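(* Assume $\partial\Omega$ is connected. Then for $u\in BV(\Omega)$, $$F(u)=\sup\Big\{\int_\Omega\psi\cdot Du^\perp\ :\ \psi\in C_c^0(\Omega;\mathbb{R}^2),\ \exists\,\varphi\in C_c^1(\Omega\times\mathbb{S}^1)\text{ such that }\underline{\theta}\cdot(\nabla_x\varphi+\psi)+f^*(\partial_\theta\varphi)\le0\text{ on }\Omega\times\mathbb{S}^1\Big\}.$$ If $\partial\Omega$ is not connected, then the same formula holds, except that the functions $\varphi$ are taken in $C^1(\Omega\times\mathbb{S}^1)$ with $\nabla\varphi\in C_c^0(\Omega\times\mathbb{S}^1;\mathbb{R}^3)$ (instead of $\varphi\in C_c^1(\Omega\times\mathbb{S}^1)$).
   Context: $\Omega\subset\mathbb{R}^2$ is a bounded open domain with Lipschitz boundary; $\mathbb{S}^1=\mathbb{R}/2\pi\mathbb{Z}$. For $\theta\in\mathbb{S}^1$, $\underline{\theta}=(\cos\theta,\sin\theta)$. Vectors of $\mathbb{R}^3$ are written $p=(p^x,p^\theta)$ with $p^x\in\mathbb{R}^2$, $p^\theta\in\mathbb{R}$. For $x\in\mathbb{R}^2$, $x^\perp=(x_2,-x_1)$; accordingly $Du^\perp=(D_2u,-D_1u)$ for the measure $Du$. $f:\mathbb{R}\to[0,+\infty]$ is convex and lower semicontinuous, and there is $\gamma>0$ with $f(t)\ge\gamma\sqrt{1+t^2}$ for all $t\in\mathbb{R}$. $f^*(y)=\sup_t(ty-f(t))$ is its convex conjugate and $f^\infty(t)=\lim_{s\to+\infty}\frac1s f(st)$ its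 recession function. Define for $\theta\in\mathbb{S}^1$, $p\in\mathbb{R}^3$: $h(\theta,p)=|p^x|f(p^\theta/|p^x|)$ if $p^x\neq0$ and $p^x\in\mathbb{R}_+\underline{\theta}$; $h(\theta,p)=f^\infty(p^\theta)$ if $p^x=0$; $h(\theta,p)=+\infty$ otherwise. $\mathcal{M}^1(\Omega\times\mathbb{S}^1;\mathbb{R}^3)$ is the space of bounded $\mathbb{R}^3$-valued Radon measures on $\Omega\times\mathbb{S}^1$. For such $\sigma=(\sigma^x,\sigma^\theta)$, $\int_{\Omega\times\mathbb{S}^1}h(\theta,\sigma):=\int_{\Omega\times\mathbb{S}^1}h\big(\theta,\frac{\sigma}{|\sigma|}\big)\,d|\sigma|$, where $\sigma/|\sigma|$ is the density of $\sigma$ with respect to its total variation $|\sigma|$. $\mathrm{div}\,\sigma=0$ means $\int\nabla\psi\cdot d\sigma=0$ for all $\psi\in C_c^1(\Omega\times\mathbb{S}^1)$. For $u\in BV(\Omega)$, $$F(u)=\inf\Big\{\int_{\Omega\times\mathbb{S}^1}h(\theta,\sigma)\ :\ \sigma\in\mathcal{M}^1(\Omega\times\mathbb{S}^1;\mathbb{R}^3),\ \mathrm{div}\,\sigma=0,\ \int_{\mathbb{S}^1}\sigma^x\,d\theta=Du^\perp\Big\},$$ where the last constraint means: for all $\varphi\in C_c^1(\Omega;\mathbb{R}^2)$, $\int_{\Omega\times\mathbb{S}^1}\varphi(x)^\perp\cdot d\sigma^x=\int_\Omega\varphi\cdot Du=-\int_\Omega u\,\mathrm{div}\,\varphi\,dx$.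 *)

theory Defs
  imports "HOL-Analysis.Analysis"
begin

text \<open>
  A bounded Radon measure with values in a Euclidean space, on the Borel space \<open>M\<close> of a
  locally closed set, is a countably additive function on \<open>sets M\<close>: finiteness of the total
  variation and regularity are automatic. Only \<open>space M\<close> and \<open>sets M\<close> are used.
\<close>

definition vector_measure :: "'a measure \<Rightarrow> ('a set \<Rightarrow> 'b::euclidean_space) \<Rightarrow> bool" where
  "vector_measure M \<sigma> \<longleftrightarrow>
     (\<forall>A::nat \<Rightarrow> 'a set. range A \<subseteq> sets M \<longrightarrow> disjoint_family A \<longrightarrow>
        (\<lambda>n. \<sigma> (A n)) sums \<sigma> (\<Union>n. A n))"

definition total_variation :: "'a measure \<Rightarrow> ('a set \<Rightarrow> 'b::euclidean_space) \<Rightarrow> 'a measure" where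
  "total_variation M \<sigma> = measure_of (space M) (sets M)
     (\<lambda>A. SUP P\<in>{P. finite P \<and> P \<subseteq> sets M \<and> disjoint P \<and> \<Union>P = A}. \<Sum>B\<in>P. ennreal (norm (\<sigma> B)))"

text \<open>The density \<open>\<sigma>/|\<sigma>|\<close>; it is unique up to \<open>|\<sigma>|\<close>-null sets.\<close>

definition polar_density ::
    "'a measure \<Rightarrow> ('a set \<Rightarrow> 'b::euclidean_space) \<Rightarrow> 'a \<Rightarrow> 'b" where
  "polar_density M \<sigma> = (SOME g. integrable (total_variation M \<sigma>) g \<and>
     (\<forall>A\<in>sets M. \<sigma> A = set_lebesgue_integral (total_variation M \<sigma>) A g))"

definition vector_integral ::
    "'a measure \<Rightarrow> ('a set \<Rightarrow> 'b::euclidean_space) \<Rightarrow> ('a \<Rightarrow> 'b) \<Rightarrow> real" where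
  "vector_integral M \<sigma> \<psi> = (\<integral>z. \<psi> z \<bullet> polar_density M \<sigma> z \<partial>total_variation M \<sigma>)"

definition compact_support :: "'a::topological_space set \<Rightarrow> ('a \<Rightarrow> 'b::zero) \<Rightarrow> bool" where
  "compact_support U g \<longleftrightarrow>
     compact (closure {z\<in>U. g z \<noteq> 0}) \<and> closure {z\<in>U. g z \<noteq> 0} \<subseteq> U"

definition C0c :: "'a::topological_space set \<Rightarrow> ('a \<Rightarrow> 'b::real_normed_vector) \<Rightarrow> bool" where
  "C0c U g \<longleftrightarrow> continuous_on U g \<and> compact_support U g"

text \<open>For open \<open>U\<close>. In finite dimension, continuity of \<open>x \<mapsto> D g(x)\<close> is the same as continuity of
  \<open>x \<mapsto> D g(x) k\<close> for each \<open>k\<close>.\<close>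

definition C1 :: "'a::euclidean_space set \<Rightarrow> ('a \<Rightarrow> 'b::real_normed_vector) \<Rightarrow> bool" where
  "C1 U g \<longleftrightarrow> (\<forall>x\<in>U. g differentiable at x) \<and>
     (\<forall>k. continuous_on U (\<lambda>x. frechet_derivative g (at x) k))"

definition C1c :: "'a::euclidean_space set \<Rightarrow> ('a \<Rightarrow> 'b::real_normed_vector) \<Rightarrow> bool" where
  "C1c U g \<longleftrightarrow> C1 U g \<and> compact_support U g"

definition gradient :: "('a::euclidean_space \<Rightarrow> real) \<Rightarrow> 'a \<Rightarrow> 'a" where
  "gradient g x = (\<Sum>b\<in>Basis. frechet_derivative g (at x) b *\<^sub>R b)"

definition divergence :: "(real^2 \<Rightarrow> real^2) \<Rightarrow> real^2 \<Rightarrow> real" where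
  "divergence \<phi> x = (\<Sum>i\<in>UNIV. frechet_derivative \<phi> (at x) (axis i 1) $ i)"

text \<open>Near each boundary point, in suitable orthonormal coordinates, the set is the strict
  subgraph of a Lipschitz function.\<close>

definition lipschitz_boundary :: "(real^2) set \<Rightarrow> bool" where
  "lipschitz_boundary \<Omega> \<longleftrightarrow> (\<forall>x0\<in>frontier \<Omega>. \<exists>r>0. \<exists>e1 e2. \<exists>g::real \<Rightarrow> real. \<exists>L.
     norm e1 = 1 \<and> norm e2 = 1 \<and> e1 \<bullet> e2 = 0 \<and> L-lipschitz_on UNIV g \<and>
     \<Omega> \<inter> ball x0 r = {y \<in> ball x0 r. y \<bullet> e2 < g (y \<bullet> e1)})"

definition perp :: "real^2 \<Rightarrow> real^2" where
  "perp x = vector [x $ 2, - (x $ 1)]"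

abbreviation borel_on :: "'a::topological_space set \<Rightarrow> 'a measure" where
  "borel_on U \<equiv> restrict_space borel U"

definition is_distr_deriv ::
    "(real^2) set \<Rightarrow> (real^2 \<Rightarrow> real) \<Rightarrow> ((real^2) set \<Rightarrow> real^2) \<Rightarrow> bool" where
  "is_distr_deriv \<Omega> u \<mu> \<longleftrightarrow> vector_measure (borel_on \<Omega>) \<mu> \<and>
     (\<forall>\<phi>::real^2 \<Rightarrow> real^2. C1c \<Omega> \<phi> \<longrightarrow>
        vector_integral (borel_on \<Omega>) \<mu> \<phi> =
          - set_lebesgue_integral lebesgue \<Omega> (\<lambda>x. u x * divergence \<phi> x))"

definition BV :: "(real^2) set \<Rightarrow> (real^2 \<Rightarrow> real) set" where
  "BV \<Omega> = {u. set_integrable lebesgue \<Omega> u \<and> (\<exists>\<mu>. is_distr_deriv \<Omega> u \<mu>)}"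

text \<open>The measure \<open>Du\<close>; its values on the Borel subsets of \<open>\<Omega>\<close> are uniquely determined.\<close>

definition BV_deriv :: "(real^2) set \<Rightarrow> (real^2 \<Rightarrow> real) \<Rightarrow> (real^2) set \<Rightarrow> real^2" where
  "BV_deriv \<Omega> u = (SOME \<mu>. is_distr_deriv \<Omega> u \<mu>)"

definition BV_deriv_perp :: "(real^2) set \<Rightarrow> (real^2 \<Rightarrow> real) \<Rightarrow> (real^2) set \<Rightarrow> real^2" where
  "BV_deriv_perp \<Omega> u A = perp (BV_deriv \<Omega> u A)"

text \<open>
  The circle \<open>\<real>/2\<pi>\<int>\<close> is realised as the unit circle of the plane through
  \<open>\<theta> \<mapsto> (cos \<theta>, sin \<theta>)\<close>, so that the vector attached to a point of the circle is the point itself.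
  Derivatives with respect to \<open>\<theta>\<close> are those of the \<open>2\<pi>\<close>-periodic lift.
\<close>

abbreviation circle :: "(real^2) set" where
  "circle \<equiv> sphere 0 1"

definition circle_pt :: "real \<Rightarrow> real^2" where
  "circle_pt \<theta> = vector [cos \<theta>, sin \<theta>]"

definition lift :: "((real^2) \<times> (real^2) \<Rightarrow> real) \<Rightarrow> (real^2) \<times> real \<Rightarrow> real" where
  "lift \<phi> = (\<lambda>(x, \<theta>). \<phi> (x, circle_pt \<theta>))"

definition C1_cyl :: "(real^2) set \<Rightarrow> ((real^2) \<times> (real^2) \<Rightarrow> real) \<Rightarrow> bool" where
  "C1_cyl \<Omega> \<phi> \<longleftrightarrow> C1 (\<Omega> \<times> UNIV) (lift \<phi>)"

definition C1c_cyl :: "(real^2) set \<Rightarrow> ((real^2) \<times> (real^2) \<Rightarrow> real) \<Rightarrow> bool" where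
  "C1c_cyl \<Omega> \<phi> \<longleftrightarrow> C1_cyl \<Omega> \<phi> \<and> compact_support (\<Omega> \<times> circle) \<phi>"

text \<open>The full gradient \<open>(\<nabla>\<^sub>x \<phi>, \<partial>\<^sub>\<theta> \<phi>)\<close>; by periodicity of the lift it does not depend on
  the angle chosen for \<open>v\<close>.\<close>

definition cyl_gradient :: "((real^2) \<times> (real^2) \<Rightarrow> real) \<Rightarrow> (real^2) \<times> (real^2) \<Rightarrow> (real^2) \<times> real" where
  "cyl_gradient \<phi> = (\<lambda>(x, v). gradient (lift \<phi>) (x, SOME \<theta>. circle_pt \<theta> = v))"

definition convex_ext :: "(real \<Rightarrow> ennreal) \<Rightarrow> bool" where
  "convex_ext f \<longleftrightarrow> (\<forall>s t a. 0 \<le> a \<and> a \<le> 1 \<longrightarrow>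
     f ((1 - a) * s + a * t) \<le> ennreal (1 - a) * f s + ennreal a * f t)"

definition lower_semicont :: "(real \<Rightarrow> ennreal) \<Rightarrow> bool" where
  "lower_semicont f \<longleftrightarrow> (\<forall>t. f t \<le> Liminf (at t) f)"

definition conjugate :: "(real \<Rightarrow> ennreal) \<Rightarrow> real \<Rightarrow> ereal" where
  "conjugate f y = (SUP t. ereal (t * y) - enn2ereal (f t))"

definition recession :: "(real \<Rightarrow> ennreal) \<Rightarrow> real \<Rightarrow> ennreal" where
  "recession f t = Lim at_top (\<lambda>s::real. f (s * t) / ennreal s)"

definition hfun :: "(real \<Rightarrow> ennreal) \<Rightarrow> real^2 \<Rightarrow> (real^2) \<times> real \<Rightarrow> ennreal" where
  "hfun f v p =
     (if fst p \<noteq> 0 \<and> (\<exists>r\<ge>0. fst p = r *\<^sub>R v) then ennreal (norm (fst p)) * f (snd p / norm (fst p))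
      else if fst p = 0 then recession f (snd p)
      else top)"

definition div_free :: "(real^2) set \<Rightarrow> (((real^2) \<times> (real^2)) set \<Rightarrow> (real^2) \<times> real) \<Rightarrow> bool" where
  "div_free \<Omega> \<sigma> \<longleftrightarrow> (\<forall>\<psi>. C1c_cyl \<Omega> \<psi> \<longrightarrow>
     vector_integral (borel_on (\<Omega> \<times> circle)) \<sigma> (cyl_gradient \<psi>) = 0)"

definition has_marginal ::
    "(real^2) set \<Rightarrow> (real^2 \<Rightarrow> real) \<Rightarrow> (((real^2) \<times> (real^2)) set \<Rightarrow> (real^2) \<times> real) \<Rightarrow> bool" where
  "has_marginal \<Omega> u \<sigma> \<longleftrightarrow> (\<forall>\<phi>::real^2 \<Rightarrow> real^2. C1c \<Omega> \<phi> \<longrightarrow>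
     vector_integral (borel_on (\<Omega> \<times> circle)) (\<lambda>A. fst (\<sigma> A)) (\<lambda>(x, v). perp (\<phi> x)) =
     vector_integral (borel_on \<Omega>) (BV_deriv \<Omega> u) \<phi>)"

definition h_integral ::
    "(real^2) set \<Rightarrow> (real \<Rightarrow> ennreal) \<Rightarrow> (((real^2) \<times> (real^2)) set \<Rightarrow> (real^2) \<times> real) \<Rightarrow> ennreal" where
  "h_integral \<Omega> f \<sigma> =
     (\<integral>\<^sup>+ z. hfun f (snd z) (polar_density (borel_on (\<Omega> \<times> circle)) \<sigma> z)
        \<partial>total_variation (borel_on (\<Omega> \<times> circle)) \<sigma>)"

definition F :: "(real^2) set \<Rightarrow> (real \<Rightarrow> ennreal) \<Rightarrow> (real^2 \<Rightarrow> real) \<Rightarrow> ennreal" where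
  "F \<Omega> f u = (INF \<sigma>\<in>{\<sigma>. vector_measure (borel_on (\<Omega> \<times> circle)) \<sigma> \<and>
                        div_free \<Omega> \<sigma> \<and> has_marginal \<Omega> u \<sigma>}. h_integral \<Omega> f \<sigma>)"

definition dual_constraint ::
    "(real^2) set \<Rightarrow> (real \<Rightarrow> ennreal) \<Rightarrow> (real^2 \<Rightarrow> real^2) \<Rightarrow> ((real^2) \<times> (real^2) \<Rightarrow> real) \<Rightarrow> bool" where
  "dual_constraint \<Omega> f \<psi> \<phi> \<longleftrightarrow> (\<forall>x\<in>\<Omega>. \<forall>v\<in>circle.
     ereal (v \<bullet> (fst (cyl_gradient \<phi> (x, v)) + \<psi> x)) + conjugate f (snd (cyl_gradient \<phi> (x, v))) \<le> 0)"

end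

theory Submission
  imports Defs "HOL-Library.Function_Algebras"
begin

text \<open>
  Write \<open>Z = \<Omega> \<times> circle\<close>. Let \<open>K\<close> be the convex set of fields \<open>\<xi> = (\<xi>\<^sup>x, \<xi>\<^sup>\<theta>)\<close> on \<open>Z\<close>
  with \<open>v \<bullet> \<xi>\<^sup>x(x, v) + f\<^sup>*(\<xi>\<^sup>\<theta>(x, v)) \<le> 0\<close>, which says that \<open>t \<mapsto> v \<bullet> \<xi>\<^sup>x + t \<xi>\<^sup>\<theta>\<close> is an affine
  minorant of \<open>f\<close>. By Fenchel-Moreau \<open>h(v, \<cdot>)\<close> is, off the origin, the support function of the
  fibre of \<open>K\<close> over \<open>v\<close> (\<open>support_le_hfun\<close>, \<open>hfun_attained\<close>). A pair \<open>(\<psi>, \<phi>)\<close> is admissible in the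
  supremum when \<open>(\<psi>, 0) + \<nabla>\<phi>\<close> lies in \<open>K\<close>, and a measure \<open>\<sigma>\<close> is admissible in the infimum when
  \<open>\<integral> ((\<psi>, 0) + \<nabla>\<phi>) \<cdot> d\<sigma> = \<integral> \<psi> \<cdot> Du\<^sup>\<bottom>\<close> for all test functions. The two problems are thus dual to each
  other.

  The supremum is at most the infimum (\<open>weak_duality\<close>), even over the larger class of potentials
  whose gradient is compactly supported: such a \<open>\<phi>\<close> is independent of the angle near the
  boundary, so up to a compactly supported function it is a function \<open>g\<close> of \<open>x\<close> alone
  (\<open>div_free_general\<close>), and \<open>\<integral> \<nabla>g \<cdot> Du\<^sup>\<bottom> = 0\<close> because a gradient is curl free
  (\<open>BV_deriv_perp_gradient\<close>). The last identity and the passage from \<open>C\<^sup>1\<close> to continuous fields in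
  the marginal constraint rest on Steklov averages.

  Conversely let \<open>S\<close> be the supremum over compactly supported potentials, assumed finite. Growth
  of \<open>f\<close> makes \<open>K\<close> contain all fields of norm at most \<open>\<gamma>\<close>, so its gauge is finite on compactly
  supported continuous fields and is bounded by a multiple of the sup norm. The assignment
  \<open>(\<psi>, 0) + \<nabla>\<phi> \<mapsto> \<integral> \<psi> \<cdot> Du\<^sup>\<bottom>\<close> is bounded by \<open>S\<close> times this gauge; Hahn-Banach extends it with the
  same bound, and Riesz represents the extension by a measure \<open>\<sigma>\<close>, which is admissible because it
  extends the given functional. Finally \<open>\<integral> \<xi> \<cdot> d\<sigma> \<le> S\<close> for continuous \<open>\<xi>\<close> in \<open>K\<close> forces
  \<open>\<integral> h(v, \<sigma>) \<le> S\<close> (\<open>h_integral_le\<close>), since \<open>h\<close> is a countable supremum of continuous sections of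
  \<open>K\<close> and measurable choices between these are approximated by continuous ones.

  The supremum over the larger class of potentials is thus squeezed between the supremum over the
  smaller class and the infimum, and the latter is at most the supremum over the smaller class; all three agree.
\<close>

section \<open>Total variation and polar density of a vector measure\<close>

text \<open>The set function that the definition of \<open>total_variation\<close> feeds to \<open>measure_of\<close>; a name of its own
  is needed until it is known to be a measure.\<close>

definition variation :: "'a measure \<Rightarrow> ('a set \<Rightarrow> 'b::euclidean_space) \<Rightarrow> 'a set \<Rightarrow> ennreal" where
  "variation M \<sigma> A =
     (SUP P\<in>{P. finite P \<and> P \<subseteq> sets M \<and> disjoint P \<and> \<Union>P = A}. \<Sum>B\<in>P. ennreal (norm (\<sigma> B)))"

lemma vector_measure_empty:
  assumes "vector_measure M \<sigma>"
  shows "\<sigma> {} = 0"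
proof -
  have "(\<lambda>n::nat. \<sigma> {}) sums \<sigma> (\<Union>n::nat. {})"
    using assms unfolding vector_measure_def by (auto simp: disjoint_family_on_def)
  hence "summable (\<lambda>n::nat. \<sigma> {})" by (rule sums_summable)
  thus ?thesis by (simp add: summable_const_iff)
qed

lemma vector_measure_sums:
  assumes "vector_measure M \<sigma>" "range A \<subseteq> sets M" "disjoint_family A"
  shows "(\<lambda>n. \<sigma> (A n)) sums \<sigma> (\<Union>n. A n)"
  using assms unfolding vector_measure_def by auto

lemma vector_measure_Un:
  assumes v: "vector_measure M \<sigma>" and "A \<in> sets M" "B \<in> sets M" "A \<inter> B = {}"
  shows "\<sigma> (A \<union> B) = \<sigma> A + \<sigma> B"
proof -
  have "(\<lambda>n. \<sigma> (binaryset A B n)) sums \<sigma> (\<Union>n. binaryset A B n)"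
    by (rule vector_measure_sums[OF v]) (use assms in \<open>auto simp: range_binaryset_eq disjoint_family_on_def binaryset_def\<close>)
  moreover have "(\<lambda>n. \<sigma> (binaryset A B n)) sums (\<sigma> A + \<sigma> B)"
    using v by (intro binaryset_sums vector_measure_empty)
  ultimately show ?thesis by (simp add: UN_binaryset_eq sums_unique2)
qed

lemma vector_measure_finite_Union:
  assumes v: "vector_measure M \<sigma>" and "finite P" "P \<subseteq> sets M" "disjoint P"
  shows "\<sigma> (\<Union>P) = (\<Sum>B\<in>P. \<sigma> B)"
  using assms(2-)
proof (induction P rule: finite_induct)
  case (insert B P)
  have "B \<inter> \<Union>P = {}" using insert by (auto simp: pairwise_insert disjnt_def)
  moreover have "\<Union>P \<in> sets M" using insert by (intro sets.finite_Union) auto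
  ultimately have "\<sigma> (B \<union> \<Union>P) = \<sigma> B + \<sigma> (\<Union>P)"
    using insert by (intro vector_measure_Un[OF v]) auto
  thus ?case using insert by (simp add: pairwise_insert)
qed (simp add: vector_measure_empty[OF v])

text \<open>Rudin's argument. Call a set bad if \<open>\<sigma>\<close> is unbounded on its subsets. A bad set splits into two
  pieces both of norm at least one, one of them bad again; iterating gives a disjoint sequence whose
  measures do not tend to zero, against countable additivity.\<close>

lemma vector_measure_bounded:
  fixes \<sigma> :: "'a set \<Rightarrow> 'b::euclidean_space"
  assumes v: "vector_measure M \<sigma>"
  obtains C where "C \<ge> 0" "\<And>A. A \<in> sets M \<Longrightarrow> norm (\<sigma> A) \<le> C"
proof -
  define bad where "bad E \<longleftrightarrow> E \<in> sets M \<and> (\<forall>C. \<exists>A\<in>sets M. A \<subseteq> E \<and> norm (\<sigma> A) > C)" for E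
  have step: "\<exists>E'. bad E' \<and> E' \<subseteq> E \<and> norm (\<sigma> (E - E')) \<ge> 1" if E: "bad E" for E
  proof -
    have "E \<in> sets M" using E bad_def by auto
    obtain A where A: "A \<in> sets M" "A \<subseteq> E" "norm (\<sigma> A) > 1 + norm (\<sigma> E)"
      using E bad_def by meson
    have "\<sigma> (A \<union> (E - A)) = \<sigma> A + \<sigma> (E - A)"
      by (rule vector_measure_Un[OF v]) (use A \<open>E \<in> sets M\<close> in auto)
    hence s: "\<sigma> E = \<sigma> A + \<sigma> (E - A)" using A by (simp add: Un_absorb1)
    have n1: "norm (\<sigma> (E - A)) \<ge> 1"
      using s A(3) norm_triangle_ineq4[of "\<sigma> E" "\<sigma> (E - A)"] by simp
    show ?thesis
    proof (cases "bad A")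
      case True thus ?thesis using n1 A by auto
    next
      case False
      then obtain C1 where C1: "\<And>B. B \<in> sets M \<Longrightarrow> B \<subseteq> A \<Longrightarrow> norm (\<sigma> B) \<le> C1"
        using A by (auto simp: bad_def not_less)
      have "bad (E - A)"
      proof (rule ccontr)
        assume "\<not> bad (E - A)"
        then obtain C2 where C2: "\<And>B. B \<in> sets M \<Longrightarrow> B \<subseteq> E - A \<Longrightarrow> norm (\<sigma> B) \<le> C2"
          using A \<open>E \<in> sets M\<close> by (auto simp: bad_def not_less)
        obtain B where B: "B \<in> sets M" "B \<subseteq> E" "norm (\<sigma> B) > C1 + C2"
          using E bad_def by meson
        have "\<sigma> ((B \<inter> A) \<union> (B - A)) = \<sigma> (B \<inter> A) + \<sigma> (B - A)"
          by (rule vector_measure_Un[OF v]) (use A B in auto)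
        hence "\<sigma> B = \<sigma> (B \<inter> A) + \<sigma> (B - A)" by (simp add: Int_Diff_Un)
        hence "norm (\<sigma> B) \<le> norm (\<sigma> (B \<inter> A)) + norm (\<sigma> (B - A))"
          by (simp add: norm_triangle_ineq)
        also have "\<dots> \<le> C1 + C2" using A B by (intro add_mono C1 C2) auto
        finally show False using B by simp
      qed
      moreover have "E - (E - A) = A" using A by auto
      ultimately show ?thesis using A(3) by (intro exI[of _ "E - A"]) (auto intro: order_trans[OF _ less_imp_le[OF A(3)]])
    qed
  qed
  have "\<not> bad (space M)"
  proof
    assume b0: "bad (space M)"
    obtain E where E0: "\<And>n. bad (E n)" and E1: "\<And>n::nat. E (Suc n) \<subseteq> E n \<and> norm (\<sigma> (E n - E (Suc n))) \<ge> 1"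
    proof -
      have "\<exists>E. \<forall>n. bad (E n) \<and> (E (Suc n) \<subseteq> E n \<and> norm (\<sigma> (E n - E (Suc n))) \<ge> 1)"
        by (rule dependent_nat_choice) (use b0 step in auto)
      thus ?thesis using that by auto
    qed
    define D where "D n = E n - E (Suc n)" for n
    have dec: "decseq E" using E1 by (auto intro!: decseq_SucI)
    have "disjoint_family D"
      unfolding disjoint_family_on_def
    proof (intro ballI impI)
      fix m n :: nat assume "m \<noteq> n"
      have *: "D i \<inter> D j = {}" if "i < j" for i j
        using decseqD[OF dec, of "Suc i" j] that by (auto simp: D_def)
      show "D m \<inter> D n = {}" using *[of m n] *[of n m] \<open>m \<noteq> n\<close> by (cases "m < n") auto
    qed
    moreover have "range D \<subseteq> sets M" using E0 by (auto simp: D_def bad_def)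
    ultimately have "(\<lambda>n. \<sigma> (D n)) sums \<sigma> (\<Union>n. D n)" by (intro vector_measure_sums[OF v])
    hence "(\<lambda>n. \<sigma> (D n)) \<longlonglongrightarrow> 0" by (intro summable_LIMSEQ_zero sums_summable)
    then obtain n where "norm (\<sigma> (D n)) < 1"
      by (metis (no_types, lifting) LIMSEQ_D diff_zero le_refl zero_less_one)
    thus False using E1[of n] by (simp add: D_def)
  qed
  then obtain C where "\<And>A. A \<in> sets M \<Longrightarrow> norm (\<sigma> A) \<le> C"
    using sets.sets_into_space unfolding bad_def by (metis not_less sets.top)
  moreover from this[of "{}"] have "C \<ge> 0" using norm_ge_zero order_trans by (meson sets.empty_sets)
  ultimately show ?thesis using that by blast
qed

lemma variation_le_sum:
  assumes "finite P" "P \<subseteq> sets M" "disjoint P" "\<Union>P = A"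
  shows "(\<Sum>B\<in>P. ennreal (norm (\<sigma> B))) \<le> variation M \<sigma> A"
  unfolding variation_def by (rule SUP_upper) (use assms in auto)

lemma norm_le_variation:
  assumes "A \<in> sets M"
  shows "ennreal (norm (\<sigma> A)) \<le> variation M \<sigma> A"
  using variation_le_sum[of "{A}" M A \<sigma>] assms by simp

text \<open>Componentwise, \<open>\<Sum>\<bar>\<sigma> B \<bullet> b\<bar>\<close> is the difference of the values of \<open>\<sigma> \<bullet> b\<close> on two unions, one of the
  pieces where it is nonnegative and one of the others, and both are controlled by the bound on \<open>\<sigma>\<close>.\<close>

lemma variation_finite:
  fixes \<sigma> :: "'a set \<Rightarrow> 'b::euclidean_space"
  assumes v: "vector_measure M \<sigma>"
  shows "variation M \<sigma> A < \<infinity>"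
proof -
  obtain C where C: "C \<ge> 0" "\<And>A. A \<in> sets M \<Longrightarrow> norm (\<sigma> A) \<le> C"
    using vector_measure_bounded[OF v] by blast
  have "(\<Sum>B\<in>P. ennreal (norm (\<sigma> B))) \<le> ennreal (real DIM('b) * (2 * C))"
    if P: "finite P" "P \<subseteq> sets M" "disjoint P" for P
  proof -
    have "(\<Sum>B\<in>P. \<bar>\<sigma> B \<bullet> b\<bar>) \<le> 2 * C" if b: "b \<in> Basis" for b
    proof -
      have half: "\<bar>\<Sum>B\<in>Q. \<sigma> B \<bullet> b\<bar> \<le> C" if "Q \<subseteq> P" for Q
      proof -
        have Q: "finite Q" "Q \<subseteq> sets M" "disjoint Q"
          using that P by (auto intro: finite_subset pairwise_subset)
        have "(\<Sum>B\<in>Q. \<sigma> B \<bullet> b) = \<sigma> (\<Union>Q) \<bullet> b"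
          using vector_measure_finite_Union[OF v Q] by (simp add: inner_sum_left)
        also have "\<bar>\<dots>\<bar> \<le> norm (\<sigma> (\<Union>Q))" using b by (simp add: Basis_le_norm)
        also have "\<dots> \<le> C" using Q by (intro C sets.finite_Union)
        finally show ?thesis .
      qed
      let ?Q = "{B\<in>P. \<sigma> B \<bullet> b \<ge> 0}"
      have "(\<Sum>B\<in>P. \<bar>\<sigma> B \<bullet> b\<bar>) = (\<Sum>B\<in>?Q. \<bar>\<sigma> B \<bullet> b\<bar>) + (\<Sum>B\<in>P - ?Q. \<bar>\<sigma> B \<bullet> b\<bar>)"
        using P by (subst add.commute) (intro sum.subset_diff; auto)
      also have "(\<Sum>B\<in>P - ?Q. \<bar>\<sigma> B \<bullet> b\<bar>) = - (\<Sum>B\<in>P - ?Q. \<sigma> B \<bullet> b)"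
        unfolding sum_negf[symmetric] by (intro sum.cong) auto
      also have "(\<Sum>B\<in>?Q. \<bar>\<sigma> B \<bullet> b\<bar>) = (\<Sum>B\<in>?Q. \<sigma> B \<bullet> b)"
        by (intro sum.cong) auto
      also have "(\<Sum>B\<in>?Q. \<sigma> B \<bullet> b) + - (\<Sum>B\<in>P - ?Q. \<sigma> B \<bullet> b)
          = (\<Sum>B\<in>?Q. \<sigma> B \<bullet> b) - (\<Sum>B\<in>P - ?Q. \<sigma> B \<bullet> b)" by simp
      also have "\<dots> \<le> 2 * C" using half[of ?Q] half[of "P - ?Q"] by auto
      finally show ?thesis .
    qed
    hence "(\<Sum>b\<in>Basis. \<Sum>B\<in>P. \<bar>\<sigma> B \<bullet> b\<bar>) \<le> real DIM('b) * (2 * C)"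
      using sum_mono[of Basis "\<lambda>b::'b. \<Sum>B\<in>P. \<bar>\<sigma> B \<bullet> b\<bar>" "\<lambda>_. 2 * C"] by simp
    moreover have "(\<Sum>B\<in>P. norm (\<sigma> B)) \<le> (\<Sum>B\<in>P. \<Sum>b\<in>Basis. \<bar>\<sigma> B \<bullet> b\<bar>)"
      by (intro sum_mono norm_le_l1)
    ultimately have "(\<Sum>B\<in>P. norm (\<sigma> B)) \<le> real DIM('b) * (2 * C)"
      by (simp add: sum.swap[of _ Basis])
    thus ?thesis by (subst sum_ennreal) (auto intro: ennreal_leI)
  qed
  hence "variation M \<sigma> A \<le> ennreal (real DIM('b) * (2 * C))"
    unfolding variation_def by (intro SUP_least) auto
  thus ?thesis using le_less_trans[OF _ ennreal_less_top] by auto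
qed

text \<open>Refining a partition of the union by the sets \<open>A n\<close> gives one inequality; joining partitions of
  disjoint sets (superadditivity) gives the other.\<close>

lemma variation_countably_additive:
  fixes \<sigma> :: "'a set \<Rightarrow> 'b::euclidean_space"
  assumes v: "vector_measure M \<sigma>" and A: "range A \<subseteq> sets M" "disjoint_family A"
  shows "(\<Sum>n. variation M \<sigma> (A n)) = variation M \<sigma> (\<Union>n. A n)"
proof (rule antisym)
  have Am[simp, measurable]: "A n \<in> sets M" for n using A by auto
  show "variation M \<sigma> (\<Union>n. A n) \<le> (\<Sum>n. variation M \<sigma> (A n))"
    unfolding variation_def[of M \<sigma> "\<Union>n. A n"]
  proof (rule SUP_least, clarify)
    fix P assume P: "finite P" "P \<subseteq> sets M" "disjoint P" "\<Union>P = (\<Union>n. A n)"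
    have 1: "ennreal (norm (\<sigma> B)) \<le> (\<Sum>n. ennreal (norm (\<sigma> (B \<inter> A n))))" if "B \<in> P" for B
    proof (cases "summable (\<lambda>n. norm (\<sigma> (B \<inter> A n)))")
      case True
      have "(\<lambda>n. \<sigma> (B \<inter> A n)) sums \<sigma> (\<Union>n. B \<inter> A n)"
        by (rule vector_measure_sums[OF v]) (use A that P in \<open>auto simp: disjoint_family_on_def\<close>)
      moreover have "(\<Union>n. B \<inter> A n) = B" using that P by auto
      ultimately have "\<sigma> B = (\<Sum>n. \<sigma> (B \<inter> A n))" by (simp add: sums_iff)
      hence "norm (\<sigma> B) \<le> (\<Sum>n. norm (\<sigma> (B \<inter> A n)))" using summable_norm[OF True] by simp
      hence "ennreal (norm (\<sigma> B)) \<le> ennreal (\<Sum>n. norm (\<sigma> (B \<inter> A n)))" by (rule ennreal_leI)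
      also have "\<dots> = (\<Sum>n. ennreal (norm (\<sigma> (B \<inter> A n))))"
        by (rule suminf_ennreal2[symmetric]) (simp_all add: True)
      finally show ?thesis .
    next
      case False
      hence "(\<Sum>n. ennreal (norm (\<sigma> (B \<inter> A n)))) = top"
        using summable_suminf_not_top[of "\<lambda>n. norm (\<sigma> (B \<inter> A n))"] by (meson norm_ge_zero)
      thus ?thesis by simp
    qed
    have 2: "(\<Sum>B\<in>P. ennreal (norm (\<sigma> (B \<inter> A n)))) \<le> variation M \<sigma> (A n)" for n
    proof -
      let ?Q = "(\<lambda>B. B \<inter> A n) ` P"
      have "(\<Sum>B\<in>P. ennreal (norm (\<sigma> (B \<inter> A n)))) = (\<Sum>C\<in>?Q. ennreal (norm (\<sigma> C)))"
      proof (subst sum.reindex_nontrivial)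
        fix B B' assume "B \<in> P" "B' \<in> P" "B \<noteq> B'" "B \<inter> A n = B' \<inter> A n"
        moreover from this have "B \<inter> B' = {}" using pairwiseD[OF P(3)] by (auto simp: disjnt_def)
        ultimately have "B \<inter> A n = {}" by blast
        thus "ennreal (norm (\<sigma> (B \<inter> A n))) = 0" by (simp add: vector_measure_empty[OF v])
      qed (use P in auto)
      also have "\<dots> \<le> variation M \<sigma> (A n)"
      proof (rule variation_le_sum)
        show "disjoint ?Q" using P(3) by (auto simp: pairwise_def disjnt_def)
        have "\<Union>?Q = \<Union>P \<inter> A n" by auto
        also have "\<dots> = A n" using P(4) by auto
        finally show "\<Union>?Q = A n" .
      qed (use P in auto)
      finally show ?thesis .
    qed
    have "(\<Sum>B\<in>P. ennreal (norm (\<sigma> B))) \<le> (\<Sum>B\<in>P. \<Sum>n. ennreal (norm (\<sigma> (B \<inter> A n))))"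
      by (intro sum_mono 1)
    also have "\<dots> = (\<Sum>n. \<Sum>B\<in>P. ennreal (norm (\<sigma> (B \<inter> A n))))"
      by (rule suminf_sum[symmetric]) auto
    also have "\<dots> \<le> (\<Sum>n. variation M \<sigma> (A n))"
      by (intro suminf_le 2) auto
    finally show "(\<Sum>B\<in>P. ennreal (norm (\<sigma> B))) \<le> (\<Sum>n. variation M \<sigma> (A n))" .
  qed
  have sup2: "variation M \<sigma> X + variation M \<sigma> Y \<le> variation M \<sigma> Z"
    if "X \<in> sets M" "Y \<in> sets M" "X \<inter> Y = {}" "X \<union> Y \<subseteq> Z" "Z \<in> sets M" for X Y Z
  proof -
    let ?S = "\<lambda>P. \<Sum>B\<in>P. ennreal (norm (\<sigma> B))"
    let ?T = "\<lambda>X. {P. finite P \<and> P \<subseteq> sets M \<and> disjoint P \<and> \<Union>P = X}"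
    have T1: "{A} \<in> ?T A" if "A \<in> sets M" for A using that by simp
    have ne: "?T X \<noteq> {}" "?T Y \<noteq> {}" using T1[OF that(1)] T1[OF that(2)] by (metis empty_iff)+
    have "?S P + ?S Q \<le> variation M \<sigma> Z" if P: "P \<in> ?T X" and Q: "Q \<in> ?T Y" for P Q
    proof -
      have XY: "\<Union>P \<inter> \<Union>Q = {}" using P Q \<open>X \<inter> Y = {}\<close> by auto
      let ?R = "insert (Z - (X \<union> Y)) (P \<union> Q)"
      have "?S P + ?S Q = ?S (P \<union> Q) + ?S (P \<inter> Q)"
        using P Q by (intro sum.union_inter[symmetric]) auto
      also have "?S (P \<inter> Q) = 0"
      proof (rule sum.neutral, rule)
        fix B assume "B \<in> P \<inter> Q" hence "B = {}" using XY by auto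
        thus "ennreal (norm (\<sigma> B)) = 0" by (simp add: vector_measure_empty[OF v])
      qed
      also have "?S (P \<union> Q) + 0 \<le> ?S ?R"
        unfolding add_0_right by (rule sum_mono2) (use P Q in simp_all, blast)
      also have "\<dots> \<le> variation M \<sigma> Z"
      proof (rule variation_le_sum)
        have "disjoint (P \<union> Q)" using P Q XY by (intro disjoint_union) auto
        moreover have "disjnt (Z - (X \<union> Y)) B" if "B \<in> P \<union> Q" for B
          using that P Q by (auto simp: disjnt_def)
        ultimately show "disjoint ?R" by (auto simp: pairwise_insert disjnt_sym)
        have "\<Union>?R = (Z - (X \<union> Y)) \<union> (\<Union>P \<union> \<Union>Q)" by auto
        also have "\<dots> = Z" using P Q \<open>X \<union> Y \<subseteq> Z\<close> by auto
        finally show "\<Union>?R = Z" .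
      qed (use P Q \<open>X \<in> sets M\<close> \<open>Y \<in> sets M\<close> \<open>Z \<in> sets M\<close> in auto)
      finally show ?thesis .
    qed
    note both = this
    have le: "?S P + variation M \<sigma> Y \<le> variation M \<sigma> Z" if P: "P \<in> ?T X" for P
    proof -
      have "?S P + variation M \<sigma> Y = (SUP Q\<in>?T Y. ?S Q + ?S P)"
        unfolding variation_def ennreal_SUP_add_left[OF ne(2)] by (rule add.commute)
      also have "\<dots> \<le> variation M \<sigma> Z"
        by (rule SUP_least, subst add.commute, rule both[OF P])
      finally show ?thesis .
    qed
    have "variation M \<sigma> X + variation M \<sigma> Y = (SUP P\<in>?T X. ?S P + variation M \<sigma> Y)"
      unfolding variation_def[of M \<sigma> X] ennreal_SUP_add_left[OF ne(1)] ..
    also have "\<dots> \<le> variation M \<sigma> Z" by (rule SUP_least, rule le)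
    finally show ?thesis .
  qed
  have fin: "(\<Sum>n<N. variation M \<sigma> (A n)) \<le> variation M \<sigma> (\<Union>n<N. A n)" for N
  proof (induction N)
    case (Suc N)
    have AN: "A n \<inter> A N = {}" if "n < N" for n
      using disjoint_family_onD[OF A(2), of n N] that by simp
    have U: "(\<Union>n<Suc N. A n) = (\<Union>n<N. A n) \<union> A N" by (simp add: lessThan_Suc Un_commute)
    have "(\<Sum>n<Suc N. variation M \<sigma> (A n)) = (\<Sum>n<N. variation M \<sigma> (A n)) + variation M \<sigma> (A N)"
      by simp
    also have "\<dots> \<le> variation M \<sigma> (\<Union>n<N. A n) + variation M \<sigma> (A N)"
      by (rule add_right_mono[OF Suc])
    also have "\<dots> \<le> variation M \<sigma> (\<Union>n<Suc N. A n)"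
      unfolding U by (rule sup2) (use AN in auto)
    finally show ?case .
  qed simp
  show "(\<Sum>n. variation M \<sigma> (A n)) \<le> variation M \<sigma> (\<Union>n. A n)"
  proof (rule suminf_le_const)
    fix N
    have "(\<Sum>n<N. variation M \<sigma> (A n)) \<le> variation M \<sigma> (\<Union>n<N. A n) + variation M \<sigma> {}"
      by (rule order_trans[OF fin]) simp
    also have "\<dots> \<le> variation M \<sigma> (\<Union>n. A n)" by (rule sup2) auto
    finally show "(\<Sum>n<N. variation M \<sigma> (A n)) \<le> variation M \<sigma> (\<Union>n. A n)" .
  qed simp
qed

lemma variation_empty:
  assumes "vector_measure M \<sigma>"
  shows "variation M \<sigma> {} = 0"
proof -
  have "(\<Sum>B\<in>P. ennreal (norm (\<sigma> B))) = 0" if "\<Union>P = {}" for P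
    using that by (intro sum.neutral) (auto simp: vector_measure_empty[OF assms])
  hence "variation M \<sigma> {} \<le> 0" unfolding variation_def by (intro SUP_least) auto
  thus ?thesis by simp
qed

lemma space_total_variation [simp]: "space (total_variation M \<sigma>) = space M"
  and sets_total_variation [simp, measurable_cong]: "sets (total_variation M \<sigma>) = sets M"
  using sets.space_closed[of M] by (simp_all add: total_variation_def)

lemma emeasure_total_variation:
  assumes "vector_measure M \<sigma>" "A \<in> sets M"
  shows "emeasure (total_variation M \<sigma>) A = variation M \<sigma> A"
proof -
  have "measure_space (space M) (sets M) (variation M \<sigma>)"
    unfolding measure_space_def
    using assms variation_countably_additive[OF assms(1)] variation_empty[OF assms(1)]
    by (auto simp: positive_def countably_additive_def sets.sigma_algebra_axioms)
  thus ?thesis unfolding total_variation_def variation_def[symmetric]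
    using assms by (intro emeasure_measure_of_sigma) (auto simp: measure_space_def)
qed

lemma finite_total_variation:
  fixes \<sigma> :: "'a set \<Rightarrow> 'b::euclidean_space"
  assumes "vector_measure M \<sigma>"
  shows "finite_measure (total_variation M \<sigma>)"
  by (rule finite_measureI)
    (use assms variation_finite[OF assms, of "space M"] in \<open>auto simp: emeasure_total_variation\<close>)

text \<open>For each basis vector \<open>b\<close> the set function \<open>\<bar>\<sigma>\<bar> + \<sigma> \<bullet> b\<close> is a positive measure that is absolutely
  continuous with respect to \<open>\<bar>\<sigma>\<bar>\<close>. Its Radon-Nikodym density minus one is the component of the
  polar density.\<close>

lemma polar_density_exists:
  fixes \<sigma> :: "'a set \<Rightarrow> 'b::euclidean_space"
  assumes v: "vector_measure M \<sigma>"
  shows "\<exists>g. integrable (total_variation M \<sigma>) g \<and>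
     (\<forall>A\<in>sets M. \<sigma> A = set_lebesgue_integral (total_variation M \<sigma>) A g)"
proof -
  let ?N = "total_variation M \<sigma>"
  interpret N: finite_measure ?N by (rule finite_total_variation[OF v])
  have le: "norm (\<sigma> A) \<le> measure ?N A" if "A \<in> sets M" for A
    using norm_le_variation[OF that, of \<sigma>]
    unfolding emeasure_total_variation[OF v that, symmetric] N.emeasure_eq_measure by simp
  have "\<exists>g. integrable ?N g \<and> (\<forall>A\<in>sets M. \<sigma> A \<bullet> b = set_lebesgue_integral ?N A g)"
    if b: "b \<in> Basis" for b
  proof -
    define m where "m A = measure ?N A + \<sigma> A \<bullet> b" for A
    have m0: "m A \<ge> 0" if "A \<in> sets M" for A
      using le[OF that] Basis_le_norm[OF b, of "\<sigma> A"] by (auto simp: m_def)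
    define Q where "Q = measure_of (space M) (sets M) (\<lambda>A. ennreal (m A))"
    have Qs[simp]: "sets Q = sets M" "space Q = space M"
      using sets.space_closed[of M] by (simp_all add: Q_def)
    have ca: "countably_additive (sets M) (\<lambda>A. ennreal (m A))"
      unfolding countably_additive_def
    proof (intro allI impI)
      fix A :: "nat \<Rightarrow> 'a set" assume A: "range A \<subseteq> sets M" "disjoint_family A"
      have "(\<lambda>n. m (A n)) sums m (\<Union>n. A n)"
        unfolding m_def using A
        by (intro sums_add N.finite_measure_UNION bounded_linear.sums[OF bounded_linear_inner_left]
              vector_measure_sums[OF v]) auto
      thus "(\<Sum>n. ennreal (m (A n))) = ennreal (m (\<Union>n. A n))"
        using A m0 by (subst suminf_ennreal2) (auto simp: sums_iff)
    qed
    have Qe: "emeasure Q A = ennreal (m A)" if "A \<in> sets M" for A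
      unfolding Q_def using ca that
      by (intro emeasure_measure_of_sigma)
         (auto simp: positive_def m_def vector_measure_empty[OF v] sets.sigma_algebra_axioms)
    have "absolutely_continuous ?N Q"
      unfolding absolutely_continuous_def
    proof
      fix A assume "A \<in> null_sets ?N"
      hence A: "A \<in> sets M" "measure ?N A = 0" by (auto simp: null_sets_def measure_def)
      hence "m A = 0" using le[OF A(1)] by (simp add: m_def)
      thus "A \<in> null_sets Q" using A Qe by (auto simp: null_sets_def)
    qed
    then obtain q where q: "q \<in> borel_measurable ?N" "density ?N q = Q"
      using N.Radon_Nikodym[of Q] by auto
    have qi: "(\<integral>\<^sup>+x. q x * indicator A x \<partial>?N) = ennreal (m A)" if "A \<in> sets M" for A
    proof -
      have "(\<integral>\<^sup>+x. q x * indicator A x \<partial>?N) = emeasure (density ?N q) A"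
        by (rule emeasure_density[symmetric]) (use q that in simp_all)
      thus ?thesis by (simp only: q(2) Qe[OF that])
    qed
    have "(\<integral>\<^sup>+x. q x \<partial>?N) = (\<integral>\<^sup>+x. q x * indicator (space M) x \<partial>?N)"
      by (rule nn_integral_cong) simp
    also have "\<dots> = ennreal (m (space M))" by (rule qi) simp
    finally have "(\<integral>\<^sup>+x. q x \<partial>?N) \<noteq> \<infinity>" by simp
    hence qf: "AE x in ?N. q x \<noteq> \<infinity>"
      by (rule nn_integral_PInf_AE[OF q(1)])
    define r where "r x = enn2real (q x)" for x
    have qr: "AE x in ?N. q x = ennreal (r x)"
      using qf by eventually_elim (auto simp: r_def less_top)
    have rm[measurable]: "r \<in> borel_measurable ?N" unfolding r_def using q by measurable
    have ri: "integrable ?N (\<lambda>x. indicator A x *\<^sub>R r x) \<and> (\<integral>x. indicator A x *\<^sub>R r x \<partial>?N) = m A" if "A \<in> sets M" for A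
    proof -
      have "(\<integral>\<^sup>+x. ennreal (indicator A x *\<^sub>R r x) \<partial>?N) = (\<integral>\<^sup>+x. q x * indicator A x \<partial>?N)"
        by (rule nn_integral_cong_AE) (use qr in \<open>eventually_elim, auto split: split_indicator\<close>)
      also have "\<dots> = ennreal (m A)" by (rule qi[OF that])
      finally have "has_bochner_integral ?N (\<lambda>x. indicator A x *\<^sub>R r x) (m A)"
        using that m0[OF that]
        by (intro has_bochner_integral_nn_integral borel_measurable_scaleR borel_measurable_indicator rm)
          (auto simp: r_def)
      thus ?thesis unfolding has_bochner_integral_iff .
    qed
    have "integrable ?N (\<lambda>x. indicator (space M) x *\<^sub>R r x)" using ri[of "space M"] by simp
    hence ri0: "integrable ?N r"
      by (rule Bochner_Integration.integrable_cong[THEN iffD1, rotated 2]) simp_all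
    have "\<sigma> A \<bullet> b = set_lebesgue_integral ?N A (\<lambda>x. r x - 1)" if "A \<in> sets M" for A
    proof -
      have "set_lebesgue_integral ?N A (\<lambda>x. r x - 1) = m A - measure ?N A"
        unfolding set_lebesgue_integral_def scaleR_diff_right
        using ri[OF that] that
        by (subst Bochner_Integration.integral_diff) (auto simp: N.emeasure_eq_measure Int_absorb2 sets.sets_into_space)
      thus ?thesis by (simp add: m_def)
    qed
    moreover have "integrable ?N (\<lambda>x. r x - 1)"
      by (intro Bochner_Integration.integrable_diff ri0 N.integrable_const)
    ultimately show ?thesis by (intro exI[of _ "\<lambda>x. r x - 1"] conjI ballI)
  qed
  note ex = this
  define g where "g b = (SOME g. integrable ?N g \<and>
    (\<forall>A\<in>sets M. \<sigma> A \<bullet> b = set_lebesgue_integral ?N A g))" for b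
  have g: "integrable ?N (g b)" "A \<in> sets M \<Longrightarrow> \<sigma> A \<bullet> b = set_lebesgue_integral ?N A (g b)"
    if "b \<in> Basis" for b A
    using someI_ex[OF ex[OF that]] unfolding g_def by auto
  define G where "G x = (\<Sum>b\<in>Basis. g b x *\<^sub>R b)" for x
  have "integrable ?N G" unfolding G_def using g by auto
  moreover have "\<sigma> A = set_lebesgue_integral ?N A G" if "A \<in> sets M" for A
  proof -
    have int: "integrable ?N (\<lambda>x. indicator A x *\<^sub>R g b x)" if "b \<in> Basis" for b
      using g(1)[OF that] \<open>A \<in> sets M\<close> by (intro integrable_mult_indicator) auto
    have "set_lebesgue_integral ?N A G
        = (\<integral>x. (\<Sum>b\<in>Basis. (indicator A x *\<^sub>R g b x) *\<^sub>R b) \<partial>?N)"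
      unfolding set_lebesgue_integral_def G_def scaleR_sum_right scaleR_scaleR real_scaleR_def ..
    also have "\<dots> = (\<Sum>b\<in>Basis. \<integral>x. (indicator A x *\<^sub>R g b x) *\<^sub>R b \<partial>?N)"
      by (intro Bochner_Integration.integral_sum integrable_scaleR_left int)
    also have "\<dots> = (\<Sum>b\<in>Basis. (\<sigma> A \<bullet> b) *\<^sub>R b)"
    proof (rule sum.cong[OF refl])
      fix b :: 'b assume b: "b \<in> Basis"
      have "(\<integral>x. (indicator A x *\<^sub>R g b x) *\<^sub>R b \<partial>?N) = (\<integral>x. indicator A x *\<^sub>R g b x \<partial>?N) *\<^sub>R b"
        by (rule integral_scaleR_left) (rule int[OF b])
      thus "(\<integral>x. (indicator A x *\<^sub>R g b x) *\<^sub>R b \<partial>?N) = (\<sigma> A \<bullet> b) *\<^sub>R b"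
        unfolding g(2)[OF b that] set_lebesgue_integral_def .
    qed
    also have "\<dots> = \<sigma> A" by (rule euclidean_representation)
    finally show ?thesis by simp
  qed
  ultimately show ?thesis by blast
qed

lemma polar_density:
  assumes "vector_measure M \<sigma>"
  shows integrable_polar_density: "integrable (total_variation M \<sigma>) (polar_density M \<sigma>)"
    and set_integral_polar_density:
      "A \<in> sets M \<Longrightarrow> \<sigma> A = set_lebesgue_integral (total_variation M \<sigma>) A (polar_density M \<sigma>)"
proof -
  note s = someI_ex[OF polar_density_exists[OF assms], folded polar_density_def]
  show "integrable (total_variation M \<sigma>) (polar_density M \<sigma>)" by (rule conjunct1[OF s])
  show "\<sigma> A = set_lebesgue_integral (total_variation M \<sigma>) A (polar_density M \<sigma>)"
    if "A \<in> sets M" by (rule bspec[OF conjunct2[OF s] that])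
qed

text \<open>On subsets of the zero set of the density \<open>\<sigma>\<close> vanishes, hence so does its variation.\<close>

lemma polar_density_nonzero:
  assumes v: "vector_measure M \<sigma>"
  shows "AE z in total_variation M \<sigma>. polar_density M \<sigma> z \<noteq> 0"
proof -
  let ?N = "total_variation M \<sigma>" and ?g = "polar_density M \<sigma>"
  have [measurable]: "?g \<in> borel_measurable ?N"
    using integrable_polar_density[OF v] by auto
  define Z where "Z = {z \<in> space ?N. ?g z = 0}"
  have "Z \<in> sets ?N" unfolding Z_def by measurable
  hence Z: "Z \<in> sets M" by simp
  have "\<sigma> B = 0" if "B \<subseteq> Z" "B \<in> sets M" for B
  proof -
    have "\<sigma> B = (\<integral>x. indicator B x *\<^sub>R ?g x \<partial>?N)"
      using set_integral_polar_density[OF v that(2)] by (simp add: set_lebesgue_integral_def)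
    also have "\<dots> = (\<integral>x. 0 \<partial>?N)"
      using that by (intro Bochner_Integration.integral_cong) (auto simp: Z_def indicator_def)
    finally show ?thesis by simp
  qed
  hence "(\<Sum>B\<in>P. ennreal (norm (\<sigma> B))) = 0" if "P \<subseteq> sets M" "\<Union>P = Z" for P
    using that by (intro sum.neutral) (auto simp: Union_upper)
  hence "variation M \<sigma> Z \<le> 0" unfolding variation_def by (intro SUP_least) auto
  hence "emeasure ?N Z = 0" using emeasure_total_variation[OF v Z] by simp
  hence "Z \<in> null_sets ?N" using \<open>Z \<in> sets ?N\<close> by (intro null_setsI)
  thus ?thesis by (rule AE_I') (auto simp: Z_def)
qed


section \<open>Integration against a vector measure\<close>

definition bounded_measurable :: "'a measure \<Rightarrow> ('a \<Rightarrow> 'b::euclidean_space) \<Rightarrow> bool" where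
  "bounded_measurable M s \<longleftrightarrow> s \<in> borel_measurable M \<and> (\<exists>B. \<forall>x\<in>space M. norm (s x) \<le> B)"

lemma bounded_measurableI:
  "s \<in> borel_measurable M \<Longrightarrow> (\<And>x. x \<in> space M \<Longrightarrow> norm (s x) \<le> B) \<Longrightarrow> bounded_measurable M s"
  unfolding bounded_measurable_def by blast

lemma bounded_measurable_add:
  assumes "bounded_measurable M s" "bounded_measurable M t"
  shows "bounded_measurable M (\<lambda>x. s x + t x)"
proof -
  obtain B B' where "\<forall>x\<in>space M. norm (s x) \<le> B" "\<forall>x\<in>space M. norm (t x) \<le> B'"
    using assms unfolding bounded_measurable_def by blast
  hence "norm (s x + t x) \<le> B + B'" if "x \<in> space M" for x
    using that by (intro norm_triangle_le add_mono) auto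
  thus ?thesis using assms unfolding bounded_measurable_def by (blast intro: borel_measurable_add)
qed

lemma bounded_measurable_mult_left:
  fixes s :: "'a \<Rightarrow> real"
  assumes "bounded_measurable M s"
  shows "bounded_measurable M (\<lambda>x. c * s x)"
proof -
  obtain B where B: "\<forall>x\<in>space M. norm (s x) \<le> B"
    using assms unfolding bounded_measurable_def by blast
  have [measurable]: "s \<in> borel_measurable M" using assms bounded_measurable_def by blast
  show ?thesis
    by (rule bounded_measurableI[where B="\<bar>c\<bar> * B"])
       (use B in \<open>auto simp: abs_mult intro: mult_left_mono\<close>)
qed

lemma bounded_measurable_indicator:
  "A \<in> sets M \<Longrightarrow> bounded_measurable M (\<lambda>x. indicator A x :: real)"
  by (rule bounded_measurableI[where B=1]) (auto simp: indicator_def)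

lemma bounded_measurable_inner_const:
  assumes "bounded_measurable M \<psi>" "b \<in> Basis"
  shows "bounded_measurable M (\<lambda>x. \<psi> x \<bullet> b)"
proof -
  obtain B where B: "\<forall>x\<in>space M. norm (\<psi> x) \<le> B" and [measurable]: "\<psi> \<in> borel_measurable M"
    using assms unfolding bounded_measurable_def by blast
  show ?thesis
    by (rule bounded_measurableI[where B=B])
      (use B Basis_le_norm[OF assms(2)] order_trans in \<open>auto, blast\<close>)
qed

text \<open>Bounded measurable functions are uniform limits of finite combinations of indicators: round
  \<open>s\<close> down to multiples of \<open>1 / n\<close>.\<close>

lemma bounded_functional_eq_0:
  fixes D :: "('a \<Rightarrow> real) \<Rightarrow> real"
  assumes add: "\<And>s t. bounded_measurable M s \<Longrightarrow> bounded_measurable M t \<Longrightarrow> D (\<lambda>x. s x + t x) = D s + D t"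
    and scale: "\<And>s c. bounded_measurable M s \<Longrightarrow> D (\<lambda>x. c * s x) = c * D s"
    and bound: "\<And>s B. s \<in> borel_measurable M \<Longrightarrow> 0 \<le> B \<Longrightarrow> (\<And>x. x \<in> space M \<Longrightarrow> \<bar>s x\<bar> \<le> B) \<Longrightarrow> \<bar>D s\<bar> \<le> C * B"
    and ind: "\<And>A. A \<in> sets M \<Longrightarrow> D (\<lambda>x. indicator A x) = 0"
    and s: "bounded_measurable M s"
  shows "D s = 0"
proof -
  have [measurable]: "s \<in> borel_measurable M" using s bounded_measurable_def by blast
  obtain B where B: "\<And>x. x \<in> space M \<Longrightarrow> \<bar>s x\<bar> \<le> B"
    using s unfolding bounded_measurable_def by auto
  have simple: "bounded_measurable M (\<lambda>x. \<Sum>k\<in>K. c k * indicator (A k) x) \<and>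
      D (\<lambda>x. \<Sum>k\<in>K. c k * indicator (A k) x) = 0"
    if "finite K" "\<And>k. A k \<in> sets M" for K :: "int set" and c A
    using that(1)
  proof (induction K rule: finite_induct)
    case empty
    have "bounded_measurable M (\<lambda>x. 0 :: real)" by (rule bounded_measurableI[where B=0]) auto
    moreover have "D (\<lambda>x. 0) = 0" using scale[OF calculation, of 0] by simp
    ultimately show ?case by simp
  next
    case (insert k K)
    have b: "bounded_measurable M (\<lambda>x. c k * indicator (A k) x)"
      by (intro bounded_measurable_mult_left bounded_measurable_indicator that)
    have Dk: "D (\<lambda>x. c k * indicator (A k) x) = 0"
      using scale[OF bounded_measurable_indicator[OF that(2)]] ind[OF that(2)] by simp
    have IH: "bounded_measurable M (\<lambda>x. \<Sum>k\<in>K. c k * indicator (A k) x)"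
      "D (\<lambda>x. \<Sum>k\<in>K. c k * indicator (A k) x) = 0" using insert.IH by (rule conjunct1, rule conjunct2)
    have "D (\<lambda>x. c k * indicator (A k) x + (\<Sum>k\<in>K. c k * indicator (A k) x)) = 0"
      unfolding add[OF b IH(1)] IH(2) Dk by (rule add_0_right)
    thus ?case unfolding sum.insert[OF insert.hyps] using bounded_measurable_add[OF b IH(1)] by (intro conjI)
  qed
  have "\<bar>D s\<bar> \<le> C * (1 / real n)" if n: "n > 0" for n :: nat
  proof -
    define N where "N = \<lceil>real n * B\<rceil> + 1"
    define A where "A k = {x \<in> space M. \<lfloor>real n * s x\<rfloor> = k}" for k
    have A: "A k \<in> sets M" for k unfolding A_def by measurable
    define t where "t = (\<lambda>x. \<Sum>k\<in>{-N..N}. (real_of_int k / real n) * indicator (A k) x)"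
    have t: "bounded_measurable M t" "D t = 0"
      unfolding t_def using simple[OF finite_atLeastAtMost_int A] by (rule conjunct1, rule conjunct2)
    have tx: "t x = \<lfloor>real n * s x\<rfloor> / real n" if x: "x \<in> space M" for x
    proof -
      have "\<bar>real n * s x\<bar> \<le> real n * B" using mult_left_mono[OF B[OF x], of "real n"] by (simp add: abs_mult)
      hence k: "\<lfloor>real n * s x\<rfloor> \<in> {-N..N}" unfolding N_def atLeastAtMost_iff by linarith
      have "t x = (\<Sum>k\<in>{-N..N}. if k = \<lfloor>real n * s x\<rfloor> then real_of_int k / real n else 0)"
        unfolding t_def by (rule sum.cong) (use x in \<open>auto simp: A_def indicator_def\<close>)
      also have "\<dots> = \<lfloor>real n * s x\<rfloor> / real n" using k by (subst sum.delta) auto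
      finally show ?thesis .
    qed
    have close: "\<bar>s x + (-1) * t x\<bar> \<le> 1 / real n" if x: "x \<in> space M" for x
    proof -
      have "s x + (-1) * t x = (real n * s x - \<lfloor>real n * s x\<rfloor>) / real n"
        using n tx[OF x] by (simp add: field_simps)
      moreover have "\<bar>real n * s x - \<lfloor>real n * s x\<rfloor>\<bar> \<le> 1" by linarith
      ultimately show ?thesis using n by (simp add: divide_right_mono)
    qed
    have t': "bounded_measurable M (\<lambda>x. (-1) * t x)" by (rule bounded_measurable_mult_left[OF t(1)])
    have "D (\<lambda>x. s x + (-1) * t x) = D s"
      using add[OF s t'] scale[OF t(1), of "-1"] t(2) by simp
    moreover have "\<bar>D (\<lambda>x. s x + (-1) * t x)\<bar> \<le> C * (1 / real n)"
      using bounded_measurable_add[OF s t'] close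
      by (intro bound) (auto simp: bounded_measurable_def)
    ultimately show ?thesis by simp
  qed
  hence "\<bar>D s\<bar> \<le> C * (1 / real (Suc n))" for n by blast
  moreover have "(\<lambda>n. C * (1 / real (Suc n))) \<longlonglongrightarrow> C * 0"
    by (intro tendsto_mult tendsto_const lim_1_over_n[THEN LIMSEQ_Suc])
  ultimately have "\<bar>D s\<bar> \<le> C * 0" by (intro LIMSEQ_le_const) auto
  thus ?thesis by simp
qed

lemma bounded_measurable_mult_integrable:
  fixes g :: "'a \<Rightarrow> real"
  assumes g: "integrable N g" and s: "s \<in> borel_measurable N" and B: "\<And>x. x \<in> space N \<Longrightarrow> \<bar>s x\<bar> \<le> B"
  shows "integrable N (\<lambda>x. s x * g x)" "\<bar>\<integral>x. s x * g x \<partial>N\<bar> \<le> (\<integral>x. \<bar>g x\<bar> \<partial>N) * B"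
proof -
  have [measurable]: "g \<in> borel_measurable N" "s \<in> borel_measurable N" using g s by auto
  have le: "\<bar>s x * g x\<bar> \<le> \<bar>g x\<bar> * B" if "x \<in> space N" for x
    using mult_right_mono[OF B[OF that], of "\<bar>g x\<bar>"] by (simp add: abs_mult mult.commute)
  have i: "integrable N (\<lambda>x. \<bar>g x\<bar> * B)" using g by simp
  show I: "integrable N (\<lambda>x. s x * g x)"
    by (rule Bochner_Integration.integrable_bound[OF i]) (use le in \<open>auto intro!: AE_I2 intro: order_trans[OF _ abs_ge_self]\<close>)
  have "\<bar>\<integral>x. s x * g x \<partial>N\<bar> \<le> (\<integral>x. \<bar>s x * g x\<bar> \<partial>N)" by (rule integral_abs_bound)
  also have "\<dots> \<le> (\<integral>x. \<bar>g x\<bar> * B \<partial>N)" using I i le by (intro integral_mono) auto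
  finally show "\<bar>\<integral>x. s x * g x \<partial>N\<bar> \<le> (\<integral>x. \<bar>g x\<bar> \<partial>N) * B" by simp
qed

text \<open>Identifies the integral against a component of \<open>\<sigma>\<close> with any other functional that agrees with it on
  indicators. Here \<open>J\<close> will be integration against another density, or a difference of two positive
  integrals.\<close>

lemma component_integral_unique:
  fixes \<sigma> :: "'a set \<Rightarrow> 'b::euclidean_space"
  assumes v: "vector_measure M \<sigma>" and b: "b \<in> Basis"
    and add: "\<And>s t. bounded_measurable M s \<Longrightarrow> bounded_measurable M t \<Longrightarrow> J (\<lambda>x. s x + t x) = J s + J t"
    and scale: "\<And>s c. bounded_measurable M s \<Longrightarrow> J (\<lambda>x. c * s x) = c * J s"
    and bound: "\<And>s B. s \<in> borel_measurable M \<Longrightarrow> 0 \<le> B \<Longrightarrow> (\<And>x. x \<in> space M \<Longrightarrow> \<bar>s x\<bar> \<le> B) \<Longrightarrow> \<bar>J s\<bar> \<le> C * B"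
    and ind: "\<And>A. A \<in> sets M \<Longrightarrow> J (\<lambda>x. indicator A x) = \<sigma> A \<bullet> b"
    and s: "bounded_measurable M s"
  shows "(\<integral>z. s z * (polar_density M \<sigma> z \<bullet> b) \<partial>total_variation M \<sigma>) = J s"
proof -
  let ?N = "total_variation M \<sigma>" and ?g = "\<lambda>z. polar_density M \<sigma> z \<bullet> b"
  have g: "integrable ?N ?g" by (intro integrable_inner_left integrable_polar_density[OF v])
  have int: "integrable ?N (\<lambda>z. s z * ?g z)" if "bounded_measurable M s" for s
    using that bounded_measurable_mult_integrable(1)[OF g, of s]
    by (auto simp: bounded_measurable_def measurable_cong_sets[OF sets_total_variation refl])
  define D where "D s = (\<integral>z. s z * ?g z \<partial>?N) - J s" for s
  have "D s = 0"
  proof (rule bounded_functional_eq_0[where D=D and s=s and M=M and C="(\<integral>x. \<bar>?g x\<bar> \<partial>?N) + C"])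
    fix s t :: "'a \<Rightarrow> real" assume st: "bounded_measurable M s" "bounded_measurable M t"
    show "D (\<lambda>x. s x + t x) = D s + D t"
      unfolding D_def add[OF st] distrib_right
      by (subst Bochner_Integration.integral_add[OF int[OF st(1)] int[OF st(2)]]) simp
  next
    fix s :: "'a \<Rightarrow> real" and c assume st: "bounded_measurable M s"
    show "D (\<lambda>x. c * s x) = c * D s"
      unfolding D_def scale[OF st] mult.assoc integral_mult_right_zero by (simp add: right_diff_distrib)
  next
    fix s :: "'a \<Rightarrow> real" and B :: real
    assume s: "s \<in> borel_measurable M" "0 \<le> B" "\<And>x. x \<in> space M \<Longrightarrow> \<bar>s x\<bar> \<le> B"
    have "\<bar>\<integral>z. s z * ?g z \<partial>?N\<bar> \<le> (\<integral>x. \<bar>?g x\<bar> \<partial>?N) * B"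
      using s by (intro bounded_measurable_mult_integrable(2)[OF g]) (auto simp: measurable_cong_sets[OF sets_total_variation refl])
    moreover have "\<bar>J s\<bar> \<le> C * B" by (rule bound[OF s])
    ultimately show "\<bar>D s\<bar> \<le> ((\<integral>x. \<bar>?g x\<bar> \<partial>?N) + C) * B"
      unfolding D_def distrib_right by linarith
  next
    fix A assume A: "A \<in> sets M"
    have i: "integrable ?N (\<lambda>z. indicator A z *\<^sub>R polar_density M \<sigma> z)"
      using A by (intro integrable_mult_indicator integrable_polar_density[OF v]) simp
    have "\<sigma> A \<bullet> b = (\<integral>z. indicator A z *\<^sub>R polar_density M \<sigma> z \<partial>?N) \<bullet> b"
      by (simp only: set_integral_polar_density[OF v A] set_lebesgue_integral_def)
    also have "\<dots> = (\<integral>z. (indicator A z *\<^sub>R polar_density M \<sigma> z) \<bullet> b \<partial>?N)"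
      by (rule integral_inner_left[symmetric]) (rule i)
    finally show "D (\<lambda>x. indicator A x) = 0"
      unfolding D_def ind[OF A] inner_scaleR_left by simp
  qed (rule s)
  thus ?thesis by (simp add: D_def)
qed

text \<open>\<open>euclidean_inner\<close> for functions, since unfolding it pointwise would also rewrite the products of
  coordinates that it produces.\<close>

lemma euclidean_inner_fun:
  "(\<lambda>z. \<psi> z \<bullet> h z) = (\<lambda>z. \<Sum>b\<in>Basis. (\<psi> z \<bullet> b) * (h z \<bullet> b))"
  by (rule ext) (rule euclidean_inner)

lemma vector_integral_components:
  fixes \<sigma> :: "'a set \<Rightarrow> 'b::euclidean_space"
  assumes v: "vector_measure M \<sigma>" and \<psi>: "bounded_measurable M \<psi>"
  shows "vector_integral M \<sigma> \<psi> =
    (\<Sum>b\<in>Basis. \<integral>z. (\<psi> z \<bullet> b) * (polar_density M \<sigma> z \<bullet> b) \<partial>total_variation M \<sigma>)"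
    and "integrable (total_variation M \<sigma>) (\<lambda>z. \<psi> z \<bullet> polar_density M \<sigma> z)"
proof -
  let ?N = "total_variation M \<sigma>" and ?g = "polar_density M \<sigma>"
  have int: "integrable ?N (\<lambda>z. (\<psi> z \<bullet> b) * (?g z \<bullet> b))" if b: "b \<in> Basis" for b
  proof -
    obtain B where B: "(\<lambda>z. \<psi> z \<bullet> b) \<in> borel_measurable M" "\<forall>x\<in>space M. \<bar>\<psi> x \<bullet> b\<bar> \<le> B"
      using bounded_measurable_inner_const[OF \<psi> b] unfolding bounded_measurable_def by auto
    show ?thesis
      by (rule bounded_measurable_mult_integrable(1)[where B=B])
        (use B in \<open>auto simp: measurable_cong_sets[OF sets_total_variation refl] intro!: integrable_polar_density[OF v]\<close>)
  qed
  show "vector_integral M \<sigma> \<psi> = (\<Sum>b\<in>Basis. \<integral>z. (\<psi> z \<bullet> b) * (?g z \<bullet> b) \<partial>?N)"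
    unfolding vector_integral_def euclidean_inner_fun[of \<psi> ?g]
    by (rule Bochner_Integration.integral_sum) (rule int)
  show "integrable ?N (\<lambda>z. \<psi> z \<bullet> ?g z)"
    unfolding euclidean_inner_fun[of \<psi> ?g] by (rule Bochner_Integration.integrable_sum) (rule int)
qed

lemma vector_measure_linear_image:
  assumes v: "vector_measure M \<sigma>" and T: "bounded_linear T"
  shows "vector_measure M (\<lambda>A. T (\<sigma> A))"
  using v bounded_linear.sums[OF T] unfolding vector_measure_def by blast

text \<open>The integral against \<open>T \<circ> \<sigma>\<close> uses the total variation and polar density of that measure; the
  adjoint \<open>T'\<close> expresses it through those of \<open>\<sigma>\<close>. It serves for the first projection, which
  relates \<open>\<sigma>\<^sup>x\<close> to \<open>\<sigma>\<close>, and for \<open>perp\<close>, which relates \<open>Du\<^sup>\<bottom>\<close> to \<open>Du\<close>.\<close>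

lemma vector_integral_linear_image:
  fixes T :: "'b::euclidean_space \<Rightarrow> 'c::euclidean_space"
  assumes v: "vector_measure M \<sigma>" and T: "bounded_linear T"
    and T': "\<And>x y. T x \<bullet> y = x \<bullet> T' y" and \<psi>: "bounded_measurable M \<psi>"
  shows "vector_integral M (\<lambda>A. T (\<sigma> A)) \<psi> = vector_integral M \<sigma> (\<lambda>z. T' (\<psi> z))"
proof -
  let ?N = "total_variation M \<sigma>" and ?g = "polar_density M \<sigma>"
  note v' = vector_measure_linear_image[OF v T]
  have gT: "integrable ?N (\<lambda>z. T (?g z))"
    by (rule integrable_bounded_linear[OF T integrable_polar_density[OF v]])
  have g: "integrable ?N (\<lambda>z. T (?g z) \<bullet> b)" for b
    by (intro integrable_inner_left gT)
  have int: "integrable ?N (\<lambda>z. s z * (T (?g z) \<bullet> b))" if "bounded_measurable M s" for s b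
    using that bounded_measurable_mult_integrable(1)[OF g, of s]
    by (auto simp: bounded_measurable_def measurable_cong_sets[OF sets_total_variation refl])
  have comp: "(\<integral>z. s z * (polar_density M (\<lambda>A. T (\<sigma> A)) z \<bullet> b) \<partial>total_variation M (\<lambda>A. T (\<sigma> A)))
      = (\<integral>z. s z * (T (?g z) \<bullet> b) \<partial>?N)" if b: "b \<in> Basis" and s: "bounded_measurable M s" for b s
  proof (rule component_integral_unique[OF v' b, where s=s and J="\<lambda>s. \<integral>z. s z * (T (?g z) \<bullet> b) \<partial>?N" and C="\<integral>x. \<bar>T (?g x) \<bullet> b\<bar> \<partial>?N"])
    fix s t :: "'a \<Rightarrow> real" assume st: "bounded_measurable M s" "bounded_measurable M t"
    show "(\<integral>z. (s z + t z) * (T (?g z) \<bullet> b) \<partial>?N) = (\<integral>z. s z * (T (?g z) \<bullet> b) \<partial>?N) + (\<integral>z. t z * (T (?g z) \<bullet> b) \<partial>?N)"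
      unfolding distrib_right by (rule Bochner_Integration.integral_add[OF int[OF st(1)] int[OF st(2)]])
  next
    fix s :: "'a \<Rightarrow> real" and c
    show "(\<integral>z. c * s z * (T (?g z) \<bullet> b) \<partial>?N) = c * (\<integral>z. s z * (T (?g z) \<bullet> b) \<partial>?N)"
      unfolding mult.assoc by (rule integral_mult_right_zero)
  next
    fix s :: "'a \<Rightarrow> real" and B :: real
    assume s: "s \<in> borel_measurable M" "0 \<le> B" "\<And>x. x \<in> space M \<Longrightarrow> \<bar>s x\<bar> \<le> B"
    show "\<bar>\<integral>z. s z * (T (?g z) \<bullet> b) \<partial>?N\<bar> \<le> (\<integral>x. \<bar>T (?g x) \<bullet> b\<bar> \<partial>?N) * B"
      using s by (intro bounded_measurable_mult_integrable(2)[OF g]) (auto simp: measurable_cong_sets[OF sets_total_variation refl])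
  next
    fix A assume A: "A \<in> sets M"
    have i: "integrable ?N (\<lambda>z. indicator A z *\<^sub>R ?g z)"
      using A by (intro integrable_mult_indicator integrable_polar_density[OF v]) simp
    have i': "integrable ?N (\<lambda>z. indicator A z *\<^sub>R T (?g z))"
      using A by (intro integrable_mult_indicator gT) simp
    have "T (\<sigma> A) = (\<integral>z. T (indicator A z *\<^sub>R ?g z) \<partial>?N)"
      unfolding set_integral_polar_density[OF v A] set_lebesgue_integral_def
      by (rule integral_bounded_linear[OF T i, symmetric])
    also have "\<dots> = (\<integral>z. indicator A z *\<^sub>R T (?g z) \<partial>?N)"
      by (simp only: linear_simps(5)[OF T])
    finally have "T (\<sigma> A) \<bullet> b = (\<integral>z. (indicator A z *\<^sub>R T (?g z)) \<bullet> b \<partial>?N)"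
      by (simp only: integral_inner_left[OF i'])
    thus "(\<integral>z. indicator A z * (T (?g z) \<bullet> b) \<partial>?N) = T (\<sigma> A) \<bullet> b" by simp
  qed (rule s)
  have "vector_integral M (\<lambda>A. T (\<sigma> A)) \<psi> = (\<Sum>b\<in>Basis. \<integral>z. (\<psi> z \<bullet> b) * (T (?g z) \<bullet> b) \<partial>?N)"
    unfolding vector_integral_components(1)[OF v' \<psi>]
    by (intro sum.cong refl comp bounded_measurable_inner_const[OF \<psi>])
  also have "\<dots> = (\<integral>z. \<psi> z \<bullet> T (?g z) \<partial>?N)"
    unfolding euclidean_inner_fun[of \<psi> "\<lambda>z. T (?g z)"]
    by (rule Bochner_Integration.integral_sum[symmetric]) (intro int bounded_measurable_inner_const[OF \<psi>])
  also have "\<dots> = vector_integral M \<sigma> (\<lambda>z. T' (\<psi> z))"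
    unfolding vector_integral_def
  proof (rule Bochner_Integration.integral_cong[OF refl])
    show "\<psi> z \<bullet> T (?g z) = T' (\<psi> z) \<bullet> ?g z" for z
      using T'[of "?g z" "\<psi> z"] by (simp only: inner_commute)
  qed
  finally show ?thesis .
qed

lemma vector_integral_add:
  assumes v: "vector_measure M \<sigma>" and "bounded_measurable M \<phi>" "bounded_measurable M \<psi>"
  shows "vector_integral M \<sigma> (\<lambda>z. \<phi> z + \<psi> z) = vector_integral M \<sigma> \<phi> + vector_integral M \<sigma> \<psi>"
  unfolding vector_integral_def inner_add_left
  by (rule Bochner_Integration.integral_add) (rule vector_integral_components(2)[OF v]; fact)+

lemma vector_integral_scaleR:
  "vector_integral M \<sigma> (\<lambda>z. c *\<^sub>R \<psi> z) = c * vector_integral M \<sigma> \<psi>"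
  unfolding vector_integral_def inner_scaleR_left by (rule integral_mult_right_zero)

lemma vector_integral_bound:
  assumes v: "vector_measure M \<sigma>" and m: "\<psi> \<in> borel_measurable M"
    and B: "\<And>z. z \<in> space M \<Longrightarrow> norm (\<psi> z) \<le> B"
  shows "\<bar>vector_integral M \<sigma> \<psi>\<bar> \<le> B * (\<integral>z. norm (polar_density M \<sigma> z) \<partial>total_variation M \<sigma>)"
proof -
  let ?N = "total_variation M \<sigma>" and ?g = "polar_density M \<sigma>"
  have "\<bar>\<integral>z. \<psi> z \<bullet> ?g z \<partial>?N\<bar> \<le> (\<integral>z. \<bar>\<psi> z \<bullet> ?g z\<bar> \<partial>?N)" by (rule integral_abs_bound)
  also have "\<dots> \<le> (\<integral>z. B * norm (?g z) \<partial>?N)"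
  proof (rule integral_mono)
    show "integrable ?N (\<lambda>z. \<bar>\<psi> z \<bullet> ?g z\<bar>)"
      by (intro integrable_abs vector_integral_components(2)[OF v] bounded_measurableI[OF m B])
    show "integrable ?N (\<lambda>z. B * norm (?g z))"
      by (intro integrable_mult_right integrable_norm integrable_polar_density[OF v])
    fix z assume "z \<in> space ?N"
    hence "norm (\<psi> z) * norm (?g z) \<le> B * norm (?g z)" using B by (intro mult_right_mono) auto
    thus "\<bar>\<psi> z \<bullet> ?g z\<bar> \<le> B * norm (?g z)" using Cauchy_Schwarz_ineq2 order_trans by blast
  qed
  finally show ?thesis unfolding vector_integral_def by simp
qed

section \<open>Continuous functions with compact support\<close>

lemma compact_support_mono:
  fixes g :: "'a::metric_space \<Rightarrow> 'b::zero"
  assumes g: "compact_support U g" and h: "\<And>z. z \<in> U \<Longrightarrow> g z = 0 \<Longrightarrow> h z = 0"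
  shows "compact_support U h"
proof -
  have "{z\<in>U. h z \<noteq> 0} \<subseteq> {z\<in>U. g z \<noteq> 0}" using h by auto
  hence c: "closure {z\<in>U. h z \<noteq> 0} \<subseteq> closure {z\<in>U. g z \<noteq> 0}" by (rule closure_mono)
  hence "compact (closure {z\<in>U. g z \<noteq> 0} \<inter> closure {z\<in>U. h z \<noteq> 0})"
    using g unfolding compact_support_def by (intro compact_Int_closed closed_closure) auto
  thus ?thesis using c g unfolding compact_support_def Int_absorb1[OF c] by (intro conjI order_trans[OF c]) auto
qed

lemma compact_supportI:
  fixes h :: "'a::metric_space \<Rightarrow> 'b::zero"
  assumes "compact K" "K \<subseteq> U" "\<And>z. z \<in> U \<Longrightarrow> z \<notin> K \<Longrightarrow> h z = 0"
  shows "compact_support U h"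
proof -
  have "{z\<in>U. h z \<noteq> 0} \<subseteq> K" using assms(3) by auto
  hence c: "closure {z\<in>U. h z \<noteq> 0} \<subseteq> K" by (rule closure_minimal) (rule compact_imp_closed[OF assms(1)])
  hence "compact (K \<inter> closure {z\<in>U. h z \<noteq> 0})"
    by (intro compact_Int_closed closed_closure assms)
  thus ?thesis using c assms(2) unfolding compact_support_def by (simp add: Int_absorb1)
qed

lemma compact_supportE:
  fixes h :: "'a::metric_space \<Rightarrow> 'b::zero"
  assumes "compact_support U h"
  obtains K where "compact K" "K \<subseteq> U" "\<And>z. z \<in> U \<Longrightarrow> z \<notin> K \<Longrightarrow> h z = 0"
proof
  show "compact (closure {z\<in>U. h z \<noteq> 0})" "closure {z\<in>U. h z \<noteq> 0} \<subseteq> U"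
    using assms unfolding compact_support_def by auto
  show "h z = 0" if "z \<in> U" "z \<notin> closure {z\<in>U. h z \<noteq> 0}" for z
    using that closure_subset[of "{z\<in>U. h z \<noteq> 0}"] by auto
qed

lemma C0c_dominated:
  fixes g :: "'a::metric_space \<Rightarrow> 'b::real_normed_vector" and h :: "'a \<Rightarrow> 'c::real_normed_vector"
  assumes "C0c U g" "continuous_on U h" "\<And>z. z \<in> U \<Longrightarrow> g z = 0 \<Longrightarrow> h z = 0"
  shows "C0c U h"
  using assms compact_support_mono[of U g h] unfolding C0c_def by auto

lemma compact_support_add:
  fixes f g :: "'a::metric_space \<Rightarrow> 'b::monoid_add"
  assumes "compact_support U f" "compact_support U g"
  shows "compact_support U (\<lambda>z. f z + g z)"
proof -
  obtain K where K: "compact K" "K \<subseteq> U" "\<And>z. z \<in> U \<Longrightarrow> z \<notin> K \<Longrightarrow> f z = 0"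
    using compact_supportE[OF assms(1)] by metis
  obtain L where L: "compact L" "L \<subseteq> U" "\<And>z. z \<in> U \<Longrightarrow> z \<notin> L \<Longrightarrow> g z = 0"
    using compact_supportE[OF assms(2)] by metis
  show ?thesis
  proof (rule compact_supportI)
    show "compact (K \<union> L)" by (rule compact_Un[OF K(1) L(1)])
    show "K \<union> L \<subseteq> U" using K L by simp
    show "f z + g z = 0" if "z \<in> U" "z \<notin> K \<union> L" for z using that K(3) L(3) by simp
  qed
qed

lemma C0c_add:
  fixes f g :: "'a::metric_space \<Rightarrow> 'b::real_normed_vector"
  assumes "C0c U f" "C0c U g"
  shows "C0c U (\<lambda>z. f z + g z)"
  using assms compact_support_add[of U f g] continuous_on_add[of U f g] unfolding C0c_def by auto

lemma C0c_scaleR: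
  fixes f :: "'a::metric_space \<Rightarrow> 'b::real_normed_vector"
  assumes "C0c U f"
  shows "C0c U (\<lambda>z. c *\<^sub>R f z)"
  by (rule C0c_dominated[OF assms])
    (use assms in \<open>auto simp: C0c_def intro!: continuous_on_scaleR continuous_on_const\<close>)

lemma C0c_mult:
  fixes f :: "'a::metric_space \<Rightarrow> real"
  assumes "C0c U f"
  shows "C0c U (\<lambda>z. c * f z)"
  using C0c_scaleR[OF assms, of c] by simp

lemma C0c_zero: "C0c U (\<lambda>z::'a::metric_space. 0)"
  unfolding C0c_def compact_support_def by simp

lemma C0c_bounded:
  fixes f :: "'a::metric_space \<Rightarrow> 'b::real_normed_vector"
  assumes "C0c U f"
  obtains B where "B > 0" "\<And>z. z \<in> U \<Longrightarrow> norm (f z) \<le> B"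
proof -
  have c: "continuous_on U f" and "compact_support U f" using assms C0c_def by auto
  then obtain K where K: "compact K" "K \<subseteq> U" "\<And>z. z \<in> U \<Longrightarrow> z \<notin> K \<Longrightarrow> f z = 0"
    using compact_supportE by metis
  have "compact (f ` K)" using K c by (intro compact_continuous_image) (auto intro: continuous_on_subset)
  then obtain B where B: "B > 0" "\<forall>x\<in>f ` K. norm x \<le> B"
    using bounded_pos compact_imp_bounded by metis
  have "norm (f z) \<le> B" if "z \<in> U" for z
    using that B K(3)[OF that] by (cases "z \<in> K") auto
  thus ?thesis using that B by blast
qed

lemma openin_cozero:
  fixes Z :: "'a::metric_space set"
  assumes "openin (top_of_set Z) U"
  obtains k :: "'a \<Rightarrow> real" where "continuous_on Z k" "\<And>z. 0 \<le> k z" "\<And>z. z \<in> Z \<Longrightarrow> k z > 0 \<longleftrightarrow> z \<in> U"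
proof (cases "U = Z")
  case True
  show ?thesis by (rule that[of "\<lambda>_. 1"]) (use True in auto)
next
  case False
  have U: "U \<subseteq> Z" using assms openin_imp_subset by blast
  have "closedin (top_of_set Z) (Z - U)" using assms by (intro closedin_diff) auto
  then obtain T where T: "closed T" "Z - U = Z \<inter> T" unfolding closedin_closed by blast
  have ne: "T \<noteq> {}" using T(2) U False by auto
  show ?thesis
  proof (rule that[of "\<lambda>z. infdist z T"])
    show "continuous_on Z (\<lambda>z. infdist z T)" by (intro continuous_intros)
    fix z assume z: "z \<in> Z"
    have "z \<in> T \<longleftrightarrow> z \<notin> U" using T(2) z by blast
    moreover have "infdist z T = 0 \<longleftrightarrow> z \<in> T"
      using in_closed_iff_infdist_zero[OF T(1) ne] by simp
    moreover have "infdist z T \<ge> 0" by (rule infdist_nonneg)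
    ultimately show "infdist z T > 0 \<longleftrightarrow> z \<in> U" by linarith
  qed (rule infdist_nonneg)
qed

text \<open>Dini: the sublevel sets increase with \<open>n\<close> and cover \<open>K\<close>, so one of them already does.\<close>

lemma Dini_C0c:
  fixes r :: "nat \<Rightarrow> 'a::metric_space \<Rightarrow> real"
  assumes K: "compact K" "K \<subseteq> Z" and r: "\<And>n. continuous_on Z (r n)"
    and dec: "\<And>m n z. z \<in> Z \<Longrightarrow> m \<le> n \<Longrightarrow> r n z \<le> r m z"
    and lim: "\<And>z. z \<in> K \<Longrightarrow> \<exists>n. r n z < \<delta>"
  obtains n where "\<And>z. z \<in> K \<Longrightarrow> r n z < \<delta>"
proof -
  have "\<exists>T. open T \<and> {z\<in>Z. r n z < \<delta>} = T \<inter> Z" for n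
  proof -
    have "{z\<in>Z. r n z < \<delta>} = Z \<inter> r n -` {..<\<delta>}" by auto
    thus ?thesis using r[of n] continuous_on_open_invariant[of Z "r n"] by (metis open_lessThan Int_commute)
  qed
  then obtain T where T: "\<And>n. open (T n)" "\<And>n. {z\<in>Z. r n z < \<delta>} = T n \<inter> Z" by metis
  have "K \<subseteq> (\<Union>n\<in>UNIV. T n)"
  proof
    fix z assume "z \<in> K"
    then obtain n where "r n z < \<delta>" using lim by blast
    hence "z \<in> T n" using T(2)[of n] \<open>z \<in> K\<close> K(2) by auto
    thus "z \<in> (\<Union>n\<in>UNIV. T n)" by blast
  qed
  then obtain F where F: "finite F" "K \<subseteq> (\<Union>n\<in>F. T n)"
    using compactE_image[OF K(1), of UNIV T] T(1) by metis
  define N where "N = Max (insert 0 F)"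
  have "r N z < \<delta>" if "z \<in> K" for z
  proof -
    obtain n where n: "n \<in> F" "z \<in> T n" proof -
      have "z \<in> (\<Union>n\<in>F. T n)" using F(2) \<open>z \<in> K\<close> by (rule subsetD)
      thus ?thesis using that by blast
    qed
    have "z \<in> Z" using that K by auto
    hence "r n z < \<delta>" using T(2)[of n] n by auto
    moreover have "n \<le> N" unfolding N_def using n F by (intro Max_ge) auto
    ultimately show ?thesis using dec[OF \<open>z \<in> Z\<close>] by (meson le_less_trans)
  qed
  thus ?thesis using that by blast
qed

lemma min_sum_le:
  fixes a :: real and k :: "nat \<Rightarrow> real"
  assumes "a \<ge> 0" "\<And>i. k i \<ge> 0"
  shows "min a (\<Sum>i<n. k i) \<le> (\<Sum>i<n. min a (k i))"
proof (induction n)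
  case (Suc n)
  have "(\<Sum>i<n. k i) \<ge> 0" using assms by (intro sum_nonneg) auto
  thus ?case using Suc assms(1) assms(2)[of n] by (simp add: min_def split: if_splits)
qed (use assms in simp)

section \<open>Riesz representation of positive functionals\<close>

text \<open>The construction of the representing measure uses the functional only on nonnegative functions, which
  spares extending the positive part of a signed functional to all of \<open>C\<^sub>c\<close> by differences.\<close>

locale positive_functional =
  fixes Z :: "'a::metric_space set" and P :: "('a \<Rightarrow> real) \<Rightarrow> real" and C :: real
  assumes add: "\<And>f g. C0c Z f \<Longrightarrow> C0c Z g \<Longrightarrow> (\<And>z. z \<in> Z \<Longrightarrow> 0 \<le> f z) \<Longrightarrow> (\<And>z. z \<in> Z \<Longrightarrow> 0 \<le> g z) \<Longrightarrow>
      P (\<lambda>z. f z + g z) = P f + P g"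
    and scale: "\<And>f c. C0c Z f \<Longrightarrow> (\<And>z. z \<in> Z \<Longrightarrow> 0 \<le> f z) \<Longrightarrow> 0 \<le> c \<Longrightarrow> P (\<lambda>z. c * f z) = c * P f"
    and nonneg: "\<And>f. C0c Z f \<Longrightarrow> (\<And>z. z \<in> Z \<Longrightarrow> 0 \<le> f z) \<Longrightarrow> 0 \<le> P f"
    and bound: "\<And>f B. C0c Z f \<Longrightarrow> (\<And>z. z \<in> Z \<Longrightarrow> 0 \<le> f z) \<Longrightarrow> (\<And>z. z \<in> Z \<Longrightarrow> f z \<le> B) \<Longrightarrow> 0 \<le> B \<Longrightarrow> P f \<le> C * B"
begin

definition nn :: "('a \<Rightarrow> real) \<Rightarrow> bool" where
  "nn f \<longleftrightarrow> C0c Z f \<and> (\<forall>z\<in>Z. 0 \<le> f z)"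

text \<open>The value that the representing measure must take on an open set; no condition on the support of
  \<open>g\<close> inside \<open>U\<close> is imposed, so that multiples of truncations of a function compete directly.\<close>

definition open_content :: "'a set \<Rightarrow> ennreal" where
  "open_content U = (SUP g\<in>{g. nn g \<and> (\<forall>z\<in>Z. g z \<le> indicator U z)}. ennreal (P g))"

definition outer :: "'a set \<Rightarrow> ennreal" where
  "outer A = (INF U\<in>{U. openin (top_of_set Z) U \<and> A \<subseteq> U}. open_content U)"

lemma nnD: "nn f \<Longrightarrow> z \<in> Z \<Longrightarrow> 0 \<le> f z" and nn_cont: "nn f \<Longrightarrow> continuous_on Z f"
  unfolding nn_def C0c_def by auto

lemma nn_dominated:
  assumes "nn g" "continuous_on Z h" "\<And>z. z \<in> Z \<Longrightarrow> g z = 0 \<Longrightarrow> h z = 0" "\<And>z. z \<in> Z \<Longrightarrow> 0 \<le> h z"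
  shows "nn h"
  using assms C0c_dominated[of Z g h] unfolding nn_def by auto

lemma nn_zero: "nn (\<lambda>z. 0)" unfolding nn_def by (simp add: C0c_zero)

lemma P_add: "nn f \<Longrightarrow> nn g \<Longrightarrow> P (\<lambda>z. f z + g z) = P f + P g"
  using add unfolding nn_def by blast

lemma nn_add: "nn f \<Longrightarrow> nn g \<Longrightarrow> nn (\<lambda>z. f z + g z)"
  unfolding nn_def by (auto intro: C0c_add)

lemma P_nonneg: "nn f \<Longrightarrow> 0 \<le> P f"
  using nonneg unfolding nn_def by blast

lemma P_bound: "nn f \<Longrightarrow> (\<And>z. z \<in> Z \<Longrightarrow> f z \<le> B) \<Longrightarrow> 0 \<le> B \<Longrightarrow> P f \<le> C * B"
  using bound unfolding nn_def by blast

lemma P_scale: "nn f \<Longrightarrow> 0 \<le> c \<Longrightarrow> P (\<lambda>z. c * f z) = c * P f"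
  using scale unfolding nn_def by blast

lemma nn_scale: "nn f \<Longrightarrow> 0 \<le> c \<Longrightarrow> nn (\<lambda>z. c * f z)"
  unfolding nn_def by (auto intro: C0c_mult)

lemma nn_diff:
  assumes f: "nn f" and g: "nn g" and le: "\<And>z. z \<in> Z \<Longrightarrow> f z \<le> g z"
  shows "nn (\<lambda>z. g z - f z)"
proof (rule nn_dominated[OF g])
  show "continuous_on Z (\<lambda>z. g z - f z)" by (intro continuous_on_diff nn_cont f g)
  show "g z - f z = 0" if "z \<in> Z" "g z = 0" for z
    using le[OF that(1)] nnD[OF f that(1)] that(2) by simp
  show "0 \<le> g z - f z" if "z \<in> Z" for z using le[OF that] by simp
qed

lemma P_mono:
  assumes f: "nn f" and g: "nn g" and le: "\<And>z. z \<in> Z \<Longrightarrow> f z \<le> g z"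
  shows "P f \<le> P g"
proof -
  have d: "nn (\<lambda>z. g z - f z)" by (rule nn_diff[OF f g le])
  have "P (\<lambda>z. f z + (g z - f z)) = P f + P (\<lambda>z. g z - f z)" by (rule P_add[OF f d])
  thus ?thesis using P_nonneg[OF d] by simp
qed

lemma C_nonneg: "0 \<le> C"
  using P_bound[OF nn_zero, of 1] P_nonneg[OF nn_zero] by simp

lemma P_sum:
  assumes "finite I" "\<And>i. i \<in> I \<Longrightarrow> nn (f i)"
  shows "nn (\<lambda>z. \<Sum>i\<in>I. f i z) \<and> P (\<lambda>z. \<Sum>i\<in>I. f i z) = (\<Sum>i\<in>I. P (f i))"
  using assms
proof (induction I rule: finite_induct)
  case empty
  have "P (\<lambda>z. 0) = 0" using P_bound[OF nn_zero, of 0] P_nonneg[OF nn_zero] by simp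
  thus ?case using nn_zero by simp
next
  case (insert i I)
  have i: "nn (f i)" and I: "nn (\<lambda>z. \<Sum>i\<in>I. f i z)" "P (\<lambda>z. \<Sum>i\<in>I. f i z) = (\<Sum>i\<in>I. P (f i))"
    using insert by auto
  show ?case unfolding sum.insert[OF insert.hyps] using nn_add[OF i I(1)] P_add[OF i I(1)] I(2) by simp
qed

text \<open>The part of \<open>g\<close> below height \<open>\<epsilon>\<close> costs at most \<open>C \<epsilon>\<close>; what remains lives on the closed set where
  \<open>g \<ge> \<epsilon>\<close>.\<close>

lemma cutoff:
  assumes g: "nn g" and e: "0 \<le> \<epsilon>"
  shows "nn (\<lambda>z. max (g z - \<epsilon>) 0)" "P g \<le> P (\<lambda>z. max (g z - \<epsilon>) 0) + C * \<epsilon>"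
proof -
  show 1: "nn (\<lambda>z. max (g z - \<epsilon>) 0)"
    by (rule nn_dominated[OF g]) (use e in \<open>auto intro!: continuous_intros nn_cont[OF g]\<close>)
  have 2: "nn (\<lambda>z. min (g z) \<epsilon>)"
    by (rule nn_dominated[OF g]) (use e nnD[OF g] in \<open>auto intro!: continuous_intros nn_cont[OF g]\<close>)
  have "(\<lambda>z. max (g z - \<epsilon>) 0 + min (g z) \<epsilon>) = g" by (rule ext) (simp add: max_def min_def)
  hence "P g = P (\<lambda>z. max (g z - \<epsilon>) 0) + P (\<lambda>z. min (g z) \<epsilon>)" using P_add[OF 1 2] by simp
  moreover have "P (\<lambda>z. min (g z) \<epsilon>) \<le> C * \<epsilon>" by (rule P_bound[OF 2 _ e]) simp
  ultimately show "P g \<le> P (\<lambda>z. max (g z - \<epsilon>) 0) + C * \<epsilon>" by simp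
qed

lemma open_content_upper:
  "nn g \<Longrightarrow> (\<And>z. z \<in> Z \<Longrightarrow> g z \<le> indicator U z) \<Longrightarrow> ennreal (P g) \<le> open_content U"
  unfolding open_content_def by (rule SUP_upper) simp

lemma open_content_least:
  assumes "\<And>g. nn g \<Longrightarrow> (\<And>z. z \<in> Z \<Longrightarrow> g z \<le> indicator U z) \<Longrightarrow> ennreal (P g) \<le> x"
  shows "open_content U \<le> x"
  unfolding open_content_def by (rule SUP_least) (use assms in blast)

lemma open_content_mono:
  assumes "U \<subseteq> V"
  shows "open_content U \<le> open_content V"
proof (rule open_content_least)
  fix g assume g: "nn g" "\<And>z. z \<in> Z \<Longrightarrow> g z \<le> indicator U z"
  have "indicator U z \<le> (indicator V z :: real)" for z using assms by (auto simp: indicator_def)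
  thus "ennreal (P g) \<le> open_content V" using g(2) by (intro open_content_upper g(1)) (rule order_trans)
qed

lemma open_content_bound: "open_content U \<le> ennreal C"
proof (rule open_content_least)
  fix g assume g: "nn g" "\<And>z. z \<in> Z \<Longrightarrow> g z \<le> indicator U z"
  have "g z \<le> 1" if "z \<in> Z" for z by (rule order_trans[OF g(2)[OF that] indicator_le_1])
  hence "P g \<le> C * 1" by (intro P_bound g(1)) simp_all
  thus "ennreal (P g) \<le> ennreal C" by (intro ennreal_leI) simp
qed

text \<open>With \<open>k i\<close> positive exactly on \<open>U i\<close>, the functions \<open>h n = \<Sum>i<n. min 1 (n * k i)\<close> increase to at
  least one on the union. Hence \<open>(g - h n)\<^sup>+\<close> decreases to zero, uniformly by Dini, while \<open>min g (h n)\<close>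
  is dominated by a sum of competitors for the \<open>U i\<close>.\<close>

lemma open_content_UN:
  fixes U :: "nat \<Rightarrow> 'a set"
  assumes U: "\<And>i. openin (top_of_set Z) (U i)"
  shows "open_content (\<Union>i. U i) \<le> (\<Sum>i. open_content (U i))"
proof (rule open_content_least)
  fix g assume g: "nn g" and gU: "\<And>z. z \<in> Z \<Longrightarrow> g z \<le> indicator (\<Union>i. U i) z"
  have g1: "g z \<le> 1" if "z \<in> Z" for z by (rule order_trans[OF gU[OF that] indicator_le_1])
  have "\<exists>k :: 'a \<Rightarrow> real. continuous_on Z k \<and> (\<forall>z. 0 \<le> k z) \<and> (\<forall>z\<in>Z. k z > 0 \<longleftrightarrow> z \<in> U i)" for i
    using openin_cozero[OF U[of i]] by metis
  then obtain k :: "nat \<Rightarrow> 'a \<Rightarrow> real" where k: "\<And>i. continuous_on Z (k i)" "\<And>i z. 0 \<le> k i z"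
      "\<And>i z. z \<in> Z \<Longrightarrow> k i z > 0 \<longleftrightarrow> z \<in> U i"
    by metis
  define l where "l n i z = min 1 (real n * k i z)" for n i z
  define h where "h n z = (\<Sum>i<n. l n i z)" for n z
  have l0: "0 \<le> l n i z" for n i z using k(2) unfolding l_def by simp
  have lc: "continuous_on Z (l n i)" for n i
    unfolding l_def using k(1) by (intro continuous_intros)
  have hc: "continuous_on Z (h n)" for n
    unfolding h_def by (intro continuous_on_sum) (rule lc)
  have hmono: "h m z \<le> h n z" if "m \<le> n" for m n z
  proof -
    have "h m z \<le> (\<Sum>i<m. l n i z)"
      unfolding h_def l_def using that k(2)
      by (intro sum_mono min.mono order_refl mult_right_mono) auto
    also have "\<dots> \<le> h n z" unfolding h_def using that l0 by (intro sum_mono2) auto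
    finally show ?thesis .
  qed
  define r where "r n z = max (g z - h n z) 0" for n z
  have rc: "continuous_on Z (r n)" for n
    unfolding r_def by (intro continuous_intros nn_cont[OF g] hc)
  have h0: "0 \<le> h n z" for n z unfolding h_def using l0 by (intro sum_nonneg) auto
  show "ennreal (P g) \<le> (\<Sum>i. open_content (U i))"
  proof (rule ennreal_le_epsilon)
    fix e :: real assume e: "0 < e"
    define \<delta> where "\<delta> = e / (C + 1)"
    have \<delta>: "\<delta> > 0" "C * \<delta> \<le> e" using e C_nonneg by (auto simp: \<delta>_def field_simps)
    obtain K where K: "compact K" "K \<subseteq> Z" "\<And>z. z \<in> Z \<Longrightarrow> z \<notin> K \<Longrightarrow> g z = 0"
      using g compact_supportE unfolding nn_def C0c_def by metis
    have lim: "\<exists>n. r n z < \<delta>" if z: "z \<in> K" for z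
    proof (cases "z \<in> (\<Union>i. U i)")
      case True
      then obtain i where "z \<in> U i" by auto
      hence "k i z > 0" using k(3) z K(2) by auto
      then obtain m where m: "1 \<le> real m * k i z"
        by (metis reals_Archimedean3 less_imp_le)
      define n where "n = max m (Suc i)"
      have "real m * k i z \<le> real n * k i z" using k(2) by (intro mult_right_mono) (auto simp: n_def)
      hence "l n i z = 1" using m unfolding l_def by simp
      moreover have "l n i z \<le> h n z" unfolding h_def using l0 by (intro member_le_sum) (auto simp: n_def)
      ultimately have "r n z = 0" unfolding r_def using g1[of z] z K(2) by auto
      thus ?thesis using \<delta>(1) by (intro exI[of _ n]) simp
    next
      case False
      hence "g z \<le> 0" using gU[of z] z K(2) by (auto simp: indicator_def)
      hence "r 0 z = 0" unfolding r_def using h0[of 0 z] by simp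
      thus ?thesis using \<delta>(1) by (intro exI[of _ 0]) simp
    qed
    have dec: "r n z \<le> r m z" if "m \<le> n" for m n z
      unfolding r_def using hmono[OF that] by (intro max.mono) auto
    obtain n where n: "\<And>z. z \<in> K \<Longrightarrow> r n z < \<delta>"
      using Dini_C0c[OF K(1,2) rc dec lim] by metis
    have rz: "r n z \<le> \<delta>" if "z \<in> Z" for z
      using n[of z] K(3)[OF that] h0[of n z] \<delta> unfolding r_def by (cases "z \<in> K") auto
    have rn: "nn (r n)"
      by (rule nn_dominated[OF g rc]) (use h0[of n] in \<open>auto simp: r_def\<close>)
    have qn: "nn (\<lambda>z. min (g z) (h n z))"
      by (rule nn_dominated[OF g]) (use h0[of n] nnD[OF g] nn_cont[OF g] hc in \<open>auto intro!: continuous_intros\<close>)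
    have sn: "nn (\<lambda>z. min (g z) (l n i z))" for i
      by (rule nn_dominated[OF g]) (use l0[of n i] nnD[OF g] nn_cont[OF g] lc in \<open>auto intro!: continuous_intros\<close>)
    have "(\<lambda>z. min (g z) (h n z) + r n z) = g" unfolding r_def by (rule ext) (simp add: max_def min_def)
    hence "P g = P (\<lambda>z. min (g z) (h n z)) + P (r n)" using P_add[OF qn rn] by simp
    moreover have "P (r n) \<le> C * \<delta>" by (rule P_bound[OF rn rz]) (use \<delta> in auto)
    moreover have "P (\<lambda>z. min (g z) (h n z)) \<le> P (\<lambda>z. \<Sum>i<n. min (g z) (l n i z))"
      using P_sum[of "{..<n}" "\<lambda>i z. min (g z) (l n i z)"] sn
      by (intro P_mono qn) (auto simp: h_def intro!: min_sum_le l0 nnD[OF g])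
    moreover have "P (\<lambda>z. \<Sum>i<n. min (g z) (l n i z)) = (\<Sum>i<n. P (\<lambda>z. min (g z) (l n i z)))"
      using P_sum[of "{..<n}" "\<lambda>i z. min (g z) (l n i z)"] sn by auto
    ultimately have "P g \<le> (\<Sum>i<n. P (\<lambda>z. min (g z) (l n i z))) + e" using \<delta>(2) by linarith
    hence "ennreal (P g) \<le> ennreal ((\<Sum>i<n. P (\<lambda>z. min (g z) (l n i z))) + e)" by (rule ennreal_leI)
    also have "\<dots> = (\<Sum>i<n. ennreal (P (\<lambda>z. min (g z) (l n i z)))) + ennreal e"
      using P_nonneg[OF sn] e by (subst ennreal_plus) (auto intro: sum_nonneg)
    also have "\<dots> \<le> (\<Sum>i<n. open_content (U i)) + ennreal e"
    proof (intro add_right_mono sum_mono open_content_upper sn)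
      fix i z assume z: "z \<in> Z"
      show "min (g z) (l n i z) \<le> indicator (U i) z"
        using k(3)[OF z, of i] k(2)[of i z] unfolding l_def by (cases "z \<in> U i") auto
    qed
    also have "\<dots> \<le> (\<Sum>i. open_content (U i)) + ennreal e"
      by (intro add_right_mono sum_le_suminf) auto
    finally show "ennreal (P g) \<le> (\<Sum>i. open_content (U i)) + ennreal e" .
  qed
qed

lemma outer_open: "openin (top_of_set Z) U \<Longrightarrow> outer U = open_content U"
  unfolding outer_def by (rule antisym) (auto intro: INF_lower INF_greatest open_content_mono)

lemma outer_mono: "A \<subseteq> B \<Longrightarrow> outer A \<le> outer B"
  unfolding outer_def by (rule INF_superset_mono) auto

lemma outer_finite: "A \<subseteq> Z \<Longrightarrow> outer A \<le> ennreal C"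
  using outer_mono[of A Z] outer_open[of Z] open_content_bound[of Z] by (auto intro: order_trans)

lemma outer_approx:
  assumes "A \<subseteq> Z" "e > 0"
  obtains U where "openin (top_of_set Z) U" "A \<subseteq> U" "open_content U \<le> outer A + ennreal e"
proof -
  have "outer A \<noteq> \<infinity>" using outer_finite[OF assms(1)] by (auto simp: top_unique)
  moreover have "0 < ennreal e" using assms(2) by simp
  ultimately have "outer A < outer A + ennreal e"
    using ennreal_add_left_cancel_less[of "outer A" 0 "ennreal e"] by (simp add: top.not_eq_extremum)
  then obtain U where "openin (top_of_set Z) U" "A \<subseteq> U" "open_content U < outer A + ennreal e"
    unfolding outer_def[of A] INF_less_iff by auto
  thus ?thesis using that less_imp_le by blast
qed

lemma outer_empty: "outer {} = 0"
proof -
  have "open_content {} \<le> 0"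
  proof (rule open_content_least)
    fix g assume g: "nn g" "\<And>z. z \<in> Z \<Longrightarrow> g z \<le> indicator {} z"
    have "P g \<le> C * 0" by (rule P_bound[OF g(1)]) (use g(2) in simp_all)
    thus "ennreal (P g) \<le> 0" by (simp add: ennreal_neg)
  qed
  thus ?thesis using outer_open[of "{}"] by simp
qed

lemma outer_UN_le:
  assumes A: "\<And>i :: nat. A i \<subseteq> Z"
  shows "outer (\<Union>i. A i) \<le> (\<Sum>i. outer (A i))"
proof (rule ennreal_le_epsilon)
  fix e :: real assume e: "0 < e"
  have "\<exists>U. openin (top_of_set Z) U \<and> A i \<subseteq> U \<and> open_content U \<le> outer (A i) + ennreal (e * (1/2) ^ Suc i)" for i
    using outer_approx[OF A[of i], of "e * (1/2) ^ Suc i"] e by (metis mult_pos_pos zero_less_divide_1_iff zero_less_numeral zero_less_power)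
  then obtain U where U: "\<And>i. openin (top_of_set Z) (U i)" "\<And>i. A i \<subseteq> U i"
      "\<And>i. open_content (U i) \<le> outer (A i) + ennreal (e * (1/2) ^ Suc i)" by metis
  have "outer (\<Union>i. A i) \<le> outer (\<Union>i. U i)" using U(2) by (intro outer_mono UN_mono) auto
  also have "\<dots> = open_content (\<Union>i. U i)" using U(1) by (intro outer_open openin_Union) auto
  also have "\<dots> \<le> (\<Sum>i. open_content (U i))" by (rule open_content_UN[OF U(1)])
  also have "\<dots> \<le> (\<Sum>i. outer (A i) + ennreal (e * (1/2) ^ Suc i))"
    by (intro suminf_le U(3)) auto
  also have "\<dots> = (\<Sum>i. outer (A i)) + (\<Sum>i. ennreal (e * (1/2) ^ Suc i))"
    by (rule suminf_add[symmetric]) auto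
  also have "(\<Sum>i. ennreal (e * (1/2) ^ Suc i)) = ennreal (e * 1)"
    using e by (intro suminf_ennreal_eq sums_mult power_half_series) simp
  finally show "outer (\<Union>i. A i) \<le> (\<Sum>i. outer (A i)) + ennreal e" by simp
qed

lemma outer_Un_le:
  assumes "A \<subseteq> Z" "B \<subseteq> Z"
  shows "outer (A \<union> B) \<le> outer A + outer B"
proof -
  have "outer (\<Union>i. binaryset A B i) \<le> (\<Sum>i. outer (binaryset A B i))"
    by (rule outer_UN_le) (use assms in \<open>auto simp: binaryset_def\<close>)
  also have "(\<Sum>i. outer (binaryset A B i)) = outer A + outer B"
    by (intro sums_unique[symmetric] binaryset_sums outer_empty)
  finally show ?thesis by (simp add: UN_binaryset_eq)
qed

text \<open>The inequality behind Caratheodory measurability of \<open>V\<close>. If \<open>g\<close> competes for \<open>V \<inter> U\<close>, its cut-off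
  part vanishes on the open set \<open>W\<close> of points of \<open>U\<close> where \<open>g < \<delta>\<close>. This set contains \<open>U - V\<close>, and
  any competitor for \<open>W\<close> can be added to the cut-off part without exceeding the indicator of \<open>U\<close>.\<close>

lemma outer_split_open:
  assumes V: "openin (top_of_set Z) V" and U: "openin (top_of_set Z) U"
  shows "outer (V \<inter> U) + outer (U - V) \<le> open_content U"
proof -
  have UV: "openin (top_of_set Z) (V \<inter> U)" using U V by (rule openin_Int[rotated])
  have step: "ennreal (P g) + outer (U - V) \<le> open_content U + ennreal e"
    if g: "nn g" "\<And>z. z \<in> Z \<Longrightarrow> g z \<le> indicator (V \<inter> U) z" and e: "e > 0" for g and e :: real
  proof -
    define \<delta> where "\<delta> = e / (C + 1)"
    have \<delta>: "\<delta> > 0" "C * \<delta> \<le> e" using e C_nonneg by (auto simp: \<delta>_def field_simps)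
    define g' where "g' z = max (g z - \<delta>) 0" for z
    have g': "nn g'" "P g \<le> P g' + C * \<delta>"
      unfolding g'_def using cutoff[OF g(1), of \<delta>] \<delta> by auto
    define W where "W = U \<inter> {z \<in> Z. g z < \<delta>}"
    have "{z \<in> Z. g z < \<delta>} = Z \<inter> g -` {..<\<delta>}" by auto
    hence "openin (top_of_set Z) {z \<in> Z. g z < \<delta>}"
      using nn_cont[OF g(1)] continuous_openin_preimage_gen[of Z g "{..<\<delta>}"] by simp
    hence W: "openin (top_of_set Z) W" unfolding W_def using U by (intro openin_Int)
    have "g z < \<delta>" if "z \<in> Z" "z \<notin> V" for z
      using g(2)[OF that(1)] that(2) \<delta>(1) by simp
    hence UVW: "U - V \<subseteq> W" unfolding W_def using openin_imp_subset[OF U] by auto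
    have "ennreal (P g') + open_content W = (SUP k\<in>{k. nn k \<and> (\<forall>z\<in>Z. k z \<le> indicator W z)}. ennreal (P k) + ennreal (P g'))"
      unfolding open_content_def
      by (subst ennreal_SUP_add_left) (use nn_zero in \<open>auto simp: add.commute\<close>)
    also have "\<dots> \<le> open_content U"
    proof (rule SUP_least, clarify)
      fix k assume k: "nn k" "\<forall>z\<in>Z. k z \<le> indicator W z"
      have "ennreal (P k) + ennreal (P g') = ennreal (P (\<lambda>z. k z + g' z))"
        using P_add[OF k(1) g'(1)] P_nonneg[OF k(1)] P_nonneg[OF g'(1)] by simp
      also have "\<dots> \<le> open_content U"
      proof (rule open_content_upper[OF nn_add[OF k(1) g'(1)]])
        fix z assume z: "z \<in> Z"
        show "k z + g' z \<le> indicator U z"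
        proof (cases "g z < \<delta>")
          case True
          hence "g' z = 0" by (simp add: g'_def)
          moreover have "k z \<le> indicator W z" using k(2) z by blast
          moreover have "indicator W z \<le> (indicator U z :: real)" by (simp add: W_def indicator_def)
          ultimately show ?thesis by linarith
        next
          case False
          hence "z \<notin> W" by (simp add: W_def)
          hence "k z \<le> 0" using k(2) z by fastforce
          moreover have "g' z \<le> g z" using False \<delta>(1) by (simp add: g'_def)
          moreover have "g z \<le> indicator (V \<inter> U) z" by (rule g(2)[OF z])
          moreover have "indicator (V \<inter> U) z \<le> (indicator U z :: real)" by (simp add: indicator_def)
          ultimately show ?thesis by linarith
        qed
      qed
      finally show "ennreal (P k) + ennreal (P g') \<le> open_content U" .
    qed
    finally have 1: "ennreal (P g') + open_content W \<le> open_content U" .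
    have "ennreal (P g) \<le> ennreal (P g' + e)" using g'(2) \<delta>(2) by (intro ennreal_leI) linarith
    also have "\<dots> = ennreal (P g') + ennreal e" using P_nonneg[OF g'(1)] e by simp
    finally have "ennreal (P g) + outer (U - V) \<le> (ennreal (P g') + ennreal e) + open_content W"
      using outer_mono[OF UVW] outer_open[OF W] by (intro add_mono) auto
    also have "\<dots> = (ennreal (P g') + open_content W) + ennreal e" by (simp only: ac_simps)
    also have "\<dots> \<le> open_content U + ennreal e" by (intro add_right_mono 1)
    finally show ?thesis .
  qed
  have step': "ennreal (P g) + outer (U - V) \<le> open_content U"
    if g: "nn g" "\<And>z. z \<in> Z \<Longrightarrow> g z \<le> indicator (V \<inter> U) z" for g
    by (rule ennreal_le_epsilon) (rule step[OF g])
  have "outer (V \<inter> U) + outer (U - V) = (SUP g\<in>{g. nn g \<and> (\<forall>z\<in>Z. g z \<le> indicator (V \<inter> U) z)}. ennreal (P g) + outer (U - V))"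
    unfolding outer_open[OF UV] open_content_def
    by (subst ennreal_SUP_add_left) (use nn_zero in auto)
  also have "\<dots> \<le> open_content U"
    by (rule SUP_least) (use step' in blast)
  finally show ?thesis .
qed

lemma outer_measure_space_outer: "outer_measure_space (Pow Z) outer"
  unfolding outer_measure_space_def positive_def increasing_def countably_subadditive_def
  using outer_empty outer_mono outer_UN_le by (auto simp: image_subset_iff)

lemma openin_lambda_system:
  assumes V: "openin (top_of_set Z) V"
  shows "V \<in> lambda_system Z (Pow Z) outer"
proof -
  have VZ: "V \<subseteq> Z" using V openin_imp_subset by blast
  have "outer (V \<inter> A) + outer ((Z - V) \<inter> A) = outer A" if A: "A \<subseteq> Z" for A
  proof (rule antisym)
    show "outer (V \<inter> A) + outer ((Z - V) \<inter> A) \<le> outer A"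
      unfolding outer_def[of A]
    proof (rule INF_greatest, clarify)
      fix U assume U: "openin (top_of_set Z) U" "A \<subseteq> U"
      have "(Z - V) \<inter> A \<subseteq> U - V" using U(2) by auto
      hence "outer (V \<inter> A) + outer ((Z - V) \<inter> A) \<le> outer (V \<inter> U) + outer (U - V)"
        using U(2) by (intro add_mono outer_mono) auto
      also have "\<dots> \<le> open_content U" by (rule outer_split_open[OF V U(1)])
      finally show "outer (V \<inter> A) + outer ((Z - V) \<inter> A) \<le> open_content U" .
    qed
    have "A = (V \<inter> A) \<union> ((Z - V) \<inter> A)" using A by auto
    hence "outer A = outer ((V \<inter> A) \<union> ((Z - V) \<inter> A))" by simp
    also have "\<dots> \<le> outer (V \<inter> A) + outer ((Z - V) \<inter> A)" using A by (intro outer_Un_le) auto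
    finally show "outer A \<le> outer (V \<inter> A) + outer ((Z - V) \<inter> A)" .
  qed
  thus ?thesis using VZ unfolding lambda_system_def by auto
qed

lemma measure_space_outer: "measure_space Z (sets (borel_on Z)) outer"
proof -
  interpret pow: sigma_algebra Z "Pow Z" by (rule sigma_algebra_Pow)
  have ms: "measure_space Z (lambda_system Z (Pow Z) outer) outer"
    by (rule pow.caratheodory_lemma[OF outer_measure_space_outer])
  then interpret lam: sigma_algebra Z "lambda_system Z (Pow Z) outer"
    unfolding measure_space_def by blast
  have "Z \<inter> A \<in> lambda_system Z (Pow Z) outer" if "A \<in> sigma_sets UNIV {S. open S}" for A
    using that
  proof (induction rule: sigma_sets.induct)
    case (Basic A)
    thus ?case by (intro openin_lambda_system) (auto simp: openin_open)
  next
    case (Compl A)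
    have "Z \<inter> (UNIV - A) = Z - Z \<inter> A" by auto
    thus ?case using lam.compl_sets[OF Compl.IH] by simp
  next
    case (Union A)
    have "Z \<inter> (\<Union>i. A i) = (\<Union>i. Z \<inter> A i)" by auto
    thus ?case using lam.countable_nat_UN[of "\<lambda>i. Z \<inter> A i"] Union.IH by auto
  qed simp
  hence sub: "sets (borel_on Z) \<subseteq> lambda_system Z (Pow Z) outer"
    unfolding sets_restrict_space borel_def by (auto simp: sets_measure_of)
  have "sigma_algebra (space (borel_on Z)) (sets (borel_on Z))" by (rule sets.sigma_algebra_axioms)
  hence "sigma_algebra Z (sets (borel_on Z))" by (simp add: space_restrict_space)
  thus ?thesis by (rule measure_down[OF ms _ sub])
qed

definition riesz_measure :: "'a measure" where
  "riesz_measure = measure_of Z (sets (borel_on Z)) outer"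

lemma sets_riesz [simp]: "sets riesz_measure = sets (borel_on Z)"
  and space_riesz [simp]: "space riesz_measure = Z"
proof -
  have sp: "sets (borel_on Z) \<subseteq> Pow Z" using sets.space_closed[of "borel_on Z"] by (simp add: space_restrict_space)
  show "sets riesz_measure = sets (borel_on Z)"
    unfolding riesz_measure_def sets_measure_of[OF sp]
    using sets.sigma_sets_eq[of "borel_on Z"] by (simp add: space_restrict_space)
  show "space riesz_measure = Z" unfolding riesz_measure_def by (rule space_measure_of[OF sp])
qed

lemma emeasure_riesz: "A \<in> sets (borel_on Z) \<Longrightarrow> emeasure riesz_measure A = outer A"
  unfolding riesz_measure_def using measure_space_outer
  by (intro emeasure_measure_of_sigma) (auto simp: measure_space_def)

lemma finite_riesz: "finite_measure riesz_measure"
proof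
  have "Z \<in> sets (borel_on Z)" by (metis sets.top space_restrict_space2 space_restrict_space space_borel Int_UNIV_right sets_riesz space_riesz)
  hence "emeasure riesz_measure Z \<le> ennreal C" using emeasure_riesz outer_finite by auto
  thus "emeasure riesz_measure (space riesz_measure) \<noteq> \<infinity>" by (auto simp: top_unique)
qed

lemma continuous_on_measurable_riesz: "continuous_on Z f \<Longrightarrow> f \<in> borel_measurable riesz_measure"
  for f :: "'a \<Rightarrow> real"
  using borel_measurable_continuous_on_restrict[of Z f] measurable_cong_sets[OF sets_riesz refl] by blast

text \<open>Cut \<open>f\<close> into horizontal layers of height \<open>\<delta>\<close>. Both \<open>P\<close> and the integral of the \<open>k\<close>-th layer lie
  between \<open>\<delta>\<close> times the measures of \<open>{f > (k + 1) \<delta>}\<close> and of \<open>{f > k \<delta>}\<close>, so the errors telescope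
  to at most \<open>\<delta>\<close> times the total mass.\<close>

lemma riesz_representation:
  assumes f: "nn f"
  shows "P f = (\<integral>z. f z \<partial>riesz_measure)"
proof -
  let ?M = riesz_measure
  interpret M: finite_measure ?M by (rule finite_riesz)
  obtain B where B: "B > 0" "\<And>z. z \<in> Z \<Longrightarrow> f z \<le> B"
    using C0c_bounded[of Z f] f unfolding nn_def by (metis real_norm_def abs_ge_self order_trans)
  have [measurable]: "f \<in> borel_measurable ?M" by (rule continuous_on_measurable_riesz[OF nn_cont[OF f]])
  have "\<bar>P f - (\<integral>z. f z \<partial>?M)\<bar> \<le> B * measure ?M Z * (1 / real n)" if n: "n > 0" for n :: nat
  proof -
    define \<delta> where "\<delta> = B / real n"
    have \<delta>: "\<delta> > 0" using B n by (simp add: \<delta>_def)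
    define A where "A k = {z \<in> Z. f z > real k * \<delta>}" for k
    have "{z \<in> space ?M. f z > real k * \<delta>} \<in> sets ?M" for k by measurable
    hence Am: "A k \<in> sets ?M" for k unfolding A_def space_riesz .
    have Ao: "openin (top_of_set Z) (A k)" for k
    proof -
      have "A k = Z \<inter> f -` {real k * \<delta><..}" unfolding A_def by auto
      thus ?thesis using continuous_openin_preimage_gen[OF nn_cont[OF f], of "{real k * \<delta><..}"] by simp
    qed
    define m where "m k = measure ?M (A k)" for k
    have m: "ennreal (m k) = open_content (A k)" for k
      using emeasure_riesz[of "A k"] Am[of k] outer_open[OF Ao] unfolding m_def M.emeasure_eq_measure[symmetric] by simp
    define fk where "fk k z = min (max (f z - real k * \<delta>) 0) \<delta>" for k z
    have fk: "nn (fk k)" for k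
      by (rule nn_dominated[OF f]) (use \<delta> in \<open>auto simp: fk_def intro!: continuous_intros nn_cont[OF f]\<close>)
    have fkle: "fk k z \<le> \<delta> * indicator (A k) z" if "z \<in> Z" for k z
      using that \<delta> unfolding fk_def A_def by (simp add: indicator_def)
    have lefk: "\<delta> * indicator (A (Suc k)) z \<le> fk k z" if "z \<in> Z" for k z
      using that \<delta> unfolding fk_def A_def by (simp add: indicator_def algebra_simps)
    have telescope: "(\<Sum>k<N. fk k z) = min (f z) (real N * \<delta>)" if "z \<in> Z" for N z
    proof (induction N)
      case (Suc N)
      show ?case unfolding sum.lessThan_Suc Suc.IH unfolding fk_def using \<delta> by (simp add: min_def max_def algebra_simps)
    qed (use nnD[OF f that] in simp)
    have nd: "real n * \<delta> = B" using n by (simp add: \<delta>_def)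
    have fsum: "f z = (\<Sum>k<n. fk k z)" if "z \<in> Z" for z
      unfolding telescope[OF that] nd using B(2)[OF that] by simp
    have P1: "P f = (\<Sum>k<n. P (fk k))"
    proof -
      have s: "nn (\<lambda>z. \<Sum>k<n. fk k z)" "P (\<lambda>z. \<Sum>k<n. fk k z) = (\<Sum>k<n. P (fk k))"
        using P_sum[of "{..<n}" fk] fk by auto
      have "P f = P (\<lambda>z. \<Sum>k<n. fk k z)"
        by (intro antisym P_mono f s(1)) (use fsum in auto)
      thus ?thesis using s(2) by simp
    qed
    have ifk: "integrable ?M (fk k)" for k
    proof (rule M.integrable_const_bound[where B=\<delta>])
      show "fk k \<in> borel_measurable ?M" by (rule continuous_on_measurable_riesz[OF nn_cont[OF fk]])
      show "AE x in ?M. norm (fk k x) \<le> \<delta>" using \<delta> by (intro AE_I2) (auto simp: fk_def)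
    qed
    have I1: "(\<integral>z. f z \<partial>?M) = (\<Sum>k<n. \<integral>z. fk k z \<partial>?M)"
    proof -
      have "(\<integral>z. f z \<partial>?M) = (\<integral>z. (\<Sum>k<n. fk k z) \<partial>?M)"
        by (rule Bochner_Integration.integral_cong[OF refl]) (use fsum in simp)
      thus ?thesis by (simp add: Bochner_Integration.integral_sum[OF ifk])
    qed
    have Pup: "P (fk k) \<le> \<delta> * m k" for k
    proof -
      have "ennreal (P (\<lambda>z. (1/\<delta>) * fk k z)) \<le> open_content (A k)"
        by (rule open_content_upper[OF nn_scale[OF fk]]) (use \<delta> fkle in \<open>auto simp: field_simps\<close>)
      hence "P (\<lambda>z. (1/\<delta>) * fk k z) \<le> m k" unfolding m[symmetric] by (simp add: m_def)
      moreover have "P (\<lambda>z. (1/\<delta>) * fk k z) = (1/\<delta>) * P (fk k)" using \<delta> by (intro P_scale fk) simp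
      ultimately have "P (fk k) / \<delta> \<le> m k" by simp
      thus ?thesis using \<delta> by (simp add: pos_divide_le_eq mult.commute)
    qed
    have Plo: "\<delta> * m (Suc k) \<le> P (fk k)" for k
    proof -
      have "open_content (A (Suc k)) \<le> ennreal (P (fk k) / \<delta>)"
      proof (rule open_content_least)
        fix g assume g: "nn g" "\<And>z. z \<in> Z \<Longrightarrow> g z \<le> indicator (A (Suc k)) z"
        have "P (\<lambda>z. \<delta> * g z) \<le> P (fk k)"
        proof (rule P_mono[OF nn_scale[OF g(1)] fk])
          show "\<delta> * g z \<le> fk k z" if "z \<in> Z" for z
            using mult_left_mono[OF g(2)[OF that], of \<delta>] lefk[OF that, of k] \<delta> by linarith
        qed (use \<delta> in simp)
        hence "P g \<le> P (fk k) / \<delta>" using P_scale[OF g(1), of \<delta>] \<delta> by (simp add: field_simps)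
        thus "ennreal (P g) \<le> ennreal (P (fk k) / \<delta>)" by (rule ennreal_leI)
      qed
      hence "m (Suc k) \<le> P (fk k) / \<delta>"
        unfolding m[symmetric] using P_nonneg[OF fk] \<delta> by (simp add: ennreal_le_iff)
      thus ?thesis using \<delta> by (simp add: field_simps)
    qed
    have Iind: "integrable ?M (\<lambda>z. \<delta> * indicator (A k) z)" "(\<integral>z. \<delta> * indicator (A k) z \<partial>?M) = \<delta> * m k" for k
    proof -
      have "integrable ?M (indicator (A k) :: _ \<Rightarrow> real)"
        by (intro integrable_real_indicator Am) (auto simp: less_top[symmetric])
      thus "integrable ?M (\<lambda>z. \<delta> * indicator (A k) z)" by simp
      have "space ?M \<inter> A k = A k" by (auto simp: A_def)
      thus "(\<integral>z. \<delta> * indicator (A k) z \<partial>?M) = \<delta> * m k" by (simp add: m_def Int_commute)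
    qed
    have Iup: "(\<integral>z. fk k z \<partial>?M) \<le> \<delta> * m k" for k
      using integral_mono[OF ifk Iind(1)[of k]] fkle unfolding Iind(2) by simp
    have Ilo: "\<delta> * m (Suc k) \<le> (\<integral>z. fk k z \<partial>?M)" for k
      using integral_mono[OF Iind(1)[of "Suc k"] ifk[of k]] lefk unfolding Iind(2) by simp
    have tel: "(\<Sum>k<N. \<delta> * m k - \<delta> * m (Suc k)) = \<delta> * m 0 - \<delta> * m N" for N
      by (induction N) auto
    have "\<bar>P f - (\<integral>z. f z \<partial>?M)\<bar> = \<bar>\<Sum>k<n. P (fk k) - (\<integral>z. fk k z \<partial>?M)\<bar>"
      unfolding P1 I1 sum_subtractf ..
    also have "\<dots> \<le> (\<Sum>k<n. \<bar>P (fk k) - (\<integral>z. fk k z \<partial>?M)\<bar>)" by (rule sum_abs)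
    also have "\<dots> \<le> (\<Sum>k<n. \<delta> * m k - \<delta> * m (Suc k))"
    proof (rule sum_mono)
      fix k show "\<bar>P (fk k) - (\<integral>z. fk k z \<partial>?M)\<bar> \<le> \<delta> * m k - \<delta> * m (Suc k)"
        using Pup[of k] Plo[of k] Iup[of k] Ilo[of k] by linarith
    qed
    also have "\<dots> \<le> \<delta> * m 0" unfolding tel using \<delta> by (simp add: m_def)
    also have "\<dots> \<le> \<delta> * measure ?M Z"
    proof (intro mult_left_mono)
      have "measure ?M (A 0) \<le> measure ?M (space ?M)" by (rule M.bounded_measure)
      thus "m 0 \<le> measure ?M Z" by (simp add: m_def)
    qed (use \<delta> in simp)
    finally show ?thesis by (simp add: \<delta>_def)
  qed
  hence "\<bar>P f - (\<integral>z. f z \<partial>?M)\<bar> \<le> B * measure ?M Z * (1 / real (Suc n))" for n by blast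
  moreover have "(\<lambda>n. B * measure ?M Z * (1 / real (Suc n))) \<longlonglongrightarrow> B * measure ?M Z * 0"
    by (intro tendsto_mult tendsto_const lim_1_over_n[THEN LIMSEQ_Suc])
  ultimately have "\<bar>P f - (\<integral>z. f z \<partial>?M)\<bar> \<le> B * measure ?M Z * 0" by (intro LIMSEQ_le_const) auto
  thus ?thesis by simp
qed

end

section \<open>Riesz representation of bounded functionals\<close>

text \<open>The positive part \<open>U f = sup {L t | 0 \<le> t \<le> f}\<close> and \<open>U - L\<close> are both positive functionals.\<close>

theorem Riesz_representation_C0c:
  fixes Z :: "'a::metric_space set" and L :: "('a \<Rightarrow> real) \<Rightarrow> real"
  assumes add: "\<And>f g. C0c Z f \<Longrightarrow> C0c Z g \<Longrightarrow> L (\<lambda>z. f z + g z) = L f + L g"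
    and scale: "\<And>f c. C0c Z f \<Longrightarrow> L (\<lambda>z. c * f z) = c * L f"
    and bound: "\<And>f B. C0c Z f \<Longrightarrow> 0 \<le> B \<Longrightarrow> (\<And>z. z \<in> Z \<Longrightarrow> \<bar>f z\<bar> \<le> B) \<Longrightarrow> \<bar>L f\<bar> \<le> C * B"
  obtains M1 M2 where "finite_measure M1" "finite_measure M2"
    "sets M1 = sets (borel_on Z)" "sets M2 = sets (borel_on Z)"
    "\<And>f. C0c Z f \<Longrightarrow> L f = (\<integral>z. f z \<partial>M1) - (\<integral>z. f z \<partial>M2)"
proof -
  define S where "S f = {t. C0c Z t \<and> (\<forall>z\<in>Z. 0 \<le> t z \<and> t z \<le> f z)}" for f :: "'a \<Rightarrow> real"
  define U where "U f = Sup (L ` S f)" for f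
  have S_bdd: "L t \<le> C * B" if "t \<in> S f" "\<And>z. z \<in> Z \<Longrightarrow> f z \<le> B" "0 \<le> B" for t f B
  proof -
    have "\<bar>t z\<bar> \<le> B" if "z \<in> Z" for z using \<open>t \<in> S f\<close> that(1) \<open>\<And>z. z \<in> Z \<Longrightarrow> f z \<le> B\<close>[OF that]
      unfolding S_def by force
    hence "\<bar>L t\<bar> \<le> C * B" using that unfolding S_def by (intro bound) auto
    thus ?thesis by simp
  qed
  have bdd: "bdd_above (L ` S f)" if "C0c Z f" for f
  proof -
    obtain B where "B > 0" "\<And>z. z \<in> Z \<Longrightarrow> norm (f z) \<le> B" using C0c_bounded[OF \<open>C0c Z f\<close>] by metis
    hence "L t \<le> C * B" if "t \<in> S f" for t
      using that by (intro S_bdd[of t f B]) (auto intro: order_trans[OF abs_ge_self])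
    thus ?thesis by (intro bdd_aboveI[where M="C * B"]) auto
  qed
  have upper: "L t \<le> U f" if "C0c Z f" "t \<in> S f" for f t
    unfolding U_def by (rule cSup_upper[OF imageI[OF that(2)] bdd[OF that(1)]])
  have least: "U f \<le> x" if "t0 \<in> S f" "\<And>t. t \<in> S f \<Longrightarrow> L t \<le> x" for f x t0
    unfolding U_def using that by (intro cSup_least) auto
  have zeroS: "(\<lambda>z. 0) \<in> S f" if "\<And>z. z \<in> Z \<Longrightarrow> 0 \<le> f z" for f
    unfolding S_def using that by (auto simp: C0c_zero)
  have selfS: "f \<in> S f" if "C0c Z f" "\<And>z. z \<in> Z \<Longrightarrow> 0 \<le> f z" for f
    unfolding S_def using that by auto
  have L0: "L (\<lambda>z. 0) = 0" using scale[OF C0c_zero, of 0] by simp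
  have U_add: "U (\<lambda>z. f z + g z) = U f + U g"
    if f: "C0c Z f" "\<And>z. z \<in> Z \<Longrightarrow> 0 \<le> f z" and g: "C0c Z g" "\<And>z. z \<in> Z \<Longrightarrow> 0 \<le> g z" for f g
  proof (rule antisym)
    have fg: "C0c Z (\<lambda>z. f z + g z)" by (rule C0c_add[OF f(1) g(1)])
    show "U (\<lambda>z. f z + g z) \<le> U f + U g"
    proof (rule least[OF zeroS])
      fix t assume t: "t \<in> S (\<lambda>z. f z + g z)"
      have tc: "C0c Z t" using t S_def by auto
      have c: "continuous_on Z t" "continuous_on Z f" using tc f(1) unfolding C0c_def by auto
      have c1: "C0c Z (\<lambda>z. min (t z) (f z))"
        by (rule C0c_dominated[OF tc]) (use c f(2) in \<open>auto intro!: continuous_intros\<close>)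
      have c2: "C0c Z (\<lambda>z. max (t z - f z) 0)"
        by (rule C0c_dominated[OF tc]) (use c f(2) in \<open>auto intro!: continuous_intros\<close>)
      have 1: "(\<lambda>z. min (t z) (f z)) \<in> S f" unfolding S_def using c1 t f(2) by (auto simp: S_def)
      have 2: "(\<lambda>z. max (t z - f z) 0) \<in> S g" unfolding S_def using c2 t g(2) by (auto simp: S_def algebra_simps)
      have "(\<lambda>z. min (t z) (f z) + max (t z - f z) 0) = t" by (rule ext) (simp add: min_def max_def)
      hence "L t = L (\<lambda>z. min (t z) (f z)) + L (\<lambda>z. max (t z - f z) 0)" using add[OF c1 c2] by simp
      thus "L t \<le> U f + U g" using upper[OF f(1) 1] upper[OF g(1) 2] by linarith
    qed (use f(2) g(2) in simp)
    have "L t + L s \<le> U (\<lambda>z. f z + g z)" if t: "t \<in> S f" and s: "s \<in> S g" for t s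
    proof -
      have ts: "C0c Z t" "C0c Z s" using t s S_def by auto
      have "(\<lambda>z. t z + s z) \<in> S (\<lambda>z. f z + g z)"
        unfolding S_def using C0c_add[OF ts] t s by (auto simp: S_def intro: add_mono)
      thus ?thesis using upper[OF fg] add[OF ts] by force
    qed
    hence "L s \<le> U (\<lambda>z. f z + g z) - L t" if "t \<in> S f" "s \<in> S g" for t s using that by force
    hence "U g \<le> U (\<lambda>z. f z + g z) - L t" if "t \<in> S f" for t
      using that by (intro least[OF zeroS[OF g(2)]]) auto
    hence "L t \<le> U (\<lambda>z. f z + g z) - U g" if "t \<in> S f" for t using that by force
    hence "U f \<le> U (\<lambda>z. f z + g z) - U g" by (intro least[OF zeroS[OF f(2)]]) auto
    thus "U f + U g \<le> U (\<lambda>z. f z + g z)" by simp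
  qed
  have U_nonneg: "0 \<le> U f" if "C0c Z f" "\<And>z. z \<in> Z \<Longrightarrow> 0 \<le> f z" for f
    using upper[OF that(1) zeroS[OF that(2)]] L0 by simp
  have U_bound: "U f \<le> C * B" if "C0c Z f" "\<And>z. z \<in> Z \<Longrightarrow> 0 \<le> f z" "\<And>z. z \<in> Z \<Longrightarrow> f z \<le> B" "0 \<le> B" for f B
    by (rule least[OF zeroS[OF that(2)]]) (use that in \<open>auto intro: S_bdd\<close>)
  have U_scale_ge: "c * U f \<le> U (\<lambda>z. c * f z)"
    if f: "C0c Z f" "\<And>z. z \<in> Z \<Longrightarrow> 0 \<le> f z" and c: "c > 0" for f c
  proof -
    have "L t \<le> U (\<lambda>z. c * f z) / c" if t: "t \<in> S f" for t
    proof -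
      have tc: "C0c Z t" using t S_def by auto
      have "(\<lambda>z. c * t z) \<in> S (\<lambda>z. c * f z)"
        unfolding S_def using C0c_mult[OF tc] t c by (auto simp: S_def)
      hence "L (\<lambda>z. c * t z) \<le> U (\<lambda>z. c * f z)" by (rule upper[OF C0c_mult[OF f(1)]])
      thus ?thesis using c scale[OF tc, of c] by (simp add: field_simps)
    qed
    hence "U f \<le> U (\<lambda>z. c * f z) / c" by (intro least[OF zeroS[OF f(2)]]) auto
    thus ?thesis using c by (simp add: field_simps)
  qed
  have U_scale: "U (\<lambda>z. c * f z) = c * U f"
    if f: "C0c Z f" "\<And>z. z \<in> Z \<Longrightarrow> 0 \<le> f z" and c: "0 \<le> c" for f c
  proof (cases "c = 0")
    case True
    have "U (\<lambda>z. 0) = 0"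
      using U_bound[of "\<lambda>z. 0" 0] U_nonneg[of "\<lambda>z. 0"] C0c_zero by (intro antisym) auto
    thus ?thesis using True by simp
  next
    case False
    hence c0: "c > 0" using c by simp
    have "(1/c) * U (\<lambda>z. c * f z) \<le> U (\<lambda>z. (1/c) * (c * f z))"
      by (rule U_scale_ge[OF C0c_mult[OF f(1)]]) (use f(2) c0 in auto)
    also have "(\<lambda>z. (1/c) * (c * f z)) = f" using c0 by (intro ext) simp
    finally have "U (\<lambda>z. c * f z) \<le> c * U f" using c0 by (simp add: field_simps)
    thus ?thesis using U_scale_ge[OF f c0] by (intro antisym) auto
  qed
  interpret P: positive_functional Z U C
    by unfold_locales (rule U_add U_scale U_nonneg U_bound; assumption)+
  interpret N: positive_functional Z "\<lambda>f. U f - L f" "C + C"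
  proof
    fix f B assume f: "C0c Z f" "\<And>z. z \<in> Z \<Longrightarrow> 0 \<le> f z" and B: "\<And>z. z \<in> Z \<Longrightarrow> f z \<le> B" "0 \<le> (B :: real)"
    have "\<bar>L f\<bar> \<le> C * B" by (rule bound[OF f(1) B(2)]) (use f(2) B(1) in auto)
    thus "U f - L f \<le> (C + C) * B" using U_bound[OF f B] unfolding distrib_right by linarith
  next
    fix f :: "'a \<Rightarrow> real" assume f: "C0c Z f" "\<And>z. z \<in> Z \<Longrightarrow> 0 \<le> f z"
    show "0 \<le> U f - L f" using upper[OF f(1) selfS[OF f]] by simp
  next
    fix f g :: "'a \<Rightarrow> real"
    assume "C0c Z f" "C0c Z g" "\<And>z. z \<in> Z \<Longrightarrow> 0 \<le> f z" "\<And>z. z \<in> Z \<Longrightarrow> 0 \<le> g z"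
    thus "U (\<lambda>z. f z + g z) - L (\<lambda>z. f z + g z) = U f - L f + (U g - L g)"
      using U_add[of f g] add[of f g] by simp
  next
    fix f :: "'a \<Rightarrow> real" and c :: real assume "C0c Z f" "\<And>z. z \<in> Z \<Longrightarrow> 0 \<le> f z" "0 \<le> c"
    thus "U (\<lambda>z. c * f z) - L (\<lambda>z. c * f z) = c * (U f - L f)"
      using U_scale[of f c] scale[of f c] by (simp add: right_diff_distrib)
  qed
  show ?thesis
  proof (rule that[OF P.finite_riesz N.finite_riesz P.sets_riesz N.sets_riesz])
    fix f :: "'a \<Rightarrow> real" assume f: "C0c Z f"
    have fc: "continuous_on Z f" using f C0c_def by auto
    define p where "p z = max (f z) 0" for z
    define n where "n z = max (- f z) 0" for z
    have p: "C0c Z p" unfolding p_def by (rule C0c_dominated[OF f]) (use fc in \<open>auto intro!: continuous_intros\<close>)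
    have n: "C0c Z n" unfolding n_def by (rule C0c_dominated[OF f]) (use fc in \<open>auto intro!: continuous_intros\<close>)
    have nnn: "P.nn p" "P.nn n" "N.nn p" "N.nn n"
      unfolding P.nn_def N.nn_def using p n by (auto simp: p_def n_def)
    have fpn: "f = (\<lambda>z. p z + (-1) * n z)" unfolding p_def n_def by (rule ext) simp
    have "L (\<lambda>z. p z + (-1) * n z) = L p - L n"
      using add[OF p C0c_mult[OF n, of "-1"]] scale[OF n, of "-1"] by simp
    hence L: "L f = L p - L n" using fpn by simp
    have rep: "L g = (\<integral>z. g z \<partial>P.riesz_measure) - (\<integral>z. g z \<partial>N.riesz_measure)" if "P.nn g" "N.nn g" for g
      using P.riesz_representation[OF that(1)] N.riesz_representation[OF that(2)] by linarith
    have int: "integrable P.riesz_measure g" "integrable N.riesz_measure g" if "C0c Z g" for g :: "'a \<Rightarrow> real"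
    proof -
      obtain B where B: "\<And>z. z \<in> Z \<Longrightarrow> norm (g z) \<le> B" using C0c_bounded[OF \<open>C0c Z g\<close>] by metis
      have gc: "continuous_on Z g" using that C0c_def by auto
      show "integrable P.riesz_measure g"
        by (rule finite_measure.integrable_const_bound[OF P.finite_riesz, where B=B])
          (use B gc in \<open>auto intro!: AE_I2 P.continuous_on_measurable_riesz\<close>)
      show "integrable N.riesz_measure g"
        by (rule finite_measure.integrable_const_bound[OF N.finite_riesz, where B=B])
          (use B gc in \<open>auto intro!: AE_I2 N.continuous_on_measurable_riesz\<close>)
    qed
    have "(\<integral>z. f z \<partial>P.riesz_measure) = (\<integral>z. p z \<partial>P.riesz_measure) - (\<integral>z. n z \<partial>P.riesz_measure)"
      "(\<integral>z. f z \<partial>N.riesz_measure) = (\<integral>z. p z \<partial>N.riesz_measure) - (\<integral>z. n z \<partial>N.riesz_measure)"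
      unfolding fpn using int[OF p] int[OF n] by simp_all
    thus "L f = (\<integral>z. f z \<partial>P.riesz_measure) - (\<integral>z. f z \<partial>N.riesz_measure)"
      using L rep[OF nnn(1,3)] rep[OF nnn(2,4)] by linarith
  qed
qed

section \<open>Hahn-Banach extension under a sublinear bound\<close>

text \<open>Pointwise operations turn functions into a real vector space, so that the Hahn-Banach theorem and
  gauges can be stated for arbitrary real vector spaces and used for spaces of fields.\<close>

instantiation "fun" :: (type, real_vector) real_vector
begin

definition "c *\<^sub>R f = (\<lambda>x. c *\<^sub>R f x)"

instance
  by standard (simp_all add: scaleR_fun_def fun_eq_iff scaleR_add_right scaleR_add_left)

end

text \<open>Partial functionals are represented by their graphs, which are subspaces of \<open>'v \<times> real\<close>. Domination
  by \<open>p\<close> alone makes such a subspace the graph of a function, because \<open>p 0 = 0\<close>; therefore the datum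
  \<open>G0\<close> may be an arbitrary dominated subspace, and its single-valuedness is a consequence.\<close>

theorem Hahn_Banach_dominated:
  fixes X :: "'v::real_vector set" and p :: "'v \<Rightarrow> real" and G0 :: "('v \<times> real) set"
  assumes X: "subspace X"
    and p_add: "\<And>x y. x \<in> X \<Longrightarrow> y \<in> X \<Longrightarrow> p (x + y) \<le> p x + p y"
    and p_scale: "\<And>x c. x \<in> X \<Longrightarrow> 0 \<le> c \<Longrightarrow> p (c *\<^sub>R x) = c * p x"
    and G0: "subspace G0" "\<And>x r. (x, r) \<in> G0 \<Longrightarrow> x \<in> X \<and> r \<le> p x"
  obtains L where "\<And>x y. x \<in> X \<Longrightarrow> y \<in> X \<Longrightarrow> L (x + y) = L x + L y"
    "\<And>x c. x \<in> X \<Longrightarrow> L (c *\<^sub>R x) = c * L x"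
    "\<And>x. x \<in> X \<Longrightarrow> L x \<le> p x"
    "\<And>x r. (x, r) \<in> G0 \<Longrightarrow> L x = r"
proof -
  define \<G> where "\<G> = {G. subspace G \<and> G0 \<subseteq> G \<and> (\<forall>x r. (x, r) \<in> G \<longrightarrow> x \<in> X \<and> r \<le> p x)}"
  have "\<exists>G\<in>\<G>. \<forall>H\<in>\<G>. G \<subseteq> H \<longrightarrow> H = G"
  proof (rule subset_Zorn_nonempty)
    show "\<G> \<noteq> {}" using G0 unfolding \<G>_def by blast
    fix \<C> assume ne: "\<C> \<noteq> {}" and ch: "subset.chain \<G> \<C>"
    have sub: "\<And>G. G \<in> \<C> \<Longrightarrow> G \<in> \<G>" and lin: "\<And>G H. G \<in> \<C> \<Longrightarrow> H \<in> \<C> \<Longrightarrow> G \<subseteq> H \<or> H \<subseteq> G"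
      using ch unfolding subset_chain_def by auto
    have "subspace (\<Union>\<C>)"
    proof (rule subspaceI)
      obtain G where "G \<in> \<C>" using ne by auto
      thus "0 \<in> \<Union>\<C>" using sub subspace_0 unfolding \<G>_def by blast
    next
      fix a b assume "a \<in> \<Union>\<C>" "b \<in> \<Union>\<C>"
      then obtain G H where GH: "G \<in> \<C>" "H \<in> \<C>" "a \<in> G" "b \<in> H" by blast
      obtain K where K: "K \<in> \<C>" "a \<in> K" "b \<in> K" using lin[OF GH(1,2)] GH by blast
      have "subspace K" using sub[OF K(1)] unfolding \<G>_def by blast
      thus "a + b \<in> \<Union>\<C>" using K subspace_add by blast
    next
      fix c :: real and a assume "a \<in> \<Union>\<C>"
      then obtain G where G: "G \<in> \<C>" "a \<in> G" by blast
      have "subspace G" using sub[OF G(1)] unfolding \<G>_def by blast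
      thus "c *\<^sub>R a \<in> \<Union>\<C>" using G subspace_scale by blast
    qed
    moreover have "G0 \<subseteq> \<Union>\<C>" using ne sub unfolding \<G>_def by blast
    moreover have "x \<in> X \<and> r \<le> p x" if "(x, r) \<in> \<Union>\<C>" for x r
      using that sub unfolding \<G>_def by blast
    ultimately show "\<Union>\<C> \<in> \<G>" unfolding \<G>_def by blast
  qed
  then obtain G where "G \<in> \<G>" and max: "\<And>H. H \<in> \<G> \<Longrightarrow> G \<subseteq> H \<Longrightarrow> H = G" by blast
  hence G: "subspace G" "G0 \<subseteq> G" and dom: "\<And>x r. (x, r) \<in> G \<Longrightarrow> x \<in> X" "\<And>x r. (x, r) \<in> G \<Longrightarrow> r \<le> p x"
    unfolding \<G>_def by auto
  have X0: "0 \<in> X" by (rule subspace_0[OF X])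
  have p0: "p 0 = 0" using p_scale[OF X0, of 0] by simp
  have unique: "r = s" if "(x, r) \<in> G" "(x, s) \<in> G" for x r s
  proof -
    have "(x, r) - (x, s) \<in> G" "(x, s) - (x, r) \<in> G" using subspace_diff[OF G(1)] that by blast+
    hence "(0, r - s) \<in> G" "(0, s - r) \<in> G" by simp_all
    hence "r - s \<le> 0" "s - r \<le> 0" using dom(2) p0 by fastforce+
    thus ?thesis by simp
  qed
  have total: "\<exists>r. (x0, r) \<in> G" if x0: "x0 \<in> X" for x0
  proof -
    have sep: "r - p (y - x0) \<le> p (z + x0) - s" if "(y, r) \<in> G" "(z, s) \<in> G" for y r z s
    proof -
      have "(y, r) + (z, s) \<in> G" using subspace_add[OF G(1)] that by blast
      hence "(y + z, r + s) \<in> G" by simp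
      hence "r + s \<le> p (y + z)" by (rule dom(2))
      also have "y + z = (y - x0) + (z + x0)" by simp
      also have "p \<dots> \<le> p (y - x0) + p (z + x0)"
        using x0 dom(1)[OF that(1)] dom(1)[OF that(2)] X by (intro p_add subspace_diff subspace_add)
      finally show ?thesis by simp
    qed
    define A where "A = (\<lambda>(y, r). r - p (y - x0)) ` G"
    have G_0: "(0, 0) \<in> G" using subspace_0[OF G(1)] by (simp add: zero_prod_def)
    \<comment> \<open>any value between the two sides of the previous inequality extends the functional\<close>
    define c where "c = Sup A"
    have c_ge: "r - p (y - x0) \<le> c" if "(y, r) \<in> G" for y r
      unfolding c_def
    proof (rule cSup_upper)
      show "r - p (y - x0) \<in> A" unfolding A_def using that by force
      show "bdd_above A" unfolding A_def using sep[OF _ G_0] by (intro bdd_aboveI2) auto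
    qed
    have c_le: "c \<le> p (z + x0) - s" if "(z, s) \<in> G" for z s
      unfolding c_def
    proof (rule cSup_least)
      show "A \<noteq> {}" unfolding A_def using G_0 by blast
      show "a \<le> p (z + x0) - s" if "a \<in> A" for a
        using that sep[OF _ \<open>(z, s) \<in> G\<close>] unfolding A_def by auto
    qed
    define H where "H = {a + b | a b. a \<in> G \<and> b \<in> span {(x0, c)}}"
    have "subspace H" unfolding H_def by (rule subspace_sums[OF G(1) subspace_span])
    moreover have GH: "G \<subseteq> H"
    proof
      fix a assume "a \<in> G"
      thus "a \<in> H" unfolding H_def using span_zero[of "{(x0, c)}"] by (metis (mono_tags, lifting) add.right_neutral mem_Collect_eq)
    qed
    moreover have "x \<in> X \<and> r \<le> p x" if "(x, r) \<in> H" for x r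
    proof -
      obtain a b where ab: "(x, r) = a + b" "a \<in> G" "b \<in> span {(x0, c)}"
        using \<open>(x, r) \<in> H\<close> unfolding H_def by blast
      obtain t where t: "b = t *\<^sub>R (x0, c)" using ab(3) by (auto simp: span_singleton)
      obtain y s where ys: "a = (y, s)" by fastforce
      have yG: "(y, s) \<in> G" using ab(2) ys by simp
      have yX: "y \<in> X" by (rule dom(1)[OF yG])
      have x: "x = y + t *\<^sub>R x0" and r: "r = s + t * c" using ab(1) t ys by auto
      have xX: "x \<in> X" unfolding x using X yX x0 by (intro subspace_add subspace_scale)
      have scaled: "((1/u) *\<^sub>R y, s / u) \<in> G" for u
        using subspace_scale[OF G(1) yG, of "1/u"] by simp
      consider "t = 0" | "t > 0" | "t < 0" by linarith
      hence "r \<le> p x"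
      proof cases
        case 1 thus ?thesis using dom(2)[OF yG] x r by simp
      next
        case 2
        have "x = t *\<^sub>R ((1/t) *\<^sub>R y + x0)" unfolding x using 2 by (simp add: scaleR_add_right)
        moreover have "(1/t) *\<^sub>R y + x0 \<in> X" using X yX x0 by (intro subspace_add subspace_scale)
        ultimately have "p x = t * p ((1/t) *\<^sub>R y + x0)" using p_scale 2 by (metis less_imp_le)
        moreover have "t * c \<le> t * (p ((1/t) *\<^sub>R y + x0) - s / t)"
          using c_le[OF scaled[of t]] 2 by (intro mult_left_mono) auto
        ultimately show ?thesis unfolding r using 2 by (simp add: right_diff_distrib)
      next
        case 3
        define u where "u = - t"
        have u: "u > 0" "t = - u" using 3 by (auto simp: u_def)
        have "x = u *\<^sub>R ((1/u) *\<^sub>R y - x0)" unfolding x using u by (simp add: scaleR_diff_right)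
        moreover have "(1/u) *\<^sub>R y - x0 \<in> X" using X yX x0 by (intro subspace_diff subspace_scale)
        ultimately have "p x = u * p ((1/u) *\<^sub>R y - x0)" using p_scale u(1) by (metis less_imp_le)
        moreover have "u * (s / u - p ((1/u) *\<^sub>R y - x0)) \<le> u * c"
          using c_ge[OF scaled[of u]] u by (intro mult_left_mono) auto
        ultimately show ?thesis unfolding r u(2) using u(1) by (simp add: right_diff_distrib)
      qed
      thus ?thesis using xX by simp
    qed
    ultimately have "H \<in> \<G>" using G(2) unfolding \<G>_def by blast
    hence "H = G" using max GH by blast
    moreover have "(x0, c) \<in> H"
      unfolding H_def using subspace_0[OF G(1)] span_base[of "(x0, c)" "{(x0, c)}"]
      by (metis (mono_tags, lifting) add.left_neutral mem_Collect_eq singletonI)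
    ultimately show ?thesis by blast
  qed
  define L where "L x = (THE r. (x, r) \<in> G)" for x
  have L_eq: "L x = r" if "(x, r) \<in> G" for x r
    unfolding L_def using that unique by (intro the_equality) auto
  have L: "(x, L x) \<in> G" if "x \<in> X" for x using total[OF that] L_eq by auto
  show ?thesis
  proof (rule that)
    fix x y assume "x \<in> X" "y \<in> X"
    hence "(x, L x) + (y, L y) \<in> G" by (intro subspace_add[OF G(1)] L)
    thus "L (x + y) = L x + L y" by (intro L_eq) simp
  next
    fix x and c :: real assume "x \<in> X"
    hence "c *\<^sub>R (x, L x) \<in> G" by (intro subspace_scale[OF G(1)] L)
    thus "L (c *\<^sub>R x) = c * L x" by (intro L_eq) simp
  next
    fix x assume "x \<in> X" thus "L x \<le> p x" by (intro dom(2) L)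
  next
    fix x r assume "(x, r) \<in> G0" thus "L x = r" using G(2) by (intro L_eq) auto
  qed
qed

section \<open>Affine minorants and the support function of the constraint set\<close>

text \<open>This is \<open>a + f\<^sup>*(c) \<le> 0\<close>, see \<open>conjugate_le_iff_affine_minorant\<close>. Negative values of the affine
  function are truncated to zero by \<open>ennreal\<close>, which is harmless as \<open>f\<close> is nonnegative.\<close>

definition affine_minorant :: "(real \<Rightarrow> ennreal) \<Rightarrow> real \<Rightarrow> real \<Rightarrow> bool" where
  "affine_minorant f a c \<longleftrightarrow> (\<forall>t. ennreal (a + c * t) \<le> f t)"

lemma conjugate_le_iff_affine_minorant:
  "ereal a + conjugate f c \<le> 0 \<longleftrightarrow> affine_minorant f a c"
proof -
  have pt: "ereal a + (ereal (t * c) - enn2ereal (f t)) \<le> 0 \<longleftrightarrow> ennreal (a + c * t) \<le> f t" for t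
  proof (cases "f t")
    case (real r)
    have "a + (c * t - r) \<le> 0 \<longleftrightarrow> a + c * t \<le> r" by linarith
    thus ?thesis using real by (simp add: enn2ereal_ennreal ennreal_le_iff mult.commute)
  next
    case top
    thus ?thesis by simp
  qed
  have "ereal a + conjugate f c = (SUP t. ereal a + (ereal (t * c) - enn2ereal (f t)))"
    unfolding conjugate_def by (rule SUP_ereal_add_right[symmetric]) auto
  hence "ereal a + conjugate f c \<le> 0 \<longleftrightarrow> (\<forall>t. ereal a + (ereal (t * c) - enn2ereal (f t)) \<le> 0)"
    by (simp add: SUP_le_iff)
  thus ?thesis unfolding pt affine_minorant_def .
qed

lemma affine_minorant_nonpos: "a \<le> 0 \<Longrightarrow> affine_minorant f a 0"
  unfolding affine_minorant_def by (simp add: ennreal_neg)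

lemma affine_minorant_convex:
  assumes "affine_minorant f a c" "affine_minorant f a' c'" "0 \<le> u" "0 \<le> w" "u + w = 1"
  shows "affine_minorant f (u * a + w * a') (u * c + w * c')"
  unfolding affine_minorant_def
proof
  fix t
  show "ennreal (u * a + w * a' + (u * c + w * c') * t) \<le> f t"
  proof (cases "f t")
    case (real r)
    hence 1: "a + c * t \<le> r" "a' + c' * t \<le> r"
      using assms(1,2) unfolding affine_minorant_def by (metis ennreal_le_iff)+
    have "u * (a + c * t) + w * (a' + c' * t) \<le> u * r + w * r"
      by (intro add_mono mult_left_mono 1 assms)
    also have "\<dots> = r" using assms(5) by (simp flip: distrib_right)
    finally show ?thesis using real by (simp add: ennreal_le_iff algebra_simps)
  qed simp
qed

lemma closed_epigraph:
  assumes lsc: "lower_semicont f"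
  shows "closed {(t, y). f t \<le> ennreal y}"
  unfolding closed_sequential_limits
proof (intro allI impI, elim conjE)
  fix X l assume X: "\<forall>n. X n \<in> {(t, y). f t \<le> ennreal y}" and lim: "X \<longlonglongrightarrow> l"
  obtain t y where l: "l = (t, y)" by fastforce
  have t: "(\<lambda>n. fst (X n)) \<longlonglongrightarrow> t" and y: "(\<lambda>n. snd (X n)) \<longlonglongrightarrow> y"
    using tendsto_fst[OF lim] tendsto_snd[OF lim] l by auto
  have "f t \<le> ennreal y"
  proof (rule ccontr)
    assume "\<not> f t \<le> ennreal y"
    then obtain r where r: "ennreal y < r" "r < f t" using dense by (metis not_le)
    have "f t \<le> Liminf (at t) f" using lsc unfolding lower_semicont_def by blast
    hence "eventually (\<lambda>s. r < f s) (at t)" using r(2) unfolding le_Liminf_iff by blast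
    hence "eventually (\<lambda>s. r < f s) (nhds t)"
      using r(2) unfolding eventually_at_filter by (auto elim: eventually_mono)
    hence 1: "eventually (\<lambda>n. r < f (fst (X n))) sequentially"
      using t unfolding filterlim_iff by blast
    have "(\<lambda>n. ennreal (snd (X n))) \<longlonglongrightarrow> ennreal y" by (rule tendsto_ennrealI[OF y])
    hence 2: "eventually (\<lambda>n. ennreal (snd (X n)) < r) sequentially" using r(1) by (rule order_tendstoD)
    have "eventually (\<lambda>n. False) sequentially"
      using 1 2
    proof eventually_elim
      case (elim n)
      have "f (fst (X n)) \<le> ennreal (snd (X n))" using X by (simp add: case_prod_beta)
      thus False using elim by simp
    qed
    thus False by simp
  qed
  thus "l \<in> {(t, y). f t \<le> ennreal y}" using l by simp
qed

lemma convex_epigraph: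
  assumes cv: "convex_ext f" and pos: "\<And>t. f t > 0"
  shows "convex {(t, y). f t \<le> ennreal y}"
  unfolding convex_alt
proof (intro ballI allI impI)
  fix p q :: "real \<times> real" and u :: real
  assume p: "p \<in> {(t, y). f t \<le> ennreal y}" and q: "q \<in> {(t, y). f t \<le> ennreal y}" and u: "0 \<le> u \<and> u \<le> 1"
  obtain s x where ps: "p = (s, x)" by fastforce
  obtain t y where qt: "q = (t, y)" by fastforce
  have fx: "f s \<le> ennreal x" and fy: "f t \<le> ennreal y" using p q ps qt by auto
  have "0 < ennreal x" "0 < ennreal y" using fx fy pos less_le_trans by blast+
  hence xy: "0 < x" "0 < y" by simp_all
  have "f ((1 - u) * s + u * t) \<le> ennreal (1 - u) * f s + ennreal u * f t"
    using cv u unfolding convex_ext_def by blast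
  also have "\<dots> \<le> ennreal (1 - u) * ennreal x + ennreal u * ennreal y"
    by (intro add_mono mult_left_mono fx fy) auto
  also have "\<dots> = ennreal ((1 - u) * x + u * y)"
    using xy u by (simp add: ennreal_mult[symmetric] ennreal_plus[symmetric] del: ennreal_plus)
  finally show "(1 - u) *\<^sub>R p + u *\<^sub>R q \<in> {(t, y). f t \<le> ennreal y}"
    by (simp add: ps qt)
qed

text \<open>Separate \<open>(\<tau>, y)\<close> from the closed convex epigraph. A non-vertical separating line is the minorant.
  A vertical one separates \<open>\<tau>\<close> from the domain of \<open>f\<close>; steep lines through the separating abscissa
  are then nonpositive on the domain and as large as desired at \<open>\<tau>\<close>.\<close>

theorem Fenchel_Moreau_real:
  assumes cv: "convex_ext f" and lsc: "lower_semicont f" and pos: "\<And>t. f t > 0"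
    and y: "ennreal y < f \<tau>"
  obtains a c where "affine_minorant f a c" "y < a + c * \<tau>"
proof (cases "\<forall>t. f t = \<infinity>")
  case True
  show ?thesis by (rule that[of "y + 1" 0]) (use True in \<open>auto simp: affine_minorant_def\<close>)
next
  case False
  then obtain t0 where t0: "f t0 \<noteq> \<infinity>" by blast
  define x0 where "x0 = enn2real (f t0)"
  have x0: "f t0 = ennreal x0" "0 \<le> x0" using t0 by (auto simp: x0_def less_top)
  let ?E = "{(t, y). f t \<le> ennreal y}"
  have "(\<tau>, y) \<notin> ?E" using y by auto
  then obtain w b where w: "w \<bullet> (\<tau>, y) < b" "\<forall>z\<in>?E. w \<bullet> z > b"
    using separating_hyperplane_closed_point[OF convex_epigraph[OF cv pos] closed_epigraph[OF lsc], of "(\<tau>, y)"] by blast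
  obtain \<alpha> \<beta> where ab: "w = (\<alpha>, \<beta>)" by fastforce
  have 1: "\<alpha> * \<tau> + \<beta> * y < b" using w(1) ab by simp
  have 2: "b < \<alpha> * t + \<beta> * x" if "f t \<le> ennreal x" for t x
  proof -
    have "(t, x) \<in> ?E" using that by simp
    hence "b < w \<bullet> (t, x)" using w(2) by blast
    thus ?thesis using ab by simp
  qed
  have "\<beta> \<ge> 0"
  proof (rule ccontr)
    assume "\<not> \<beta> \<ge> 0"
    define x where "x = max x0 ((b - \<alpha> * t0) / \<beta>)"
    have "f t0 \<le> ennreal x" using x0 by (simp add: x_def ennreal_leI)
    hence "b < \<alpha> * t0 + \<beta> * x" by (rule 2)
    moreover have "\<beta> * x \<le> \<beta> * ((b - \<alpha> * t0) / \<beta>)"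
      using \<open>\<not> \<beta> \<ge> 0\<close> by (intro mult_left_mono_neg) (auto simp: x_def)
    ultimately show False using \<open>\<not> \<beta> \<ge> 0\<close> by simp
  qed
  show ?thesis
  proof (cases "\<beta> = 0")
    case False
    hence \<beta>: "\<beta> > 0" using \<open>\<beta> \<ge> 0\<close> by simp
    have "ennreal (b / \<beta> + - \<alpha> / \<beta> * t) \<le> f t" for t
    proof (cases "f t")
      case (real x)
      hence "b < \<alpha> * t + \<beta> * x" by (intro 2) simp
      hence "b / \<beta> + - \<alpha> / \<beta> * t \<le> x" using \<beta> by (simp add: field_simps)
      thus ?thesis using real by (simp add: ennreal_leI)
    qed simp
    moreover have "y < b / \<beta> + - \<alpha> / \<beta> * \<tau>" using 1 \<beta> by (simp add: field_simps)
    ultimately show ?thesis using that unfolding affine_minorant_def by blast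
  next
    case True
    define k where "k = (\<bar>y\<bar> + 1) / (b - \<alpha> * \<tau>)"
    have k: "k > 0" "k * (b - \<alpha> * \<tau>) = \<bar>y\<bar> + 1" using 1 True by (auto simp: k_def)
    have "ennreal (k * b + - k * \<alpha> * t) \<le> f t" for t
    proof (cases "f t")
      case (real x)
      hence "b < \<alpha> * t" using 2[of t x] True by simp
      hence "k * (b - \<alpha> * t) \<le> 0" using k(1) by (intro mult_nonneg_nonpos) auto
      thus ?thesis by (simp add: ennreal_neg algebra_simps)
    qed simp
    moreover have "y < k * b + - k * \<alpha> * \<tau>" using k(2) by (simp add: algebra_simps)
    ultimately show ?thesis using that unfolding affine_minorant_def by blast
  qed
qed

text \<open>A minorant of slope \<open>c\<close> gives \<open>f(s t) / s \<ge> a / s + c t\<close>, which bounds the limit from below. For the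
  upper bound let \<open>R\<close> be the supremum of \<open>c t\<close>. From a point \<open>t1 = s1 t\<close> where \<open>f\<close> is finite every
  minorant grows at most at rate \<open>R\<close>, and by Fenchel-Moreau so does \<open>f\<close>. For \<open>t = 0\<close> the identity would
  fail when \<open>f 0 = \<infinity>\<close>.\<close>

lemma recession_eq_SUP:
  assumes cv: "convex_ext f" and lsc: "lower_semicont f" and pos: "\<And>t. f t > 0" and t: "t \<noteq> 0"
  shows "recession f t = (SUP (a, c)\<in>{(a, c). affine_minorant f a c}. ennreal (c * t))" (is "_ = ?R")
proof -
  have upper: "ennreal (c * t) \<le> ?R" if "affine_minorant f a c" for a c
    using that by (intro SUP_upper2[of "(a, c)"]) auto
  have "((\<lambda>s::real. f (s * t) / ennreal s) \<longlongrightarrow> ?R) at_top"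
  proof (rule order_tendstoI)
    fix y assume "y < ?R"
    then obtain a c where ac: "affine_minorant f a c" "y < ennreal (c * t)"
      unfolding less_SUP_iff by auto
    obtain y' where y': "y = ennreal y'" "0 \<le> y'" using ac(2) by (cases y) auto
    have "y' < c * t" using ac(2) y' by (simp add: ennreal_less_iff)
    moreover have "((\<lambda>s. a / s + c * t) \<longlongrightarrow> 0 + c * t) at_top"
      by (intro tendsto_add tendsto_const tendsto_divide_0[OF tendsto_const] filterlim_at_top_imp_at_infinity filterlim_ident)
    ultimately have "eventually (\<lambda>s. y' < a / s + c * t) at_top" by (intro order_tendstoD(1)) auto
    moreover have "eventually (\<lambda>s::real. s > 0) at_top" by (rule eventually_gt_at_top)
    ultimately show "eventually (\<lambda>s. y < f (s * t) / ennreal s) at_top"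
    proof eventually_elim
      case (elim s)
      have e: "a + c * (s * t) = (a / s + c * t) * s" using elim by (simp add: field_simps)
      have "y < ennreal (a / s + c * t)" using elim y' by (simp add: ennreal_less_iff)
      also have "\<dots> = ennreal (a + c * (s * t)) / ennreal s"
        using elim y'(2) unfolding e by (subst divide_ennreal) auto
      also have "\<dots> \<le> f (s * t) / ennreal s"
        using ac(1) unfolding affine_minorant_def by (intro divide_right_mono_ennreal) blast
      finally show ?case .
    qed
  next
    fix y assume y: "?R < y"
    hence "?R < \<infinity>" using less_le_trans top_greatest infinity_ennreal_def by metis
    then obtain R where R: "?R = ennreal R" "0 \<le> R"
      using ennreal_cases[of ?R] by (metis infinity_ennreal_def less_irrefl)
    have cR: "c * t \<le> R" if "affine_minorant f a c" for a c
      using upper[OF that] R by (simp add: ennreal_le_iff)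
    have "\<exists>t1. f t1 \<noteq> \<infinity>"
    proof (rule ccontr)
      assume "\<nexists>t1. f t1 \<noteq> \<infinity>"
      hence "affine_minorant f 0 ((R + 1) / t)" by (simp add: affine_minorant_def)
      thus False using cR t by fastforce
    qed
    then obtain t1 where t1: "f t1 \<noteq> \<infinity>" by blast
    define F where "F = enn2real (f t1)"
    have F: "f t1 = ennreal F" "0 \<le> F" using t1 by (auto simp: F_def less_top)
    define s1 where "s1 = t1 / t"
    have le: "f (s * t) \<le> ennreal (F + R * (s - s1))" if s: "s > s1" for s
    proof (rule ccontr)
      assume "\<not> ?thesis"
      then obtain a c where ac: "affine_minorant f a c" "F + R * (s - s1) < a + c * (s * t)"
        using Fenchel_Moreau_real[OF cv lsc pos, of "F + R * (s - s1)" "s * t"] by (metis not_le)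
      have "ennreal (a + c * t1) \<le> ennreal F" using ac(1) F(1) unfolding affine_minorant_def by metis
      hence "a + c * t1 \<le> F" using F(2) by (simp add: ennreal_le_iff)
      moreover have "(c * t) * (s - s1) \<le> R * (s - s1)" using cR[OF ac(1)] s by (intro mult_right_mono) auto
      moreover have "a + c * (s * t) = (a + c * t1) + (c * t) * (s - s1)"
        using t by (simp add: s1_def field_simps)
      ultimately show False using ac(2) by linarith
    qed
    obtain z where z: "?R < ennreal z" "ennreal z \<le> y"
    proof (cases y)
      case (real r) thus ?thesis using y that by auto
    next
      case top
      show ?thesis by (rule that[of "R + 1"]) (use R top in \<open>auto simp: ennreal_less_iff\<close>)
    qed
    have Rz: "R < z" using z(1) R by (simp add: ennreal_less_iff)
    have "((\<lambda>s. (F - R * s1) / s + R) \<longlongrightarrow> 0 + R) at_top"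
      by (intro tendsto_add tendsto_const tendsto_divide_0[OF tendsto_const] filterlim_at_top_imp_at_infinity filterlim_ident)
    hence "eventually (\<lambda>s. (F - R * s1) / s + R < z) at_top" using Rz by (intro order_tendstoD(2)) auto
    moreover have "eventually (\<lambda>s::real. s > max 0 s1) at_top" by (rule eventually_gt_at_top)
    ultimately show "eventually (\<lambda>s. f (s * t) / ennreal s < y) at_top"
    proof eventually_elim
      case (elim s)
      have s: "s > 0" "s > s1" using elim by auto
      have e: "F + R * (s - s1) = ((F - R * s1) / s + R) * s" using s by (simp add: field_simps)
      have nn: "F + R * (s - s1) \<ge> 0" using F R s by auto
      have "f (s * t) / ennreal s \<le> ennreal (F + R * (s - s1)) / ennreal s"
        by (rule divide_right_mono_ennreal[OF le[OF s(2)]])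
      also have "\<dots> = ennreal ((F + R * (s - s1)) / s)" using nn s by (intro divide_ennreal)
      also have "(F + R * (s - s1)) / s = (F - R * s1) / s + R" unfolding e using s by simp
      also have "ennreal \<dots> < ennreal z" using elim R Rz by (intro ennreal_lessI) auto
      finally show ?case using z(2) by simp
    qed
  qed
  thus ?thesis unfolding recession_def by (intro tendsto_Lim) auto
qed

lemma perp_simps [simp]: "perp x $ 1 = x $ 2" "perp x $ 2 = - x $ 1"
  unfolding perp_def by simp_all

lemma circle_sum_squares: "v \<in> circle \<Longrightarrow> v $ 1 * v $ 1 + v $ 2 * v $ 2 = 1"
  using dot_square_norm[of v] by (simp add: inner_vec_def sum_2)

lemma circle_decomposition:
  assumes "v \<in> circle"
  shows "x = (v \<bullet> x) *\<^sub>R v + (perp v \<bullet> x) *\<^sub>R perp v"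
proof -
  have "(v $ 1 * x $ 1 + v $ 2 * x $ 2) * v $ 1 + (v $ 2 * x $ 1 + - v $ 1 * x $ 2) * v $ 2
      = x $ 1 * (v $ 1 * v $ 1 + v $ 2 * v $ 2)"
    "(v $ 1 * x $ 1 + v $ 2 * x $ 2) * v $ 2 + (v $ 2 * x $ 1 + - v $ 1 * x $ 2) * - v $ 1
      = x $ 2 * (v $ 1 * v $ 1 + v $ 2 * v $ 2)"
    by (simp_all add: algebra_simps)
  thus ?thesis
    using circle_sum_squares[OF assms] by (simp add: vec_eq_iff forall_2 inner_vec_def sum_2)
qed

text \<open>Sections of the constraint set that are constant in the moving frame \<open>v, perp v\<close>: the constraint
  bounds the component along \<open>v\<close> by the angular component and leaves the component along \<open>perp v\<close>
  free, the same condition for every \<open>v\<close>.\<close>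

definition frame_section :: "real \<times> real \<times> real \<Rightarrow> real^2 \<Rightarrow> (real^2) \<times> real" where
  "frame_section q v = (fst q *\<^sub>R v + fst (snd q) *\<^sub>R perp v, snd (snd q))"

lemma frame_section_inner:
  "frame_section q v \<bullet> p = fst q * (v \<bullet> fst p) + fst (snd q) * (perp v \<bullet> fst p) + snd (snd q) * snd p"
  by (simp add: frame_section_def inner_prod_def inner_add_left)

lemma inner_perp_self [simp]: "v \<bullet> perp v = 0" "perp v \<bullet> v = 0"
  by (simp_all add: inner_vec_def sum_2)

lemma inner_frame_section: 
  assumes "v \<in> circle"
  shows "v \<bullet> fst (frame_section q v) = fst q" "snd (frame_section q v) = snd (snd q)"
  using assms dot_square_norm[of v] by (simp_all add: frame_section_def inner_add_right)

lemma support_le_hfun: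
  assumes cv: "convex_ext f" and lsc: "lower_semicont f" and pos: "\<And>t. f t > 0"
    and v: "v \<in> circle" and \<xi>: "affine_minorant f (v \<bullet> fst \<xi>) (snd \<xi>)"
  shows "ennreal (\<xi> \<bullet> p) \<le> hfun f v p"
proof -
  consider (ray) r where "r > 0" "fst p = r *\<^sub>R v" | (zero) "fst p = 0" | (out) "hfun f v p = top"
    unfolding hfun_def by (metis order_le_less scaleR_zero_left)
  thus ?thesis
  proof cases
    case ray
    have v0: "v \<noteq> 0" using v by auto
    have n: "norm (fst p) = r" using ray v by simp
    have h: "hfun f v p = ennreal r * f (snd p / r)"
      unfolding hfun_def n using ray v0 by (auto intro!: exI[of _ r])
    have "\<xi> \<bullet> p = r * (v \<bullet> fst \<xi> + snd \<xi> * (snd p / r))"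
      using ray by (simp add: inner_prod_def distrib_left inner_commute)
    hence "ennreal (\<xi> \<bullet> p) = ennreal r * ennreal (v \<bullet> fst \<xi> + snd \<xi> * (snd p / r))"
      using ennreal_mult'[of r] ray by simp
    also have "\<dots> \<le> ennreal r * f (snd p / r)"
      by (rule mult_left_mono) (use \<xi> affine_minorant_def in blast, simp)
    finally show ?thesis unfolding h .
  next
    case zero
    have h: "hfun f v p = recession f (snd p)" unfolding hfun_def using zero by simp
    have e: "\<xi> \<bullet> p = snd \<xi> * snd p" using zero by (simp add: inner_prod_def)
    show ?thesis
    proof (cases "snd p = 0")
      case True thus ?thesis using e by simp
    next
      case False
      show ?thesis unfolding h e recession_eq_SUP[OF cv lsc pos False]
        using \<xi> by (intro SUP_upper2[of "(v \<bullet> fst \<xi>, snd \<xi>)"]) auto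
    qed
  qed simp
qed

text \<open>If \<open>p\<^sup>x\<close> is a positive multiple of \<open>v\<close> this is Fenchel-Moreau, and for \<open>p\<^sup>x = 0\<close> it is the formula
  for the recession function. Otherwise either the free component along \<open>perp v\<close> or a very negative
  component along \<open>v\<close> makes the pairing as large as desired.\<close>

lemma hfun_attained:
  assumes cv: "convex_ext f" and lsc: "lower_semicont f" and pos: "\<And>t. f t > 0"
    and v: "v \<in> circle" and p: "p \<noteq> 0" and y: "ennreal y < hfun f v p"
  obtains q where "affine_minorant f (fst q) (snd (snd q))" "y < frame_section q v \<bullet> p"
proof -
  consider (ray) r where "r > 0" "fst p = r *\<^sub>R v" | (zero) "fst p = 0"
    | (out) "\<not> (\<exists>r\<ge>0. fst p = r *\<^sub>R v)"
    by (metis order_le_less scaleR_zero_left)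
  thus ?thesis
  proof cases
    case ray
    have v0: "v \<noteq> 0" using v by auto
    have n: "norm (fst p) = r" using ray v by simp
    have "ennreal y < ennreal r * f (snd p / r)"
      using y unfolding hfun_def n using ray v0 by (auto split: if_splits)
    hence "ennreal (y / r) < f (snd p / r)"
    proof (rule contrapos_pp)
      assume "\<not> ennreal (y / r) < f (snd p / r)"
      hence "ennreal r * f (snd p / r) \<le> ennreal r * ennreal (y / r)" by (intro mult_left_mono) auto
      also have "\<dots> = ennreal y" using ennreal_mult'[of r "y / r"] ray by simp
      finally show "\<not> ennreal y < ennreal r * f (snd p / r)" by simp
    qed
    then obtain a c where ac: "affine_minorant f a c" "y / r < a + c * (snd p / r)"
      using Fenchel_Moreau_real[OF cv lsc pos] by metis
    have vv: "v \<bullet> v = 1" using v dot_square_norm[of v] by simp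
    have "y < frame_section (a, 0, c) v \<bullet> p"
      using ac(2) ray by (simp add: frame_section_inner vv field_simps)
    thus ?thesis using ac(1) that[of "(a, 0, c)"] by simp
  next
    case zero
    hence s: "snd p \<noteq> 0" using p by (simp add: prod_eq_iff)
    have "ennreal y < recession f (snd p)" using y zero unfolding hfun_def by simp
    then obtain a c where ac: "affine_minorant f a c" "ennreal y < ennreal (c * snd p)"
      unfolding recession_eq_SUP[OF cv lsc pos s] less_SUP_iff by auto
    have "y < c * snd p" using ac(2) by (metis ennreal_leI not_le)
    hence "y < frame_section (a, 0, c) v \<bullet> p" using zero by (simp add: frame_section_inner)
    thus ?thesis using ac(1) that[of "(a, 0, c)"] by simp
  next
    case out
    show ?thesis
    proof (cases "perp v \<bullet> fst p = 0")
      case False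
      have "y < frame_section (0, (y + 1) / (perp v \<bullet> fst p), 0) v \<bullet> p"
        using False by (simp add: frame_section_inner)
      thus ?thesis using that[of "(0, (y + 1) / (perp v \<bullet> fst p), 0)"] affine_minorant_nonpos[of 0 f] by simp
    next
      case True
      define r where "r = v \<bullet> fst p"
      have "fst p = r *\<^sub>R v" using circle_decomposition[OF v, of "fst p"] True by (simp add: r_def)
      hence r: "r < 0" using out by (meson not_le)
      define a where "a = (\<bar>y\<bar> + 1) / r"
      have a: "a \<le> 0" "a * r = \<bar>y\<bar> + 1" using r by (auto simp: a_def divide_nonneg_neg)
      have "y < frame_section (a, 0, 0) v \<bullet> p" using a(2) by (simp add: frame_section_inner r_def[symmetric])
      thus ?thesis using that[of "(a, 0, 0)"] affine_minorant_nonpos[OF a(1), of f] by simp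
    qed
  qed
qed

text \<open>A countable dense set of frame coordinates suffices as the pairing is continuous in them. The zero
  section is put first so that finite maxima are nonnegative.\<close>

lemma hfun_eq_countable_SUP:
  assumes cv: "convex_ext f" and lsc: "lower_semicont f" and pos: "\<And>t. f t > 0"
  obtains q :: "nat \<Rightarrow> real \<times> real \<times> real"
    where "\<And>n. affine_minorant f (fst (q n)) (snd (snd (q n)))" "q 0 = 0"
      "\<And>v p. v \<in> circle \<Longrightarrow> p \<noteq> 0 \<Longrightarrow> hfun f v p = (SUP n. ennreal (frame_section (q n) v \<bullet> p))"
proof -
  define D where "D = {q :: real \<times> real \<times> real. affine_minorant f (fst q) (snd (snd q))}"
  obtain T where T: "countable T" "T \<subseteq> D" "D \<subseteq> closure T" using separable[of D] by blast
  have D0: "0 \<in> D" using affine_minorant_nonpos[of 0 f] by (simp add: D_def)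
  define q where "q n = (case n of 0 \<Rightarrow> 0 | Suc k \<Rightarrow> from_nat_into (insert 0 T) k)" for n
  have cT: "countable (insert 0 T)" using T(1) by simp
  have "from_nat_into (insert 0 T) k \<in> D" for k
  proof -
    have "from_nat_into (insert 0 T) k \<in> insert 0 T" by (rule from_nat_into) simp
    thus ?thesis using T(2) D0 by auto
  qed
  hence qD: "q n \<in> D" for n using D0 by (cases n) (auto simp: q_def)
  have qT: "\<exists>n. q n = x" if "x \<in> T" for x
  proof -
    obtain k where "from_nat_into (insert 0 T) k = x"
      using from_nat_into_surj[OF cT, of x] \<open>x \<in> T\<close> by blast
    thus ?thesis by (intro exI[of _ "Suc k"]) (simp add: q_def)
  qed
  show ?thesis
  proof (rule that)
    show "affine_minorant f (fst (q n)) (snd (snd (q n)))" for n using qD D_def by blast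
    show "q 0 = 0" by (simp add: q_def)
    fix v p assume v: "v \<in> circle" and p: "p \<noteq> (0 :: (real^2) \<times> real)"
    show "hfun f v p = (SUP n. ennreal (frame_section (q n) v \<bullet> p))"
    proof (rule antisym)
      show "(SUP n. ennreal (frame_section (q n) v \<bullet> p)) \<le> hfun f v p"
        by (intro SUP_least support_le_hfun[OF cv lsc pos v])
          (use qD in \<open>simp add: inner_frame_section[OF v] D_def\<close>)
      show "hfun f v p \<le> (SUP n. ennreal (frame_section (q n) v \<bullet> p))"
      proof (rule dense_le)
        fix y assume y: "y < hfun f v p"
        then obtain y' where y': "y = ennreal y'" by (cases y) auto
        obtain x where x: "x \<in> D" "y' < frame_section x v \<bullet> p"
          using hfun_attained[OF cv lsc pos v p] y unfolding y' D_def by (metis mem_Collect_eq)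
        have "open {x. y' < frame_section x v \<bullet> p}"
          unfolding frame_section_inner by (intro open_Collect_less continuous_intros)
        moreover have "x \<in> {x. y' < frame_section x v \<bullet> p}" using x(2) by simp
        ultimately have "{x. y' < frame_section x v \<bullet> p} \<inter> T \<noteq> {}"
          using x(1) T(3) open_Int_closure_eq_empty[of "{x. y' < frame_section x v \<bullet> p}" T] by blast
        then obtain x' where "x' \<in> T" "y' < frame_section x' v \<bullet> p" by blast
        then obtain n where "y' < frame_section (q n) v \<bullet> p" using qT by metis
        hence "y \<le> ennreal (frame_section (q n) v \<bullet> p)" unfolding y' by (intro ennreal_leI) simp
        thus "y \<le> (SUP n. ennreal (frame_section (q n) v \<bullet> p))" by (rule SUP_upper2[OF UNIV_I])
      qed
    qed
  qed
qed

section \<open>Steklov averages\<close>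

text \<open>The point with given coordinates, as a linear combination in order to make its continuity evident.\<close>

definition pt :: "real \<Rightarrow> real \<Rightarrow> real^2" where
  "pt a b = a *\<^sub>R axis 1 1 + b *\<^sub>R axis 2 1"

lemma pt_simps [simp]: "pt a b $ 1 = a" "pt a b $ 2 = b"
  by (simp_all add: pt_def axis_def)

lemma pt_add: "pt a b + pt c d = pt (a + c) (b + d)"
  by (simp add: pt_def scaleR_add_left)

lemma pt_coords: "pt (x $ 1) (x $ 2) = x"
  by (simp add: vec_eq_iff forall_2)

lemma continuous_on_pt [continuous_intros]:
  "continuous_on S f \<Longrightarrow> continuous_on S g \<Longrightarrow> continuous_on S (\<lambda>x. pt (f x) (g x))"
  unfolding pt_def by (intro continuous_intros)

lemma norm_pt_le: "norm (pt a b) \<le> \<bar>a\<bar> + \<bar>b\<bar>"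
  using norm_le_l1_cart[of "pt a b"] by (simp add: sum_2)

definition vedge :: "real \<Rightarrow> (real^2 \<Rightarrow> 'b::euclidean_space) \<Rightarrow> real^2 \<Rightarrow> 'b" where
  "vedge \<epsilon> G y = integral {0..\<epsilon>} (\<lambda>t. G (y + pt 0 t))"

definition hedge :: "real \<Rightarrow> (real^2 \<Rightarrow> 'b::euclidean_space) \<Rightarrow> real^2 \<Rightarrow> 'b" where
  "hedge \<epsilon> G y = integral {0..\<epsilon>} (\<lambda>s. G (y + pt s 0))"

text \<open>The average of \<open>G\<close> over the square of side \<open>\<epsilon>\<close> with lower left corner \<open>x\<close>.\<close>

definition steklov :: "real \<Rightarrow> (real^2 \<Rightarrow> 'b::euclidean_space) \<Rightarrow> real^2 \<Rightarrow> 'b" where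
  "steklov \<epsilon> G x = (1 / \<epsilon>\<^sup>2) *\<^sub>R integral {0..\<epsilon>} (\<lambda>s. vedge \<epsilon> G (x + pt s 0))"

lemma continuous_on_vedge [continuous_intros]:
  assumes G: "continuous_on UNIV G" and f: "continuous_on S f"
  shows "continuous_on S (\<lambda>x. vedge \<epsilon> G (f x))"
proof -
  have "continuous_on UNIV (vedge \<epsilon> G)"
    unfolding vedge_def[abs_def] cbox_interval[symmetric]
    by (rule integral_continuous_on_param)
      (auto simp: case_prod_beta intro!: continuous_intros continuous_on_compose2[OF G])
  thus ?thesis using f by (rule continuous_on_compose2) auto
qed

lemma continuous_on_hedge [continuous_intros]:
  assumes G: "continuous_on UNIV G" and f: "continuous_on S f"
  shows "continuous_on S (\<lambda>x. hedge \<epsilon> G (f x))"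
proof -
  have "continuous_on UNIV (hedge \<epsilon> G)"
    unfolding hedge_def[abs_def] cbox_interval[symmetric]
    by (rule integral_continuous_on_param)
      (auto simp: case_prod_beta intro!: continuous_intros continuous_on_compose2[OF G])
  thus ?thesis using f by (rule continuous_on_compose2) auto
qed

lemma steklov_swap:
  assumes G: "continuous_on UNIV G"
  shows "steklov \<epsilon> G x = (1 / \<epsilon>\<^sup>2) *\<^sub>R integral {0..\<epsilon>} (\<lambda>t. hedge \<epsilon> G (x + pt 0 t))"
proof -
  have c: "continuous_on (cbox (0, 0) (\<epsilon>, \<epsilon>)) (\<lambda>(s, t). G (x + pt s 0 + pt 0 t))"
    unfolding case_prod_beta by (intro continuous_on_compose2[OF G] continuous_intros) auto
  have e: "x + pt s 0 + pt 0 t = x + pt 0 t + pt s 0" for s t by (simp add: add.assoc pt_add)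
  show ?thesis
    unfolding steklov_def vedge_def hedge_def
    using integral_swap_continuous[OF c] by (simp add: e)
qed

text \<open>The integral is \<open>g (a + \<epsilon>) - g a\<close> for an antiderivative \<open>g\<close> of \<open>h\<close> near \<open>[a, a + \<epsilon>]\<close>.\<close>

lemma has_vector_derivative_moving_integral:
  fixes h :: "real \<Rightarrow> 'b::euclidean_space"
  assumes h: "continuous_on UNIV h" and \<epsilon>: "\<epsilon> > 0"
  shows "((\<lambda>a. integral {0..\<epsilon>} (\<lambda>s. h (a + s))) has_vector_derivative h (a + \<epsilon>) - h a) (at a)"
proof -
  let ?I = "{a - 1..a + \<epsilon> + 1}"
  obtain g where g: "\<And>x. x \<in> ?I \<Longrightarrow> (g has_vector_derivative h x) (at x within ?I)"
    using antiderivative_continuous[OF continuous_on_subset[OF h subset_UNIV], of "a - 1" "a + \<epsilon> + 1"] by metis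
  have gat: "(g has_vector_derivative h x) (at x)" if "x \<in> {a - 1<..<a + \<epsilon> + 1}" for x
    using g[of x] that at_within_interior[of x ?I] by (simp add: interior_atLeastAtMost_real)
  have shift: "((\<lambda>b. g (b + c)) has_vector_derivative h (b + c)) (at b)"
    if "b + c \<in> {a - 1<..<a + \<epsilon> + 1}" for b c
  proof -
    have "((\<lambda>b. b + c) has_vector_derivative 1) (at b)" by (auto intro!: derivative_eq_intros)
    from vector_diff_chain_at[OF this gat[OF that]] show ?thesis by (simp add: o_def)
  qed
  have eq: "g (b + \<epsilon>) - g (b + 0) = integral {0..\<epsilon>} (\<lambda>s. h (b + s))" if b: "b \<in> {a - 1<..<a + 1}" for b
  proof -
    have "((\<lambda>s. g (b + s)) has_vector_derivative h (b + s)) (at s within {0..\<epsilon>})" if "s \<in> {0..\<epsilon>}" for s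
      using shift[of s b] that b by (auto simp: add.commute intro: has_vector_derivative_at_within)
    hence "((\<lambda>s. h (b + s)) has_integral (g (b + \<epsilon>) - g (b + 0))) {0..\<epsilon>}"
      using \<epsilon> by (intro fundamental_theorem_of_calculus) auto
    thus ?thesis by (simp add: integral_unique)
  qed
  have "((\<lambda>b. g (b + \<epsilon>) - g (b + 0)) has_vector_derivative h (a + \<epsilon>) - h (a + 0)) (at a)"
    by (intro has_vector_derivative_diff shift) (use \<epsilon> in auto)
  hence "((\<lambda>a. integral {0..\<epsilon>} (\<lambda>s. h (a + s))) has_vector_derivative h (a + \<epsilon>) - h (a + 0)) (at a)"
    by (rule has_vector_derivative_transform_within_open[where S="{a - 1<..<a + 1}"]) (use eq in auto)
  thus ?thesis by simp
qed

text \<open>The partial derivatives of the average over a square are differences of integrals over opposite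
  edges.\<close>

definition steklov_deriv :: "real \<Rightarrow> (real^2 \<Rightarrow> 'b::euclidean_space) \<Rightarrow> real^2 \<Rightarrow> real^2 \<Rightarrow> 'b" where
  "steklov_deriv \<epsilon> G x k = (1 / \<epsilon>\<^sup>2) *\<^sub>R
     ((k $ 1) *\<^sub>R (vedge \<epsilon> G (x + pt \<epsilon> 0) - vedge \<epsilon> G x) +
      (k $ 2) *\<^sub>R (hedge \<epsilon> G (x + pt 0 \<epsilon>) - hedge \<epsilon> G x))"

text \<open>Moving the square horizontally differentiates the outer integral of the iterated integral, moving it
  vertically does so after exchanging the order of integration; both partial derivatives are
  continuous.\<close>

lemma steklov_has_derivative:
  fixes G :: "real^2 \<Rightarrow> 'b::euclidean_space"
  assumes G: "continuous_on UNIV G" and \<epsilon>: "\<epsilon> > 0"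
  shows "(steklov \<epsilon> G has_derivative steklov_deriv \<epsilon> G x) (at x)"
proof -
  define J where "J a b = integral {0..\<epsilon>} (\<lambda>s. vedge \<epsilon> G (pt (a + s) b))" for a b
  have J1: "J a b = integral {0..\<epsilon>} (\<lambda>t. hedge \<epsilon> G (pt a (b + t)))" for a b
  proof -
    have "(1 / \<epsilon>\<^sup>2) *\<^sub>R J a b = (1 / \<epsilon>\<^sup>2) *\<^sub>R integral {0..\<epsilon>} (\<lambda>t. hedge \<epsilon> G (pt a (b + t)))"
      using steklov_swap[OF G, of \<epsilon> "pt a b"] unfolding steklov_def J_def by (simp add: pt_add)
    thus ?thesis using \<epsilon> by simp
  qed
  have dx: "((\<lambda>a. J a b) has_derivative (\<lambda>k. k *\<^sub>R (vedge \<epsilon> G (pt (a + \<epsilon>) b) - vedge \<epsilon> G (pt a b)))) (at a within UNIV)" for a b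
  proof -
    have c: "continuous_on UNIV (\<lambda>a. vedge \<epsilon> G (pt a b))" by (intro continuous_intros G)
    show ?thesis unfolding J_def has_vector_derivative_def[symmetric]
      using has_vector_derivative_moving_integral[OF c \<epsilon>, of a] by simp
  qed
  have dy: "((\<lambda>b. J a b) has_derivative
      blinfun_apply (blinfun_scaleR_left (hedge \<epsilon> G (pt a (b + \<epsilon>)) - hedge \<epsilon> G (pt a b)))) (at b within UNIV)" for a b
  proof -
    have c: "continuous_on UNIV (\<lambda>b. hedge \<epsilon> G (pt a b))" by (intro continuous_intros G)
    show ?thesis unfolding J1 blinfun_scaleR_left.rep_eq has_vector_derivative_def[symmetric]
      using has_vector_derivative_moving_integral[OF c \<epsilon>, of b] by simp
  qed
  have c: "continuous_on UNIV (\<lambda>z. blinfun_scaleR_left (hedge \<epsilon> G (pt (fst z) (snd z + \<epsilon>)) - hedge \<epsilon> G (pt (fst z) (snd z))))"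
    by (intro bounded_linear.continuous_on[OF bounded_linear_blinfun_scaleR_left] continuous_intros G)
  have "((\<lambda>(a, b). J a b) has_derivative
      (\<lambda>(tx, ty). tx *\<^sub>R (vedge \<epsilon> G (pt (x $ 1 + \<epsilon>) (x $ 2)) - vedge \<epsilon> G (pt (x $ 1) (x $ 2)))
        + blinfun_apply (blinfun_scaleR_left (hedge \<epsilon> G (pt (x $ 1) (x $ 2 + \<epsilon>)) - hedge \<epsilon> G (pt (x $ 1) (x $ 2)))) ty))
      (at (x $ 1, x $ 2) within UNIV \<times> UNIV)"
  proof (rule has_derivative_partialsI[OF dx dy])
    show "continuous (at (x $ 1, x $ 2) within UNIV \<times> UNIV)
        (\<lambda>(a, b). blinfun_scaleR_left (hedge \<epsilon> G (pt a (b + \<epsilon>)) - hedge \<epsilon> G (pt a b)))"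
      using c unfolding case_prod_beta UNIV_Times_UNIV by (simp add: continuous_on_eq_continuous_at)
  qed auto
  hence 1: "((\<lambda>(a, b). J a b) has_derivative
      (\<lambda>(tx, ty). tx *\<^sub>R (vedge \<epsilon> G (x + pt \<epsilon> 0) - vedge \<epsilon> G x) + ty *\<^sub>R (hedge \<epsilon> G (x + pt 0 \<epsilon>) - hedge \<epsilon> G x)))
      (at (x $ 1, x $ 2))"
    using pt_add[of "x $ 1" "x $ 2"] by (simp add: pt_coords)
  have 2: "((\<lambda>x::real^2. (x $ 1, x $ 2)) has_derivative (\<lambda>k. (k $ 1, k $ 2))) (at x)"
    by (intro has_derivative_Pair bounded_linear_imp_has_derivative bounded_linear_vec_nth)
  have 3: "((\<lambda>x. (case (x $ 1, x $ 2) of (a, b) \<Rightarrow> J a b)) has_derivative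
      (\<lambda>k. (k $ 1) *\<^sub>R (vedge \<epsilon> G (x + pt \<epsilon> 0) - vedge \<epsilon> G x) + (k $ 2) *\<^sub>R (hedge \<epsilon> G (x + pt 0 \<epsilon>) - hedge \<epsilon> G x))) (at x)"
    using has_derivative_compose[OF 2 1] by simp
  have s: "steklov \<epsilon> G = (\<lambda>x. (1 / \<epsilon>\<^sup>2) *\<^sub>R (case (x $ 1, x $ 2) of (a, b) \<Rightarrow> J a b))"
  proof (rule ext)
    fix x
    have "x + pt s 0 = pt (x $ 1 + s) (x $ 2)" for s using pt_add[of "x $ 1" "x $ 2" s 0] by (simp add: pt_coords)
    thus "steklov \<epsilon> G x = (1 / \<epsilon>\<^sup>2) *\<^sub>R (case (x $ 1, x $ 2) of (a, b) \<Rightarrow> J a b)"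
      unfolding steklov_def J_def by simp
  qed
  show ?thesis
    unfolding s steklov_deriv_def by (rule has_derivative_scaleR_right[OF 3])
qed

lemma frechet_derivative_steklov:
  fixes G :: "real^2 \<Rightarrow> 'b::euclidean_space"
  assumes "continuous_on UNIV G" "\<epsilon> > 0"
  shows "frechet_derivative (steklov \<epsilon> G) (at x) = steklov_deriv \<epsilon> G x"
  by (rule frechet_derivative_at[symmetric]) (rule steklov_has_derivative[OF assms])

lemma C1_steklov:
  fixes G :: "real^2 \<Rightarrow> 'b::euclidean_space"
  assumes G: "continuous_on UNIV G" and \<epsilon>: "\<epsilon> > 0"
  shows "C1 U (steklov \<epsilon> G)"
  unfolding C1_def frechet_derivative_steklov[OF assms]
proof (intro conjI ballI allI)
  fix x show "steklov \<epsilon> G differentiable at x"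
    using steklov_has_derivative[OF assms] unfolding differentiable_def by blast
next
  fix k show "continuous_on U (\<lambda>x. steklov_deriv \<epsilon> G x k)"
    unfolding steklov_deriv_def by (intro continuous_intros G)
qed

lemma steklov_close:
  fixes G :: "real^2 \<Rightarrow> 'b::euclidean_space"
  assumes G: "continuous_on UNIV G" and \<epsilon>: "\<epsilon> > 0"
    and close: "\<And>s t. s \<in> {0..\<epsilon>} \<Longrightarrow> t \<in> {0..\<epsilon>} \<Longrightarrow> norm (G (x + pt s t) - c) \<le> \<eta>"
  shows "norm (steklov \<epsilon> G x - c) \<le> \<eta>"
proof -
  have avg: "norm (integral {0..\<epsilon>} f - \<epsilon> *\<^sub>R d) \<le> B * \<epsilon>"
    if f: "continuous_on UNIV f" and B: "\<And>t. t \<in> {0..\<epsilon>} \<Longrightarrow> norm (f t - d) \<le> B" for f and d :: 'b and B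
  proof -
    have "f integrable_on {0..\<epsilon>}" by (intro integrable_continuous_real continuous_on_subset[OF f]) auto
    hence "integral {0..\<epsilon>} (\<lambda>t. f t - d) = integral {0..\<epsilon>} f - integral {0..\<epsilon>} (\<lambda>t. d)"
      by (rule Henstock_Kurzweil_Integration.integral_diff) (rule integrable_const_ivl)
    moreover have "integral {0..\<epsilon>} (\<lambda>t. d) = \<epsilon> *\<^sub>R d" using \<epsilon> by simp
    moreover have "norm (integral {0..\<epsilon>} (\<lambda>t. f t - d)) \<le> B * (\<epsilon> - 0)"
      by (rule integral_bound) (use \<epsilon> B in \<open>auto intro!: continuous_intros continuous_on_subset[OF f]\<close>)
    ultimately show ?thesis using \<epsilon> by simp
  qed
  have 1: "norm (vedge \<epsilon> G (x + pt s 0) - \<epsilon> *\<^sub>R c) \<le> \<eta> * \<epsilon>" if s: "s \<in> {0..\<epsilon>}" for s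
    unfolding vedge_def
  proof (rule avg)
    show "continuous_on UNIV (\<lambda>t. G (x + pt s 0 + pt 0 t))"
      by (intro continuous_on_compose2[OF G] continuous_intros) auto
    show "norm (G (x + pt s 0 + pt 0 t) - c) \<le> \<eta>" if "t \<in> {0..\<epsilon>}" for t
      using close[OF s that] by (simp add: add.assoc pt_add)
  qed
  have "norm (integral {0..\<epsilon>} (\<lambda>s. vedge \<epsilon> G (x + pt s 0)) - \<epsilon> *\<^sub>R (\<epsilon> *\<^sub>R c)) \<le> (\<eta> * \<epsilon>) * \<epsilon>"
    by (rule avg[OF _ 1]) (intro continuous_intros G)
  hence "norm ((1 / \<epsilon>\<^sup>2) *\<^sub>R (integral {0..\<epsilon>} (\<lambda>s. vedge \<epsilon> G (x + pt s 0)) - \<epsilon> *\<^sub>R (\<epsilon> *\<^sub>R c))) \<le> (1 / \<epsilon>\<^sup>2) * ((\<eta> * \<epsilon>) * \<epsilon>)"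
    by (simp add: divide_right_mono)
  moreover have "(1 / \<epsilon>\<^sup>2) * ((\<eta> * \<epsilon>) * \<epsilon>) = \<eta>" using \<epsilon> by (simp add: power2_eq_square)
  moreover have "(1 / \<epsilon>\<^sup>2) *\<^sub>R (integral {0..\<epsilon>} (\<lambda>s. vedge \<epsilon> G (x + pt s 0)) - \<epsilon> *\<^sub>R (\<epsilon> *\<^sub>R c)) = steklov \<epsilon> G x - c"
    unfolding steklov_def scaleR_diff_right using \<epsilon> by (simp add: power2_eq_square)
  ultimately show ?thesis by metis
qed

definition zero_ext :: "'a set \<Rightarrow> ('a \<Rightarrow> 'b::zero) \<Rightarrow> 'a \<Rightarrow> 'b" where
  "zero_ext U g x = (if x \<in> U then g x else 0)"

lemma continuous_on_zero_ext:
  fixes g :: "'a::metric_space \<Rightarrow> 'b::real_normed_vector"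
  assumes "open U" "C0c U g"
  shows "continuous_on UNIV (zero_ext U g)"
proof -
  obtain K where K: "compact K" "K \<subseteq> U" "\<And>z. z \<in> U \<Longrightarrow> z \<notin> K \<Longrightarrow> g z = 0"
    using assms(2) compact_supportE unfolding C0c_def by metis
  have "continuous_on (U \<union> - K) (zero_ext U g)"
  proof (rule continuous_on_open_Un)
    show "continuous_on U (zero_ext U g)"
      by (rule continuous_on_eq[of U g]) (use assms(2) in \<open>auto simp: C0c_def zero_ext_def\<close>)
    have "continuous_on (- K) (\<lambda>x. 0 :: 'b)" by (rule continuous_on_const)
    thus "continuous_on (- K) (zero_ext U g)"
      by (rule continuous_on_eq) (use K in \<open>auto simp: zero_ext_def\<close>)
    show "open (- K)" using compact_imp_closed[OF K(1)] by (rule open_Compl)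
  qed (rule assms(1))
  moreover have "U \<union> - K = UNIV" using K by auto
  ultimately show ?thesis by simp
qed

text \<open>The single approximation result on which the density of smooth fields and the curl-free property
  both rest. The clause on distances keeps every square of side at most \<open>\<epsilon>\<^sub>0\<close> that meets the support inside
  \<open>U\<close>.\<close>

lemma C0c_steklov_approx:
  fixes g :: "real^2 \<Rightarrow> 'b::euclidean_space"
  assumes U: "open U" "U \<noteq> {}" and g: "C0c U g" and \<eta>: "\<eta> > 0"
  obtains K \<delta> \<epsilon>\<^sub>0 where "compact K" "K \<subseteq> U" "\<And>x. x \<notin> K \<Longrightarrow> zero_ext U g x = 0"
    "\<epsilon>\<^sub>0 > 0" "\<And>y z. y \<in> K \<Longrightarrow> dist y z \<le> 2 * \<epsilon>\<^sub>0 \<Longrightarrow> z \<in> U"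
    "\<And>\<epsilon>. 0 < \<epsilon> \<Longrightarrow> \<epsilon> \<le> \<epsilon>\<^sub>0 \<Longrightarrow> C1c U (steklov \<epsilon> (zero_ext U g))"
    "\<And>\<epsilon> x. 0 < \<epsilon> \<Longrightarrow> \<epsilon> \<le> \<epsilon>\<^sub>0 \<Longrightarrow> norm (steklov \<epsilon> (zero_ext U g) x - zero_ext U g x) \<le> \<eta>"
proof -
  let ?G = "zero_ext U g"
  have G: "continuous_on UNIV ?G" by (rule continuous_on_zero_ext[OF U(1) g])
  obtain K0 where K0: "compact K0" "K0 \<subseteq> U" "\<And>z. z \<in> U \<Longrightarrow> z \<notin> K0 \<Longrightarrow> g z = 0"
    using g compact_supportE unfolding C0c_def by metis
  obtain x0 where x0: "x0 \<in> U" using U(2) by blast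
  \<comment> \<open>a nonempty set is required for the distance function\<close>
  define K where "K = insert x0 K0"
  have K: "compact K" "K \<subseteq> U" "K \<noteq> {}" "\<And>x. x \<notin> K \<Longrightarrow> ?G x = 0"
    using K0 x0 by (auto simp: K_def zero_ext_def)
  obtain \<delta> where \<delta>: "\<delta> > 0" "{x. infdist x K \<le> \<delta>} \<subseteq> U"
    using compact_in_open_separated[OF K(3,1) U(1) K(2)] by metis
  have cK: "compact {x. infdist x K \<le> \<delta>}" by (rule compact_infdist_le[OF K(3,1) \<delta>(1)])
  have near: "infdist z K \<le> dist y z" if "y \<in> K" for y z
    using infdist_le[OF that, of z] by (simp add: dist_commute)
  have "uniformly_continuous_on {x. infdist x K \<le> \<delta>} ?G"
    by (rule compact_uniformly_continuous[OF continuous_on_subset[OF G subset_UNIV] cK])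
  then obtain d where d: "d > 0" "\<And>x y. infdist x K \<le> \<delta> \<Longrightarrow> infdist y K \<le> \<delta> \<Longrightarrow> dist y x < d \<Longrightarrow> dist (?G y) (?G x) < \<eta>"
    unfolding uniformly_continuous_on_def using \<eta> by (metis mem_Collect_eq)
  have unif: "norm (?G y - ?G x) \<le> \<eta>" if yx: "dist y x < d" "dist y x \<le> \<delta>" for x y
  proof (cases "x \<in> K \<or> y \<in> K")
    case True
    hence "infdist x K \<le> \<delta>" "infdist y K \<le> \<delta>"
      using near[of x y] near[of y x] yx \<delta>(1) infdist_zero[of x K] infdist_zero[of y K]
      by (auto simp: dist_commute)
    thus ?thesis using d(2) yx by (force simp: dist_norm)
  next
    case False
    thus ?thesis using K(4) \<eta> by simp
  qed
  \<comment> \<open>a square of side at most \<open>\<epsilon>\<^sub>0\<close> has diameter at most \<open>2 * \<epsilon>\<^sub>0\<close>\<close>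
  define \<epsilon>\<^sub>0 where "\<epsilon>\<^sub>0 = min \<delta> d / 4"
  have e0: "\<epsilon>\<^sub>0 > 0" "2 * \<epsilon>\<^sub>0 < d" "2 * \<epsilon>\<^sub>0 \<le> \<delta>" using \<delta>(1) d(1) by (auto simp: \<epsilon>\<^sub>0_def)
  have dpt: "dist (x + pt s t) x \<le> 2 * \<epsilon>\<^sub>0" if "\<epsilon> \<le> \<epsilon>\<^sub>0" "s \<in> {0..\<epsilon>}" "t \<in> {0..\<epsilon>}" for x s t \<epsilon>
    using norm_pt_le[of s t] that by (simp add: dist_norm)
  show ?thesis
  proof (rule that[OF K(1,2,4) e0(1)])
    fix y z assume "y \<in> K" "dist y z \<le> 2 * \<epsilon>\<^sub>0"
    hence "infdist z K \<le> \<delta>" using near e0(3) by (meson order_trans)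
    thus "z \<in> U" using \<delta>(2) by auto
  next
    fix \<epsilon> x assume \<epsilon>: "0 < \<epsilon>" "\<epsilon> \<le> \<epsilon>\<^sub>0"
    show "norm (steklov \<epsilon> ?G x - ?G x) \<le> \<eta>"
    proof (rule steklov_close[OF G \<epsilon>(1)])
      fix s t assume "s \<in> {0..\<epsilon>}" "t \<in> {0..\<epsilon>}"
      hence "dist (x + pt s t) x \<le> 2 * \<epsilon>\<^sub>0" by (rule dpt[OF \<epsilon>(2)])
      thus "norm (?G (x + pt s t) - ?G x) \<le> \<eta>" using e0 by (intro unif) auto
    qed
  next
    fix \<epsilon> assume \<epsilon>: "0 < \<epsilon>" "\<epsilon> \<le> \<epsilon>\<^sub>0"
    have "compact_support U (steklov \<epsilon> ?G)"
    proof (rule compact_supportI[OF cK \<delta>(2)])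
      fix x assume x: "x \<notin> {x. infdist x K \<le> \<delta>}"
      have "norm (steklov \<epsilon> ?G x - 0) \<le> 0"
      proof (rule steklov_close[OF G \<epsilon>(1)])
        fix s t assume "s \<in> {0..\<epsilon>}" "t \<in> {0..\<epsilon>}"
        hence "dist (x + pt s t) x \<le> \<delta>" using dpt[OF \<epsilon>(2)] e0(3) order_trans by blast
        hence "x + pt s t \<notin> K" using x near[of "x + pt s t" x] by auto
        thus "norm (?G (x + pt s t) - 0) \<le> 0" using K(4) by simp
      qed
      thus "steklov \<epsilon> ?G x = 0" by simp
    qed
    thus "C1c U (steklov \<epsilon> ?G)" unfolding C1c_def using C1_steklov[OF G \<epsilon>(1)] by blast
  qed
qed

lemma gradient_inner:
  assumes "g differentiable at x"
  shows "gradient g x \<bullet> k = frechet_derivative g (at x) k"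
proof -
  interpret linear "frechet_derivative g (at x)" by (rule linear_frechet_derivative[OF assms])
  have "frechet_derivative g (at x) k = frechet_derivative g (at x) (\<Sum>b\<in>Basis. (k \<bullet> b) *\<^sub>R b)"
    by (simp only: euclidean_representation)
  also have "\<dots> = (\<Sum>b\<in>Basis. (k \<bullet> b) * frechet_derivative g (at x) b)" by (simp add: sum scale)
  also have "\<dots> = gradient g x \<bullet> k"
    unfolding gradient_def inner_sum_left by (simp add: inner_commute mult.commute)
  finally show ?thesis by simp
qed

lemma integral_gradient_segment:
  fixes g :: "real^2 \<Rightarrow> real"
  assumes "\<epsilon> \<ge> 0" and "\<And>t. t \<in> {0..\<epsilon>} \<Longrightarrow> g differentiable at (y + t *\<^sub>R e)"
  shows "((\<lambda>t. gradient g (y + t *\<^sub>R e) \<bullet> e) has_integral (g (y + \<epsilon> *\<^sub>R e) - g (y + 0 *\<^sub>R e))) {0..\<epsilon>}"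
proof (rule fundamental_theorem_of_calculus[OF assms(1)])
  fix t assume t: "t \<in> {0..\<epsilon>}"
  have 1: "(g has_derivative frechet_derivative g (at (y + t *\<^sub>R e))) (at (y + t *\<^sub>R e))"
    using assms(2)[OF t] frechet_derivative_works by blast
  have 2: "((\<lambda>t. y + t *\<^sub>R e) has_derivative (\<lambda>h. h *\<^sub>R e)) (at t within {0..\<epsilon>})"
    by (auto intro!: derivative_eq_intros)
  have "((\<lambda>t. g (y + t *\<^sub>R e)) has_derivative (\<lambda>h. frechet_derivative g (at (y + t *\<^sub>R e)) (h *\<^sub>R e))) (at t within {0..\<epsilon>})"
    by (rule has_derivative_compose[OF 2 1])
  moreover have "frechet_derivative g (at (y + t *\<^sub>R e)) (h *\<^sub>R e) = h *\<^sub>R (gradient g (y + t *\<^sub>R e) \<bullet> e)" for h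
    using gradient_inner[OF assms(2)[OF t], of "h *\<^sub>R e"] by (simp add: inner_scaleR_right)
  ultimately show "((\<lambda>t. g (y + t *\<^sub>R e)) has_vector_derivative gradient g (y + t *\<^sub>R e) \<bullet> e) (at t within {0..\<epsilon>})"
    unfolding has_vector_derivative_def by simp
qed

text \<open>If the square meets the support it lies in \<open>U\<close>, and the edge integrals of the gradient are
  differences of \<open>g\<close> at the corners: both sides equal the same alternating sum over the four corners.
  Otherwise all edge integrals vanish. No second derivative of \<open>g\<close> is involved.\<close>

lemma steklov_gradient_curl_free:
  fixes g :: "real^2 \<Rightarrow> real"
  assumes U: "open U" and g: "C1 U g" and gc: "C0c U (gradient g)" and \<epsilon>: "\<epsilon> > 0"
    and K: "\<And>x. x \<notin> K \<Longrightarrow> zero_ext U (gradient g) x = 0"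
    and near: "\<And>y z. y \<in> K \<Longrightarrow> dist y z \<le> 2 * \<epsilon> \<Longrightarrow> z \<in> U"
  shows "steklov_deriv \<epsilon> (zero_ext U (gradient g)) x (axis 1 1) $ 2 =
    steklov_deriv \<epsilon> (zero_ext U (gradient g)) x (axis 2 1) $ 1"
proof -
  let ?G = "zero_ext U (gradient g)"
  have G: "continuous_on UNIV ?G" by (rule continuous_on_zero_ext[OF U gc])
  have int: "(\<lambda>t. ?G (y + pt 0 t)) integrable_on {0..\<epsilon>}" "(\<lambda>t. ?G (y + pt t 0)) integrable_on {0..\<epsilon>}" for y
    by (intro integrable_continuous_real continuous_on_compose2[OF G] continuous_intros; auto)+
  have v: "vedge \<epsilon> ?G y $ 2 = integral {0..\<epsilon>} (\<lambda>t. ?G (y + pt 0 t) $ 2)" for y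
    unfolding vedge_def by (rule integral_linear[OF int(1) bounded_linear_vec_nth, unfolded o_def, symmetric])
  have h: "hedge \<epsilon> ?G y $ 1 = integral {0..\<epsilon>} (\<lambda>t. ?G (y + pt t 0) $ 1)" for y
    unfolding hedge_def by (rule integral_linear[OF int(2) bounded_linear_vec_nth, unfolded o_def, symmetric])
  have "(vedge \<epsilon> ?G (x + pt \<epsilon> 0) - vedge \<epsilon> ?G x) $ 2 = (hedge \<epsilon> ?G (x + pt 0 \<epsilon>) - hedge \<epsilon> ?G x) $ 1"
  proof (cases "\<exists>s\<in>{0..\<epsilon>}. \<exists>t\<in>{0..\<epsilon>}. x + pt s t \<in> K")
    case True
    then obtain s t where st: "s \<in> {0..\<epsilon>}" "t \<in> {0..\<epsilon>}" "x + pt s t \<in> K" by blast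
    have inU: "x + pt a b \<in> U" if ab: "a \<in> {0..\<epsilon>}" "b \<in> {0..\<epsilon>}" for a b
    proof (rule near[OF st(3)])
      have "(x + pt s t) - (x + pt a b) = pt (s - a) (t - b)" by (simp add: pt_def scaleR_diff_left)
      hence "dist (x + pt s t) (x + pt a b) \<le> \<bar>s - a\<bar> + \<bar>t - b\<bar>" unfolding dist_norm using norm_pt_le by metis
      thus "dist (x + pt s t) (x + pt a b) \<le> 2 * \<epsilon>" using st ab by auto
    qed
    have diff: "g differentiable at (x + pt a b)" if "a \<in> {0..\<epsilon>}" "b \<in> {0..\<epsilon>}" for a b
      using g inU[OF that] unfolding C1_def by blast
    have vert: "vedge \<epsilon> ?G (x + pt a 0) $ 2 = g (x + pt a \<epsilon>) - g (x + pt a 0)" if a: "a \<in> {0..\<epsilon>}" for a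
    proof -
      have p: "x + pt a 0 + t *\<^sub>R axis 2 1 = x + pt a t" for t by (simp add: pt_def)
      have "((\<lambda>t. gradient g (x + pt a t) \<bullet> axis 2 1) has_integral (g (x + pt a \<epsilon>) - g (x + pt a 0))) {0..\<epsilon>}"
        using integral_gradient_segment[of \<epsilon> g "x + pt a 0" "axis 2 1"] \<epsilon> diff[OF a] unfolding p by simp
      hence "((\<lambda>t. ?G (x + pt a 0 + pt 0 t) $ 2) has_integral (g (x + pt a \<epsilon>) - g (x + pt a 0))) {0..\<epsilon>}"
        by (rule has_integral_eq[rotated]) (use inU[OF a] in \<open>auto simp: zero_ext_def inner_axis add.assoc pt_add\<close>)
      thus ?thesis unfolding v by (rule integral_unique)
    qed
    have hori: "hedge \<epsilon> ?G (x + pt 0 b) $ 1 = g (x + pt \<epsilon> b) - g (x + pt 0 b)" if b: "b \<in> {0..\<epsilon>}" for b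
    proof -
      have p: "x + pt 0 b + t *\<^sub>R axis 1 1 = x + pt t b" for t by (simp add: pt_def)
      have "((\<lambda>t. gradient g (x + pt t b) \<bullet> axis 1 1) has_integral (g (x + pt \<epsilon> b) - g (x + pt 0 b))) {0..\<epsilon>}"
        using integral_gradient_segment[of \<epsilon> g "x + pt 0 b" "axis 1 1"] \<epsilon> diff[OF _ b] unfolding p by simp
      hence "((\<lambda>t. ?G (x + pt 0 b + pt t 0) $ 1) has_integral (g (x + pt \<epsilon> b) - g (x + pt 0 b))) {0..\<epsilon>}"
        by (rule has_integral_eq[rotated]) (use inU[OF _ b] in \<open>auto simp: zero_ext_def inner_axis add.assoc pt_add\<close>)
      thus ?thesis unfolding h by (rule integral_unique)
    qed
    have "x + pt 0 0 = x" by (simp add: pt_def)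
    thus ?thesis using vert[of \<epsilon>] vert[of 0] hori[of \<epsilon>] hori[of 0] \<epsilon> by simp
  next
    case False
    hence z: "?G (x + pt s t) = 0" if "s \<in> {0..\<epsilon>}" "t \<in> {0..\<epsilon>}" for s t using K that by blast
    have "vedge \<epsilon> ?G (x + pt a 0) = 0" if a: "a \<in> {0..\<epsilon>}" for a
      unfolding vedge_def by (rule integral_unique[OF has_integral_is_0]) (use z[OF a] in \<open>simp add: add.assoc pt_add\<close>)
    moreover have "hedge \<epsilon> ?G (x + pt 0 b) = 0" if b: "b \<in> {0..\<epsilon>}" for b
      unfolding hedge_def by (rule integral_unique[OF has_integral_is_0]) (use z[OF _ b] in \<open>simp add: add.assoc pt_add\<close>)
    ultimately have "vedge \<epsilon> ?G (x + pt \<epsilon> 0) = 0" "vedge \<epsilon> ?G (x + pt 0 0) = 0"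
      "hedge \<epsilon> ?G (x + pt 0 \<epsilon>) = 0" "hedge \<epsilon> ?G (x + pt 0 0) = 0" using \<epsilon> by auto
    thus ?thesis by (simp add: pt_def)
  qed
  thus ?thesis unfolding steklov_deriv_def by (simp add: axis_def)
qed

section \<open>The marginal constraint against continuous fields\<close>

lemma space_borel_on [simp]: "space (borel_on U) = U"
  by (simp add: space_restrict_space)

lemma C0c_bounded_measurable:
  fixes \<psi> :: "'a::metric_space \<Rightarrow> 'b::euclidean_space"
  assumes "C0c U \<psi>"
  shows "bounded_measurable (borel_on U) \<psi>"
proof -
  obtain B where B: "\<And>z. z \<in> U \<Longrightarrow> norm (\<psi> z) \<le> B" using C0c_bounded[OF assms] by metis
  have "\<psi> \<in> borel_measurable (borel_on U)"
    using assms unfolding C0c_def by (intro borel_measurable_continuous_on_restrict) blast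
  thus ?thesis by (rule bounded_measurableI[where B=B]) (simp add: B)
qed

text \<open>Vanishing passes to uniform limits because the total variation is finite.\<close>

lemma vector_integral_eq_0_approx:
  fixes \<psi> :: "'a \<Rightarrow> 'b::euclidean_space"
  assumes v: "vector_measure M \<sigma>" and \<psi>: "bounded_measurable M \<psi>"
    and approx: "\<And>\<eta>. \<eta> > 0 \<Longrightarrow> \<exists>\<phi>. bounded_measurable M \<phi> \<and> vector_integral M \<sigma> \<phi> = 0 \<and> (\<forall>z\<in>space M. norm (\<phi> z - \<psi> z) \<le> \<eta>)"
  shows "vector_integral M \<sigma> \<psi> = 0"
proof -
  define C where "C = (\<integral>z. norm (polar_density M \<sigma> z) \<partial>total_variation M \<sigma>)"
  have C0: "C \<ge> 0" unfolding C_def by (intro integral_nonneg_AE AE_I2) simp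
  have "\<bar>vector_integral M \<sigma> \<psi>\<bar> \<le> 0 + e" if e: "e > 0" for e
  proof -
    define \<eta> where "\<eta> = e / (C + 1)"
    have \<eta>: "\<eta> > 0" "\<eta> * C \<le> e" using C0 e by (auto simp: \<eta>_def field_simps)
    obtain \<phi> where \<phi>: "bounded_measurable M \<phi>" "vector_integral M \<sigma> \<phi> = 0"
      "\<And>z. z \<in> space M \<Longrightarrow> norm (\<phi> z - \<psi> z) \<le> \<eta>" using approx[OF \<eta>(1)] by blast
    have [measurable]: "\<phi> \<in> borel_measurable M" "\<psi> \<in> borel_measurable M"
      using \<phi>(1) \<psi> unfolding bounded_measurable_def by auto
    have d: "bounded_measurable M (\<lambda>z. \<phi> z - \<psi> z)"
      by (rule bounded_measurableI[where B=\<eta>]) (use \<phi>(3) in auto)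
    have "vector_integral M \<sigma> (\<lambda>z. \<psi> z + (\<phi> z - \<psi> z)) = vector_integral M \<sigma> \<psi> + vector_integral M \<sigma> (\<lambda>z. \<phi> z - \<psi> z)"
      by (rule vector_integral_add[OF v \<psi> d])
    hence "vector_integral M \<sigma> \<psi> = - vector_integral M \<sigma> (\<lambda>z. \<phi> z - \<psi> z)" using \<phi>(2) by simp
    moreover have "\<bar>vector_integral M \<sigma> (\<lambda>z. \<phi> z - \<psi> z)\<bar> \<le> \<eta> * C"
      unfolding C_def by (rule vector_integral_bound[OF v]) (use \<phi>(3) in auto)
    ultimately show ?thesis using \<eta>(2) by simp
  qed
  hence "\<bar>vector_integral M \<sigma> \<psi>\<bar> \<le> 0" by (rule field_le_epsilon)
  thus ?thesis by simp
qed

lemma bounded_linear_perp: "bounded_linear perp"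
proof (rule linear_conv_bounded_linear[THEN iffD1], rule linearI)
  show "perp (x + y) = perp x + perp y" for x y by (simp add: vec_eq_iff forall_2)
  show "perp (c *\<^sub>R x) = c *\<^sub>R perp x" for c x by (simp add: vec_eq_iff forall_2)
qed

lemma perp_adjoint: "perp x \<bullet> y = x \<bullet> - perp y"
  by (simp add: inner_vec_def sum_2)

lemma perp_perp: "perp (- perp x) = x"
  by (simp add: vec_eq_iff forall_2)

lemma C1_linear_image:
  assumes T: "bounded_linear T" and f: "C1 U f"
  shows "C1 U (\<lambda>x. T (f x))" "\<And>x. x \<in> U \<Longrightarrow> frechet_derivative (\<lambda>x. T (f x)) (at x) = (\<lambda>k. T (frechet_derivative f (at x) k))"
proof -
  have d: "((\<lambda>x. T (f x)) has_derivative (\<lambda>k. T (frechet_derivative f (at x) k))) (at x)" if "x \<in> U" for x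
    using f that frechet_derivative_works unfolding C1_def
    by (intro bounded_linear.has_derivative[OF T]) blast
  show e: "frechet_derivative (\<lambda>x. T (f x)) (at x) = (\<lambda>k. T (frechet_derivative f (at x) k))" if "x \<in> U" for x
    by (rule frechet_derivative_at[symmetric]) (rule d[OF that])
  show "C1 U (\<lambda>x. T (f x))"
    unfolding C1_def
  proof (intro conjI ballI allI)
    show "(\<lambda>x. T (f x)) differentiable at x" if "x \<in> U" for x using d[OF that] unfolding differentiable_def by blast
    fix k
    have "continuous_on U (\<lambda>x. T (frechet_derivative f (at x) k))"
      using f unfolding C1_def by (intro bounded_linear.continuous_on[OF T]) blast
    thus "continuous_on U (\<lambda>x. frechet_derivative (\<lambda>x. T (f x)) (at x) k)"
      by (rule continuous_on_eq) (simp add: e)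
  qed
qed

lemma C1c_linear_image:
  assumes T: "bounded_linear T" and f: "C1c U f"
  shows "C1c U (\<lambda>x. T (f x))"
  using C1_linear_image(1)[OF T, of U f] f compact_support_mono[of U f "\<lambda>x. T (f x)"] linear_simps(3)[OF T]
  unfolding C1c_def by auto

lemma C1_add:
  assumes f: "C1 U f" and g: "C1 U g"
  shows "C1 U (\<lambda>x. f x + g x)" "\<And>x. x \<in> U \<Longrightarrow> frechet_derivative (\<lambda>x. f x + g x) (at x) = (\<lambda>k. frechet_derivative f (at x) k + frechet_derivative g (at x) k)"
proof -
  have d: "((\<lambda>x. f x + g x) has_derivative (\<lambda>k. frechet_derivative f (at x) k + frechet_derivative g (at x) k)) (at x)" if "x \<in> U" for x
    using f g that frechet_derivative_works unfolding C1_def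
    by (intro has_derivative_add) blast+
  show e: "frechet_derivative (\<lambda>x. f x + g x) (at x) = (\<lambda>k. frechet_derivative f (at x) k + frechet_derivative g (at x) k)" if "x \<in> U" for x
    by (rule frechet_derivative_at[symmetric]) (rule d[OF that])
  show "C1 U (\<lambda>x. f x + g x)"
    unfolding C1_def
  proof (intro conjI ballI allI)
    show "(\<lambda>x. f x + g x) differentiable at x" if "x \<in> U" for x using d[OF that] unfolding differentiable_def by blast
    fix k
    have "continuous_on U (\<lambda>x. frechet_derivative f (at x) k + frechet_derivative g (at x) k)"
      using f g unfolding C1_def by (intro continuous_on_add) blast+
    thus "continuous_on U (\<lambda>x. frechet_derivative (\<lambda>x. f x + g x) (at x) k)"
      by (rule continuous_on_eq) (simp add: e)
  qed
qed

lemma C1_differentiable: "C1 U f \<Longrightarrow> x \<in> U \<Longrightarrow> f differentiable at x"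
  unfolding C1_def by blast

lemma C1_continuous_on: "C1 U f \<Longrightarrow> continuous_on U f"
  by (meson C1_differentiable differentiable_imp_continuous_on differentiable_on_def differentiable_at_withinI)

lemma gradient_add:
  assumes "C1 U f" "C1 U g" "x \<in> U"
  shows "gradient (\<lambda>x. f x + g x) x = gradient f x + gradient g x"
  unfolding gradient_def C1_add(2)[OF assms] by (simp add: scaleR_add_left sum.distrib)

lemma gradient_scale:
  assumes "C1 U f" "x \<in> U"
  shows "gradient (\<lambda>x. c * f x) x = c *\<^sub>R gradient f x"
  unfolding gradient_def C1_linear_image(2)[OF bounded_linear_mult_right assms]
  by (simp add: scaleR_sum_right)

lemma continuous_on_gradient: "C1 U g \<Longrightarrow> continuous_on U (gradient g)"
  unfolding gradient_def[abs_def] C1_def by (intro continuous_on_sum continuous_on_scaleR continuous_on_const) blast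

lemma BV_deriv_is_distr_deriv: "u \<in> BV \<Omega> \<Longrightarrow> is_distr_deriv \<Omega> u (BV_deriv \<Omega> u)"
  unfolding BV_deriv_def BV_def by (auto intro: someI[of "is_distr_deriv \<Omega> u"])

lemma vector_measure_BV_deriv: "u \<in> BV \<Omega> \<Longrightarrow> vector_measure (borel_on \<Omega>) (BV_deriv \<Omega> u)"
  using BV_deriv_is_distr_deriv unfolding is_distr_deriv_def by blast

lemma vector_measure_BV_deriv_perp: "u \<in> BV \<Omega> \<Longrightarrow> vector_measure (borel_on \<Omega>) (BV_deriv_perp \<Omega> u)"
  unfolding BV_deriv_perp_def[abs_def]
  by (rule vector_measure_linear_image[OF vector_measure_BV_deriv bounded_linear_perp])

lemma vector_integral_BV_deriv_perp:
  assumes "u \<in> BV \<Omega>" "bounded_measurable (borel_on \<Omega>) \<psi>"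
  shows "vector_integral (borel_on \<Omega>) (BV_deriv_perp \<Omega> u) \<psi> = vector_integral (borel_on \<Omega>) (BV_deriv \<Omega> u) (\<lambda>x. - perp (\<psi> x))"
  unfolding BV_deriv_perp_def[abs_def]
  by (rule vector_integral_linear_image[OF vector_measure_BV_deriv[OF assms(1)] bounded_linear_perp perp_adjoint assms(2)])

lemma C1c_C0c: "C1c U f \<Longrightarrow> C0c U f"
  unfolding C1c_def C0c_def using C1_continuous_on by blast

text \<open>Approximate \<open>\<nabla>g\<close> by its Steklov averages \<open>S\<close>. The rotated field \<open>- perp S\<close> is a \<open>C\<^sup>1\<close> test function for
  \<open>Du\<close> and has zero divergence since \<open>S\<close> is curl free.\<close>

lemma BV_deriv_perp_gradient:
  assumes U: "open \<Omega>" "\<Omega> \<noteq> {}" and u: "u \<in> BV \<Omega>" and g: "C1 \<Omega> g" and gc: "C0c \<Omega> (gradient g)"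
  shows "vector_integral (borel_on \<Omega>) (BV_deriv_perp \<Omega> u) (gradient g) = 0"
proof (rule vector_integral_eq_0_approx[OF vector_measure_BV_deriv_perp[OF u] C0c_bounded_measurable[OF gc]])
  fix \<eta> :: real assume \<eta>: "\<eta> > 0"
  let ?G = "zero_ext \<Omega> (gradient g)"
  obtain K \<epsilon> where K: "compact K" "K \<subseteq> \<Omega>" "\<And>x. x \<notin> K \<Longrightarrow> ?G x = 0" and \<epsilon>: "\<epsilon> > 0"
    and near: "\<And>y z. y \<in> K \<Longrightarrow> dist y z \<le> 2 * \<epsilon> \<Longrightarrow> z \<in> \<Omega>"
    and c: "\<And>e. 0 < e \<Longrightarrow> e \<le> \<epsilon> \<Longrightarrow> C1c \<Omega> (steklov e ?G)"
    and close: "\<And>e x. 0 < e \<Longrightarrow> e \<le> \<epsilon> \<Longrightarrow> norm (steklov e ?G x - ?G x) \<le> \<eta>"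
    using C0c_steklov_approx[OF U gc \<eta>] by metis
  let ?S = "steklov \<epsilon> ?G"
  have S: "C1c \<Omega> ?S" using c \<epsilon> by blast
  have G: "continuous_on UNIV ?G" by (rule continuous_on_zero_ext[OF U(1) gc])
  let ?\<phi> = "\<lambda>x. - perp (?S x)"
  have bl: "bounded_linear (\<lambda>y. - perp y)" by (rule bounded_linear_minus[OF bounded_linear_perp])
  have \<phi>: "C1c \<Omega> ?\<phi>" by (rule C1c_linear_image[OF bl S])
  have div: "divergence ?\<phi> x = 0" if x: "x \<in> \<Omega>" for x
  proof -
    have "frechet_derivative ?\<phi> (at x) = (\<lambda>k. - perp (frechet_derivative ?S (at x) k))"
      using S x unfolding C1c_def by (intro C1_linear_image(2)[OF bl]) auto
    hence "divergence ?\<phi> x = - (steklov_deriv \<epsilon> ?G x (axis 1 1) $ 2) + steklov_deriv \<epsilon> ?G x (axis 2 1) $ 1"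
      unfolding divergence_def frechet_derivative_steklov[OF G \<epsilon>] by (simp add: sum_2)
    thus ?thesis using steklov_gradient_curl_free[OF U(1) g gc \<epsilon> K(3) near] by simp
  qed
  have "vector_integral (borel_on \<Omega>) (BV_deriv_perp \<Omega> u) ?S = vector_integral (borel_on \<Omega>) (BV_deriv \<Omega> u) ?\<phi>"
    by (rule vector_integral_BV_deriv_perp[OF u C0c_bounded_measurable[OF C1c_C0c[OF S]]])
  also have "\<dots> = - set_lebesgue_integral lebesgue \<Omega> (\<lambda>x. u x * divergence ?\<phi> x)"
    using BV_deriv_is_distr_deriv[OF u] \<phi> unfolding is_distr_deriv_def by blast
  also have "set_lebesgue_integral lebesgue \<Omega> (\<lambda>x. u x * divergence ?\<phi> x) = (\<integral>x. 0 \<partial>(lebesgue :: (real^2) measure))"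
    unfolding set_lebesgue_integral_def
    by (rule Bochner_Integration.integral_cong[OF refl]) (use div in \<open>auto simp: indicator_def\<close>)
  finally have "vector_integral (borel_on \<Omega>) (BV_deriv_perp \<Omega> u) ?S = 0" by simp
  moreover have "norm (?S x - gradient g x) \<le> \<eta>" if "x \<in> \<Omega>" for x
    using close[OF \<epsilon> order_refl, of x] that by (simp add: zero_ext_def)
  ultimately show "\<exists>\<phi>. bounded_measurable (borel_on \<Omega>) \<phi> \<and>
      vector_integral (borel_on \<Omega>) (BV_deriv_perp \<Omega> u) \<phi> = 0 \<and>
      (\<forall>z\<in>space (borel_on \<Omega>). norm (\<phi> z - gradient g z) \<le> \<eta>)"
    using C0c_bounded_measurable[OF C1c_C0c[OF S]] by auto
qed

lemma C0c_comp_fst: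
  fixes \<psi> :: "'a::metric_space \<Rightarrow> 'b::real_normed_vector" and C :: "'c::metric_space set"
  assumes "C0c \<Omega> \<psi>" "compact C"
  shows "C0c (\<Omega> \<times> C) (\<lambda>z. \<psi> (fst z))"
proof -
  have "compact_support \<Omega> \<psi>" using assms(1) C0c_def by blast
  then obtain K where K: "compact K" "K \<subseteq> \<Omega>" "\<And>z. z \<in> \<Omega> \<Longrightarrow> z \<notin> K \<Longrightarrow> \<psi> z = 0"
    using compact_supportE by metis
  have "continuous_on (\<Omega> \<times> C) (\<lambda>z. \<psi> (fst z))"
  proof (rule continuous_on_compose2[of \<Omega> \<psi> "\<Omega> \<times> C" fst])
    show "continuous_on \<Omega> \<psi>" using assms(1) C0c_def by blast
    show "continuous_on (\<Omega> \<times> C) (fst :: 'a \<times> 'c \<Rightarrow> 'a)" by (rule continuous_on_fst[OF continuous_on_id])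
  qed auto
  moreover have "compact_support (\<Omega> \<times> C) (\<lambda>z. \<psi> (fst z))"
  proof (rule compact_supportI[OF compact_Times[OF K(1) assms(2)]])
    show "K \<times> C \<subseteq> \<Omega> \<times> C" using K(2) by auto
    show "\<psi> (fst z) = 0" if "z \<in> \<Omega> \<times> C" "z \<notin> K \<times> C" for z
      using that by (intro K(3)) auto
  qed
  ultimately show ?thesis unfolding C0c_def by blast
qed

lemma C0c_linear_image:
  fixes f :: "'a::metric_space \<Rightarrow> 'b::real_normed_vector"
  assumes "bounded_linear T" "C0c U f"
  shows "C0c U (\<lambda>x. T (f x))"
  by (rule C0c_dominated[OF assms(2)])
    (use assms linear_simps(3)[OF assms(1)] in \<open>auto simp: C0c_def intro: bounded_linear.continuous_on\<close>)

lemma bounded_linear_Pair0: "bounded_linear (\<lambda>x. (x, 0))"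
  by (intro bounded_linear_Pair bounded_linear_ident bounded_linear_zero)

lemma C0c_horizontal:
  fixes \<psi> :: "real^2 \<Rightarrow> real^2"
  assumes "C0c \<Omega> \<psi>"
  shows "C0c (\<Omega> \<times> circle) (\<lambda>z. (\<psi> (fst z), 0 :: real))"
  by (rule C0c_linear_image[OF bounded_linear_Pair0 C0c_comp_fst[OF assms compact_sphere]])

lemma vector_integral_fst:
  fixes \<sigma> :: "'a set \<Rightarrow> (real^2) \<times> real"
  assumes "vector_measure M \<sigma>" "bounded_measurable M \<psi>"
  shows "vector_integral M (\<lambda>A. fst (\<sigma> A)) \<psi> = vector_integral M \<sigma> (\<lambda>z. (\<psi> z, 0))"
  by (rule vector_integral_linear_image[OF assms(1) bounded_linear_fst _ assms(2)]) (simp add: inner_prod_def)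

text \<open>The constraint is imposed for \<open>C\<^sup>1\<close> fields; both sides are continuous under uniform convergence, and
  Steklov averages approximate.\<close>

lemma marginal_C0c:
  assumes U: "open \<Omega>" "\<Omega> \<noteq> {}" and u: "u \<in> BV \<Omega>"
    and v: "vector_measure (borel_on (\<Omega> \<times> circle)) \<sigma>" and m: "has_marginal \<Omega> u \<sigma>"
    and \<psi>: "C0c \<Omega> \<psi>"
  shows "vector_integral (borel_on (\<Omega> \<times> circle)) \<sigma> (\<lambda>z. (\<psi> (fst z), 0)) = vector_integral (borel_on \<Omega>) (BV_deriv_perp \<Omega> u) \<psi>"
proof -
  let ?Z = "borel_on (\<Omega> \<times> circle)" and ?D = "BV_deriv_perp \<Omega> u"
  note vD = vector_measure_BV_deriv_perp[OF u]
  have smooth: "vector_integral ?Z \<sigma> (\<lambda>z. (\<phi> (fst z), 0)) = vector_integral (borel_on \<Omega>) ?D \<phi>" if \<phi>: "C1c \<Omega> \<phi>" for \<phi>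
  proof -
    have bl: "bounded_linear (\<lambda>y. - perp y)" by (rule bounded_linear_minus[OF bounded_linear_perp])
    have "vector_integral ?Z (\<lambda>A. fst (\<sigma> A)) (\<lambda>(x, v). perp (- perp (\<phi> x))) = vector_integral (borel_on \<Omega>) (BV_deriv \<Omega> u) (\<lambda>x. - perp (\<phi> x))"
      using m C1c_linear_image[OF bl \<phi>] unfolding has_marginal_def by blast
    moreover have "vector_integral ?Z (\<lambda>A. fst (\<sigma> A)) (\<lambda>z. \<phi> (fst z)) = vector_integral ?Z \<sigma> (\<lambda>z. (\<phi> (fst z), 0))"
      by (intro vector_integral_fst[OF v] C0c_bounded_measurable C0c_comp_fst C1c_C0c \<phi> compact_sphere)
    ultimately show ?thesis
      using vector_integral_BV_deriv_perp[OF u C0c_bounded_measurable[OF C1c_C0c[OF \<phi>]]]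
      by (simp add: perp_perp case_prod_unfold)
  qed
  define C1 where "C1 = (\<integral>z. norm (polar_density ?Z \<sigma> z) \<partial>total_variation ?Z \<sigma>)"
  define C2 where "C2 = (\<integral>z. norm (polar_density (borel_on \<Omega>) ?D z) \<partial>total_variation (borel_on \<Omega>) ?D)"
  have C0: "C1 \<ge> 0" "C2 \<ge> 0" unfolding C1_def C2_def by (intro integral_nonneg_AE AE_I2; simp)+
  have "\<bar>vector_integral ?Z \<sigma> (\<lambda>z. (\<psi> (fst z), 0)) - vector_integral (borel_on \<Omega>) ?D \<psi>\<bar> \<le> 0 + e" if e: "e > 0" for e
  proof -
    define \<eta> where "\<eta> = e / (C1 + C2 + 1)"
    have \<eta>: "\<eta> > 0" "\<eta> * (C1 + C2 + 1) = e" using C0 e by (auto simp: \<eta>_def)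
    hence \<eta>le: "\<eta> * C1 + \<eta> * C2 \<le> e" by (simp add: distrib_left)
    obtain \<epsilon> where \<epsilon>: "\<epsilon> > 0" and S: "\<And>e. 0 < e \<Longrightarrow> e \<le> \<epsilon> \<Longrightarrow> C1c \<Omega> (steklov e (zero_ext \<Omega> \<psi>))"
      "\<And>e x. 0 < e \<Longrightarrow> e \<le> \<epsilon> \<Longrightarrow> norm (steklov e (zero_ext \<Omega> \<psi>) x - zero_ext \<Omega> \<psi> x) \<le> \<eta>"
      using C0c_steklov_approx[OF U \<psi> \<eta>(1)] by metis
    define \<phi> where "\<phi> = steklov \<epsilon> (zero_ext \<Omega> \<psi>)"
    have \<phi>: "C1c \<Omega> \<phi>" unfolding \<phi>_def by (rule S(1)[OF \<epsilon> order_refl])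
    have close: "norm (\<psi> x - \<phi> x) \<le> \<eta>" if "x \<in> \<Omega>" for x
      using S(2)[OF \<epsilon> order_refl, of x] that by (simp add: \<phi>_def zero_ext_def norm_minus_commute)
    define d where "d x = \<psi> x + (-1) *\<^sub>R \<phi> x" for x
    have d: "C0c \<Omega> d" unfolding d_def by (intro C0c_add \<psi> C0c_scaleR C1c_C0c \<phi>)
    have \<psi>d: "\<psi> = (\<lambda>x. \<phi> x + d x)" by (rule ext) (simp add: d_def)
    have 1: "vector_integral (borel_on \<Omega>) ?D \<psi> = vector_integral (borel_on \<Omega>) ?D \<phi> + vector_integral (borel_on \<Omega>) ?D d"
      unfolding \<psi>d by (intro vector_integral_add[OF vD] C0c_bounded_measurable d C1c_C0c \<phi>)
    have eq: "(\<lambda>z. (\<psi> (fst z), 0::real)) = (\<lambda>z. (\<phi> (fst z), 0) + (d (fst z), 0))"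
      by (rule ext) (simp add: \<psi>d)
    have 2: "vector_integral ?Z \<sigma> (\<lambda>z. (\<psi> (fst z), 0)) = vector_integral ?Z \<sigma> (\<lambda>z. (\<phi> (fst z), 0)) + vector_integral ?Z \<sigma> (\<lambda>z. (d (fst z), 0))"
      unfolding eq by (intro vector_integral_add[OF v] C0c_bounded_measurable C0c_horizontal d C1c_C0c \<phi>)
    have dn: "norm (d x) \<le> \<eta>" if "x \<in> \<Omega>" for x using close[OF that] by (simp add: d_def)
    have 3: "\<bar>vector_integral (borel_on \<Omega>) ?D d\<bar> \<le> \<eta> * C2"
      unfolding C2_def using C0c_bounded_measurable[OF d] dn
      by (intro vector_integral_bound[OF vD]) (auto simp: bounded_measurable_def)
    have 4: "\<bar>vector_integral ?Z \<sigma> (\<lambda>z. (d (fst z), 0))\<bar> \<le> \<eta> * C1"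
      unfolding C1_def using C0c_bounded_measurable[OF C0c_horizontal[OF d]] dn
      by (intro vector_integral_bound[OF v]) (auto simp: bounded_measurable_def norm_Pair)
    show ?thesis using 1 2 3 4 smooth[OF \<phi>] \<eta>le by linarith
  qed
  hence "\<bar>vector_integral ?Z \<sigma> (\<lambda>z. (\<psi> (fst z), 0)) - vector_integral (borel_on \<Omega>) ?D \<psi>\<bar> \<le> 0" by (rule field_le_epsilon)
  thus ?thesis by simp
qed


section \<open>Gradients on the cylinder\<close>

lemma circle_pt_simps [simp]: "circle_pt \<theta> $ 1 = cos \<theta>" "circle_pt \<theta> $ 2 = sin \<theta>"
  by (simp_all add: circle_pt_def)

lemma circle_pt_in_circle: "circle_pt \<theta> \<in> circle"
  by (simp add: norm_eq_sqrt_inner inner_vec_def sum_2 power2_eq_square[symmetric])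

lemma continuous_on_circle_pt [continuous_intros]:
  fixes f :: "'a::t2_space \<Rightarrow> real"
  shows "continuous_on S f \<Longrightarrow> continuous_on S (\<lambda>x. circle_pt (f x))"
proof -
  assume f: "continuous_on S f"
  have "circle_pt \<theta> = pt (cos \<theta>) (sin \<theta>)" for \<theta> by (simp add: vec_eq_iff forall_2)
  thus ?thesis using f by (simp only:) (intro continuous_on_pt continuous_on_cos continuous_on_sin)
qed

text \<open>The angle at which \<open>cyl_gradient\<close> evaluates the gradient of the lift. It is not continuous, and
  continuity of \<open>cyl_gradient\<close> has to come from periodicity.\<close>

definition angle :: "real^2 \<Rightarrow> real" where
  "angle v = (SOME \<theta>. circle_pt \<theta> = v)"

lemma circle_pt_angle: assumes "v \<in> circle" shows "circle_pt (angle v) = v"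
proof -
  have "(v $ 1)\<^sup>2 + (v $ 2)\<^sup>2 = 1" using circle_sum_squares[OF assms] by (simp add: power2_eq_square)
  then obtain t where "v $ 1 = cos t" "v $ 2 = sin t" by (rule sincos_total_2pi)
  hence "circle_pt t = v" by (simp add: vec_eq_iff forall_2)
  thus ?thesis unfolding angle_def by (rule someI)
qed

lemma cyl_gradient_eq: "cyl_gradient \<phi> (x, v) = gradient (lift \<phi>) (x, angle v)"
  by (simp add: cyl_gradient_def angle_def)

lemma lift_eq: "lift \<phi> (x, \<theta>) = \<phi> (x, circle_pt \<theta>)"
  by (simp add: lift_def)

text \<open>Two angles of the same point differ by a period of the lift.\<close>

lemma gradient_lift_periodic:
  assumes \<phi>: "C1_cyl \<Omega> \<phi>" and x: "x \<in> \<Omega>" and eq: "circle_pt \<theta> = circle_pt \<theta>'"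
  shows "gradient (lift \<phi>) (x, \<theta>) = gradient (lift \<phi>) (x, \<theta>')"
proof -
  define c where "c = \<theta>' - \<theta>"
  have e: "cos \<theta> = cos \<theta>'" "sin \<theta> = sin \<theta>'"
    using arg_cong[OF eq, of "\<lambda>v. v $ 1"] arg_cong[OF eq, of "\<lambda>v. v $ 2"] by simp_all
  have c: "cos c = 1" "sin c = 0"
    unfolding c_def using e by (simp_all add: cos_diff sin_diff power2_eq_square[symmetric])
  have per: "lift \<phi> z = lift \<phi> (z + (0, c))" for z
  proof -
    have "circle_pt (snd z + c) = circle_pt (snd z)"
      using c by (simp add: vec_eq_iff forall_2 cos_add sin_add)
    thus ?thesis by (cases z) (simp add: lift_eq)
  qed
  have "(lift \<phi> has_derivative frechet_derivative (lift \<phi>) (at (x, \<theta>'))) (at (x, \<theta>'))"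
    using \<phi> x frechet_derivative_works unfolding C1_cyl_def C1_def by auto
  hence d: "(lift \<phi> has_derivative frechet_derivative (lift \<phi>) (at (x, \<theta>'))) (at ((x, \<theta>) + (0, c)))"
    by (simp add: c_def)
  have "((\<lambda>z. z + (0, c)) has_derivative (\<lambda>h. h)) (at (x, \<theta>))" by (auto intro!: derivative_eq_intros)
  from has_derivative_compose[OF this d]
  have "((\<lambda>z. lift \<phi> (z + (0, c))) has_derivative frechet_derivative (lift \<phi>) (at (x, \<theta>'))) (at (x, \<theta>))" .
  hence "(lift \<phi> has_derivative frechet_derivative (lift \<phi>) (at (x, \<theta>'))) (at (x, \<theta>))"
    by (simp only: per[symmetric])
  hence "frechet_derivative (lift \<phi>) (at (x, \<theta>')) = frechet_derivative (lift \<phi>) (at (x, \<theta>))"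
    by (rule frechet_derivative_at)
  thus ?thesis unfolding gradient_def by simp
qed

lemma cyl_gradient_circle_pt:
  assumes "C1_cyl \<Omega> \<phi>" "x \<in> \<Omega>"
  shows "cyl_gradient \<phi> (x, circle_pt \<theta>) = gradient (lift \<phi>) (x, \<theta>)"
  unfolding cyl_gradient_eq
  by (rule gradient_lift_periodic[OF assms]) (rule circle_pt_angle[OF circle_pt_in_circle])

text \<open>Near \<open>v0\<close> a continuous angle is obtained from the sine of the angle between \<open>v0\<close> and \<open>v\<close>, which is the
  determinant of the two vectors.\<close>

lemma local_angle:
  assumes v0: "v0 \<in> circle"
  defines "t \<equiv> \<lambda>v :: real^2. angle v0 + arcsin (v0 $ 1 * v $ 2 - v0 $ 2 * v $ 1)"
  shows "continuous_on circle t" "\<And>v. v \<in> circle \<Longrightarrow> v0 \<bullet> v > 0 \<Longrightarrow> circle_pt (t v) = v"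
proof -
  have id: "(v0 $ 1 * v $ 2 - v0 $ 2 * v $ 1)\<^sup>2 + (v0 \<bullet> v)\<^sup>2 = 1" if v: "v \<in> circle" for v
  proof -
    have "(v0 $ 1 * v $ 2 - v0 $ 2 * v $ 1)\<^sup>2 + (v0 \<bullet> v)\<^sup>2
        = (v0 $ 1 * v0 $ 1 + v0 $ 2 * v0 $ 2) * (v $ 1 * v $ 1 + v $ 2 * v $ 2)"
      by (simp add: inner_vec_def sum_2 power2_eq_square algebra_simps)
    thus ?thesis using circle_sum_squares[OF v0] circle_sum_squares[OF v] by simp
  qed
  have bd: "- 1 \<le> v0 $ 1 * v $ 2 - v0 $ 2 * v $ 1 \<and> v0 $ 1 * v $ 2 - v0 $ 2 * v $ 1 \<le> 1" if "v \<in> circle" for v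
  proof -
    have "(v0 $ 1 * v $ 2 - v0 $ 2 * v $ 1)\<^sup>2 \<le> 1" using id[OF that] by (smt (verit) zero_le_power2)
    hence "\<bar>v0 $ 1 * v $ 2 - v0 $ 2 * v $ 1\<bar> \<le> 1" by (simp add: abs_square_le_1)
    thus ?thesis by linarith
  qed
  show "continuous_on circle t"
    unfolding t_def using bd by (intro continuous_intros) auto
  fix v assume v: "v \<in> circle" and pos: "v0 \<bullet> v > 0"
  define s where "s = v0 $ 1 * v $ 2 - v0 $ 2 * v $ 1"
  have c0: "cos (angle v0) = v0 $ 1" "sin (angle v0) = v0 $ 2"
    using circle_pt_angle[OF v0] circle_pt_simps by metis+
  have sn: "sin (arcsin s) = s" using bd[OF v] by (simp add: s_def)
  have "cos (arcsin s) = sqrt (1 - s\<^sup>2)" using bd[OF v] by (intro cos_arcsin) (auto simp: s_def)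
  also have "1 - s\<^sup>2 = (v0 \<bullet> v)\<^sup>2" using id[OF v] by (simp add: s_def)
  finally have cs: "cos (arcsin s) = v0 \<bullet> v" using pos by simp
  have "v0 $ 1 * (v0 \<bullet> v) - v0 $ 2 * s = v $ 1 * (v0 $ 1 * v0 $ 1 + v0 $ 2 * v0 $ 2)"
    "v0 $ 2 * (v0 \<bullet> v) + v0 $ 1 * s = v $ 2 * (v0 $ 1 * v0 $ 1 + v0 $ 2 * v0 $ 2)"
    by (simp_all add: s_def inner_vec_def sum_2 algebra_simps)
  thus "circle_pt (t v) = v"
    unfolding t_def s_def[symmetric] using circle_sum_squares[OF v0] sn cs c0
    by (simp add: vec_eq_iff forall_2 cos_add sin_add)
qed

text \<open>Around each point replace the angle chosen by \<open>cyl_gradient\<close> by a continuous one.\<close>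

lemma continuous_on_cyl_gradient:
  assumes \<phi>: "C1_cyl \<Omega> \<phi>"
  shows "continuous_on (\<Omega> \<times> circle) (cyl_gradient \<phi>)"
  unfolding continuous_on_eq_continuous_within
proof
  fix z0 assume z0: "z0 \<in> \<Omega> \<times> circle"
  define v0 where "v0 = snd z0"
  have v0: "v0 \<in> circle" using z0 by (auto simp: v0_def)
  define t where "t v = angle v0 + arcsin (v0 $ 1 * v $ 2 - v0 $ 2 * v $ 1)" for v :: "real^2"
  define T where "T = {z :: (real^2) \<times> (real^2). v0 \<bullet> snd z > 0}"
  have T: "open T" unfolding T_def by (intro open_Collect_less continuous_intros)
  have z0T: "z0 \<in> T" using v0 by (auto simp: T_def v0_def norm_eq_sqrt_inner)
  have tc: "continuous_on circle t" and ti: "\<And>v. v \<in> circle \<Longrightarrow> v0 \<bullet> v > 0 \<Longrightarrow> circle_pt (t v) = v"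
    using local_angle[OF v0] unfolding t_def[abs_def] by auto
  have Gc: "continuous_on (\<Omega> \<times> UNIV) (gradient (lift \<phi>))"
    using \<phi> unfolding C1_cyl_def by (rule continuous_on_gradient)
  have mc: "continuous_on (\<Omega> \<times> circle \<inter> T) (\<lambda>z. (fst z, t (snd z)))"
    by (intro continuous_on_Pair continuous_on_fst continuous_on_id continuous_on_compose2[OF tc] continuous_on_snd) auto
  have "continuous_on (\<Omega> \<times> circle \<inter> T) (\<lambda>z. gradient (lift \<phi>) (fst z, t (snd z)))"
    by (rule continuous_on_compose2[OF Gc mc]) auto
  hence "continuous_on (\<Omega> \<times> circle \<inter> T) (cyl_gradient \<phi>)"
  proof (rule continuous_on_eq)
    fix z assume z: "z \<in> \<Omega> \<times> circle \<inter> T"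
    hence "circle_pt (t (snd z)) = snd z" by (intro ti) (auto simp: T_def)
    hence "cyl_gradient \<phi> (fst z, snd z) = gradient (lift \<phi>) (fst z, t (snd z))"
      using cyl_gradient_circle_pt[OF \<phi>, of "fst z" "t (snd z)"] z by auto
    thus "gradient (lift \<phi>) (fst z, t (snd z)) = cyl_gradient \<phi> z" by simp
  qed
  hence "continuous (at z0 within (\<Omega> \<times> circle \<inter> T)) (cyl_gradient \<phi>)"
    using z0 z0T unfolding continuous_on_eq_continuous_within by blast
  moreover have "at z0 within (\<Omega> \<times> circle \<inter> T) = at z0 within (\<Omega> \<times> circle)"
    by (rule at_within_nhd[OF z0T T]) auto
  ultimately show "continuous (at z0 within (\<Omega> \<times> circle)) (cyl_gradient \<phi>)" by simp
qed

lemma cyl_gradient_add: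
  assumes "C1_cyl \<Omega> \<phi>" "C1_cyl \<Omega> \<psi>"
  shows "C1_cyl \<Omega> (\<lambda>z. \<phi> z + \<psi> z)"
    "x \<in> \<Omega> \<Longrightarrow> cyl_gradient (\<lambda>z. \<phi> z + \<psi> z) (x, v) = cyl_gradient \<phi> (x, v) + cyl_gradient \<psi> (x, v)"
proof -
  have l: "lift (\<lambda>z. \<phi> z + \<psi> z) = (\<lambda>z. lift \<phi> z + lift \<psi> z)" by (rule ext) (simp add: lift_def case_prod_beta)
  show "C1_cyl \<Omega> (\<lambda>z. \<phi> z + \<psi> z)" using assms C1_add(1) unfolding C1_cyl_def l by blast
  show "cyl_gradient (\<lambda>z. \<phi> z + \<psi> z) (x, v) = cyl_gradient \<phi> (x, v) + cyl_gradient \<psi> (x, v)" if "x \<in> \<Omega>"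
    unfolding cyl_gradient_eq l using assms that unfolding C1_cyl_def by (intro gradient_add) auto
qed

lemma cyl_gradient_scale:
  assumes "C1_cyl \<Omega> \<phi>"
  shows "C1_cyl \<Omega> (\<lambda>z. c * \<phi> z)"
    "x \<in> \<Omega> \<Longrightarrow> cyl_gradient (\<lambda>z. c * \<phi> z) (x, v) = c *\<^sub>R cyl_gradient \<phi> (x, v)"
proof -
  have l: "lift (\<lambda>z. c * \<phi> z) = (\<lambda>z. c * lift \<phi> z)" by (rule ext) (simp add: lift_def case_prod_beta)
  show "C1_cyl \<Omega> (\<lambda>z. c * \<phi> z)"
    using assms C1_linear_image(1)[OF bounded_linear_mult_right] unfolding C1_cyl_def l by blast
  show "cyl_gradient (\<lambda>z. c * \<phi> z) (x, v) = c *\<^sub>R cyl_gradient \<phi> (x, v)" if "x \<in> \<Omega>"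
    unfolding cyl_gradient_eq l using assms that unfolding C1_cyl_def by (intro gradient_scale) auto
qed

lemma gradient_locally_0:
  assumes "open T" "z \<in> T" "\<And>w. w \<in> T \<Longrightarrow> g w = 0"
  shows "gradient g z = 0"
proof -
  have "((\<lambda>w. 0) has_derivative (\<lambda>h. 0)) (at z)" by (rule has_derivative_const)
  hence "(g has_derivative (\<lambda>h. 0)) (at z)"
    by (rule has_derivative_transform_within_open[OF _ assms(1,2)]) (simp add: assms(3))
  hence "frechet_derivative g (at z) = (\<lambda>h. 0)" by (rule frechet_derivative_at[symmetric])
  thus ?thesis unfolding gradient_def by simp
qed

lemma C0c_cyl_gradient:
  assumes \<Omega>: "open \<Omega>" and \<phi>: "C1c_cyl \<Omega> \<phi>"
  shows "C0c (\<Omega> \<times> circle) (cyl_gradient \<phi>)"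
proof -
  have c1: "C1_cyl \<Omega> \<phi>" and "compact_support (\<Omega> \<times> circle) \<phi>" using \<phi> unfolding C1c_cyl_def by auto
  then obtain K where K: "compact K" "K \<subseteq> \<Omega> \<times> circle" "\<And>z. z \<in> \<Omega> \<times> circle \<Longrightarrow> z \<notin> K \<Longrightarrow> \<phi> z = 0"
    using compact_supportE by metis
  have "compact_support (\<Omega> \<times> circle) (cyl_gradient \<phi>)"
  proof (rule compact_supportI[OF K(1,2)])
    fix z assume z: "z \<in> \<Omega> \<times> circle" "z \<notin> K"
    obtain x v where xv: "z = (x, v)" by fastforce
    define T where "T = {w :: (real^2) \<times> real. fst w \<in> \<Omega> \<and> (fst w, circle_pt (snd w)) \<notin> K}"
    have "T = (\<lambda>w. fst w) -` \<Omega> \<inter> (\<lambda>w. (fst w, circle_pt (snd w))) -` (- K)" unfolding T_def by auto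
    moreover have "open ((\<lambda>w :: (real^2) \<times> real. fst w) -` \<Omega>)"
      by (intro open_vimage \<Omega> continuous_intros)
    moreover have "open ((\<lambda>w :: (real^2) \<times> real. (fst w, circle_pt (snd w))) -` (- K))"
      by (intro open_vimage open_Compl compact_imp_closed K(1) continuous_intros)
    ultimately have T: "open T" by (simp add: open_Int)
    have "(x, angle v) \<in> T" using z xv circle_pt_angle[of v] by (auto simp: T_def)
    hence "gradient (lift \<phi>) (x, angle v) = 0"
    proof (rule gradient_locally_0[OF T])
      fix w assume "w \<in> T"
      thus "lift \<phi> w = 0" using K(3)[of "(fst w, circle_pt (snd w))"] circle_pt_in_circle[of "snd w"]
        by (cases w) (auto simp: T_def lift_eq)
    qed
    thus "cyl_gradient \<phi> z = 0" by (simp add: xv cyl_gradient_eq)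
  qed
  thus ?thesis unfolding C0c_def using continuous_on_cyl_gradient[OF c1] by blast
qed

text \<open>The slice at angle zero, as a function on \<open>\<Omega>\<close> and as a potential on the cylinder.\<close>

lemma C1_cyl_slice:
  assumes \<phi>: "C1_cyl \<Omega> \<phi>"
  defines "g \<equiv> \<lambda>x. \<phi> (x, circle_pt 0)"
  shows "C1 \<Omega> g" "\<And>x. x \<in> \<Omega> \<Longrightarrow> gradient g x = fst (cyl_gradient \<phi> (x, circle_pt 0))"
    "C1_cyl \<Omega> (\<lambda>z. g (fst z))" "\<And>x v. x \<in> \<Omega> \<Longrightarrow> cyl_gradient (\<lambda>z. g (fst z)) (x, v) = (gradient g x, 0)"
proof -
  have dl: "(lift \<phi> has_derivative frechet_derivative (lift \<phi>) (at (x, 0))) (at (x, 0))" if "x \<in> \<Omega>" for x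
    using \<phi> that frechet_derivative_works unfolding C1_cyl_def C1_def by auto
  have g: "g = (\<lambda>x. lift \<phi> (x, 0))" by (rule ext) (simp add: g_def lift_eq)
  have dg: "(g has_derivative (\<lambda>k. frechet_derivative (lift \<phi>) (at (x, 0)) (k, 0))) (at x)" if "x \<in> \<Omega>" for x
  proof -
    have "((\<lambda>x :: real^2. (x, 0 :: real)) has_derivative (\<lambda>k. (k, 0))) (at x)"
      by (auto intro!: derivative_eq_intros)
    from has_derivative_compose[OF this dl[OF that]] show ?thesis unfolding g .
  qed
  have fg: "frechet_derivative g (at x) = (\<lambda>k. frechet_derivative (lift \<phi>) (at (x, 0)) (k, 0))" if "x \<in> \<Omega>" for x
    by (rule frechet_derivative_at[symmetric]) (rule dg[OF that])
  have gd: "g differentiable at x" if "x \<in> \<Omega>" for x using dg[OF that] unfolding differentiable_def by blast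
  show C1g: "C1 \<Omega> g"
    unfolding C1_def
  proof (intro conjI ballI allI gd)
    fix k
    have "continuous_on (\<Omega> \<times> UNIV) (\<lambda>z. frechet_derivative (lift \<phi>) (at z) (k, 0))"
      using \<phi> unfolding C1_cyl_def C1_def by blast
    hence "continuous_on \<Omega> (\<lambda>x. frechet_derivative (lift \<phi>) (at (x, 0)) (k, 0))"
      by (rule continuous_on_compose2) (auto intro!: continuous_intros)
    thus "continuous_on \<Omega> (\<lambda>x. frechet_derivative g (at x) k)"
      by (rule continuous_on_eq) (simp add: fg)
  qed
  show "gradient g x = fst (cyl_gradient \<phi> (x, circle_pt 0))" if x: "x \<in> \<Omega>" for x
  proof (rule vector_eq_rdot[THEN iffD1], rule allI)
    fix k
    have "lift \<phi> differentiable at (x, 0)" using dl[OF x] unfolding differentiable_def by blast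
    hence "gradient (lift \<phi>) (x, 0) \<bullet> (k, 0) = frechet_derivative (lift \<phi>) (at (x, 0)) (k, 0)"
      by (rule gradient_inner)
    thus "gradient g x \<bullet> k = fst (cyl_gradient \<phi> (x, circle_pt 0)) \<bullet> k"
      unfolding cyl_gradient_circle_pt[OF \<phi> x] gradient_inner[OF gd[OF x]] fg[OF x]
      by (simp add: inner_prod_def)
  qed
  have l: "lift (\<lambda>z. g (fst z)) = (\<lambda>z. g (fst z))" by (rule ext) (simp add: lift_def case_prod_beta)
  have d: "((\<lambda>z :: (real^2) \<times> real. g (fst z)) has_derivative (\<lambda>k. frechet_derivative g (at (fst z)) (fst k))) (at z)"
    if "fst z \<in> \<Omega>" for z
  proof (rule has_derivative_compose[where g=g and f=fst])
    show "(fst has_derivative fst) (at z)" by (rule bounded_linear_imp_has_derivative[OF bounded_linear_fst])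
    show "(g has_derivative frechet_derivative g (at (fst z))) (at (fst z))"
      using gd[OF that] frechet_derivative_works by blast
  qed
  have fd: "frechet_derivative (\<lambda>z :: (real^2) \<times> real. g (fst z)) (at z) = (\<lambda>k. frechet_derivative g (at (fst z)) (fst k))"
    if "fst z \<in> \<Omega>" for z
    by (rule frechet_derivative_at[symmetric]) (rule d[OF that])
  show "C1_cyl \<Omega> (\<lambda>z. g (fst z))"
    unfolding C1_cyl_def l C1_def
  proof (intro conjI ballI allI)
    fix z :: "(real^2) \<times> real" assume "z \<in> \<Omega> \<times> UNIV"
    thus "(\<lambda>z. g (fst z)) differentiable at z" using d[of z] unfolding differentiable_def by auto
  next
    fix k :: "(real^2) \<times> real"
    have "continuous_on \<Omega> (\<lambda>x. frechet_derivative g (at x) (fst k))" using C1g unfolding C1_def by blast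
    hence "continuous_on (\<Omega> \<times> (UNIV :: real set)) (\<lambda>z. frechet_derivative g (at (fst z)) (fst k))"
      by (rule continuous_on_compose2) (auto intro!: continuous_intros)
    thus "continuous_on (\<Omega> \<times> UNIV) (\<lambda>z :: (real^2) \<times> real. frechet_derivative (\<lambda>z. g (fst z)) (at z) k)"
      by (rule continuous_on_eq) (auto simp: fd)
  qed
  show "cyl_gradient (\<lambda>z. g (fst z)) (x, v) = (gradient g x, 0)" if x: "x \<in> \<Omega>" for x v
    unfolding cyl_gradient_eq l
  proof (rule vector_eq_rdot[THEN iffD1], rule allI)
    fix k :: "(real^2) \<times> real"
    have "(\<lambda>z :: (real^2) \<times> real. g (fst z)) differentiable at (x, angle v)"
      using d[of "(x, angle v)"] x unfolding differentiable_def by auto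
    hence "gradient (\<lambda>z. g (fst z)) (x, angle v) \<bullet> k = frechet_derivative g (at x) (fst k)"
      using fd[of "(x, angle v)"] x gradient_inner by fastforce
    also have "\<dots> = gradient g x \<bullet> fst k" by (rule gradient_inner[OF gd[OF x], symmetric])
    finally show "gradient (\<lambda>z. g (fst z)) (x, angle v) \<bullet> k = (gradient g x, 0) \<bullet> k"
      by (simp add: inner_prod_def)
  qed
qed

lemma C1_cyl_constant_angle:
  assumes \<phi>: "C1_cyl \<Omega> \<phi>" and x: "x \<in> \<Omega>" and z: "\<And>v. v \<in> circle \<Longrightarrow> cyl_gradient \<phi> (x, v) = 0" and v: "v \<in> circle"
  shows "\<phi> (x, v) = \<phi> (x, circle_pt 0)"
proof -
  have d: "((\<lambda>\<theta>. lift \<phi> (x, \<theta>)) has_derivative (\<lambda>h. 0)) (at \<theta> within UNIV)" for \<theta>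
  proof -
    have df: "lift \<phi> differentiable at (x, \<theta>)" using \<phi> x unfolding C1_cyl_def C1_def by auto
    have "gradient (lift \<phi>) (x, \<theta>) = 0"
      using cyl_gradient_circle_pt[OF \<phi> x, of \<theta>] z[OF circle_pt_in_circle] by simp
    hence "frechet_derivative (lift \<phi>) (at (x, \<theta>)) = (\<lambda>k. 0)"
      using gradient_inner[OF df] by (auto simp: fun_eq_iff)
    hence dl: "(lift \<phi> has_derivative (\<lambda>k. 0)) (at (x, \<theta>))" using df frechet_derivative_works by metis
    have "((\<lambda>\<theta>. (x, \<theta>)) has_derivative (\<lambda>h. (0, h))) (at \<theta> within UNIV)"
      by (auto intro!: derivative_eq_intros)
    from has_derivative_compose[OF this dl] show ?thesis by simp
  qed
  have "lift \<phi> (x, angle v) = lift \<phi> (x, 0)"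
  proof -
    obtain c where "\<And>\<theta>. \<theta> \<in> UNIV \<Longrightarrow> lift \<phi> (x, \<theta>) = c"
      using has_derivative_zero_constant[OF convex_UNIV d] by metis
    thus ?thesis by simp
  qed
  thus ?thesis unfolding lift_eq circle_pt_angle[OF v] .
qed

text \<open>Subtracting the slice \<open>g\<close> at angle zero from \<open>\<phi>\<close> leaves a compactly supported potential, since
  off the projection of the support of \<open>\<nabla>\<phi>\<close> nothing depends on the angle. The contribution of \<open>g\<close> is
  \<open>\<integral> \<nabla>g \<cdot> Du\<^sup>\<bottom> = 0\<close>; \<open>g\<close> itself need not have compact support.\<close>

lemma div_free_general:
  assumes U: "open \<Omega>" "\<Omega> \<noteq> {}" and u: "u \<in> BV \<Omega>"
    and v: "vector_measure (borel_on (\<Omega> \<times> circle)) \<sigma>" and m: "has_marginal \<Omega> u \<sigma>" and df: "div_free \<Omega> \<sigma>"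
    and \<phi>: "C1_cyl \<Omega> \<phi>" and c: "C0c (\<Omega> \<times> circle) (cyl_gradient \<phi>)"
  shows "vector_integral (borel_on (\<Omega> \<times> circle)) \<sigma> (cyl_gradient \<phi>) = 0"
proof -
  let ?Z = "borel_on (\<Omega> \<times> circle)"
  define g where "g x = \<phi> (x, circle_pt 0)" for x
  define \<phi>0 where "\<phi>0 z = g (fst z)" for z :: "(real^2) \<times> (real^2)"
  define \<phi>1 where "\<phi>1 z = \<phi> z + (-1) * \<phi>0 z" for z
  note slice = C1_cyl_slice[OF \<phi>, folded g_def, folded \<phi>0_def[abs_def]]
  have "compact_support (\<Omega> \<times> circle) (cyl_gradient \<phi>)" using c C0c_def by blast
  then obtain K where K: "compact K" "K \<subseteq> \<Omega> \<times> circle" "\<And>z. z \<in> \<Omega> \<times> circle \<Longrightarrow> z \<notin> K \<Longrightarrow> cyl_gradient \<phi> z = 0"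
    using compact_supportE by metis
  have fK: "compact (fst ` K)" by (intro compact_continuous_image K continuous_on_fst continuous_on_id)
  have fKs: "fst ` K \<subseteq> \<Omega>" using K(2) by auto
  have zero: "cyl_gradient \<phi> (x, v) = 0" if "x \<in> \<Omega>" "x \<notin> fst ` K" "v \<in> circle" for x v
    using that by (intro K(3)) force+
  have gg: "C0c \<Omega> (gradient g)"
    unfolding C0c_def
  proof
    show "continuous_on \<Omega> (gradient g)" by (rule continuous_on_gradient[OF slice(1)])
    show "compact_support \<Omega> (gradient g)"
    proof (rule compact_supportI[OF fK fKs])
      fix x assume "x \<in> \<Omega>" "x \<notin> fst ` K"
      hence "cyl_gradient \<phi> (x, circle_pt 0) = 0" by (intro zero circle_pt_in_circle)
      thus "gradient g x = 0" unfolding slice(2)[OF \<open>x \<in> \<Omega>\<close>] by simp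
    qed
  qed
  have c1: "C1c_cyl \<Omega> \<phi>1"
    unfolding C1c_cyl_def
  proof
    show "C1_cyl \<Omega> \<phi>1" unfolding \<phi>1_def by (intro cyl_gradient_add(1) \<phi> cyl_gradient_scale(1) slice(3))
    show "compact_support (\<Omega> \<times> circle) \<phi>1"
    proof (rule compact_supportI[OF compact_Times[OF fK compact_sphere]])
      show "fst ` K \<times> circle \<subseteq> \<Omega> \<times> circle" using fKs by auto
      fix z assume z: "z \<in> \<Omega> \<times> circle" "z \<notin> fst ` K \<times> circle"
      have "fst z \<in> \<Omega>" "fst z \<notin> fst ` K" "snd z \<in> circle" using z by (auto simp: mem_Times_iff)
      hence "\<phi> (fst z, snd z) = \<phi> (fst z, circle_pt 0)"
        using zero by (intro C1_cyl_constant_angle[OF \<phi>]) auto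
      thus "\<phi>1 z = 0" by (simp add: \<phi>1_def \<phi>0_def g_def)
    qed
  qed
  have eq: "cyl_gradient \<phi> z = cyl_gradient \<phi>1 z + (gradient g (fst z), 0)" if z: "z \<in> \<Omega> \<times> circle" for z
  proof -
    obtain x v where xv: "z = (x, v)" by fastforce
    have x: "x \<in> \<Omega>" using z xv by auto
    have "cyl_gradient \<phi>1 (x, v) = cyl_gradient \<phi> (x, v) + cyl_gradient (\<lambda>z. (-1) * \<phi>0 z) (x, v)"
      unfolding \<phi>1_def by (rule cyl_gradient_add(2)[OF \<phi> cyl_gradient_scale(1)[OF slice(3)] x])
    also have "cyl_gradient (\<lambda>z. (-1) * \<phi>0 z) (x, v) = (-1) *\<^sub>R (gradient g x, 0)"
      unfolding cyl_gradient_scale(2)[OF slice(3) x] slice(4)[OF x] ..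
    finally show ?thesis by (simp add: xv zero_prod_def[symmetric])
  qed
  have "vector_integral ?Z \<sigma> (cyl_gradient \<phi>) = vector_integral ?Z \<sigma> (\<lambda>z. cyl_gradient \<phi>1 z + (gradient g (fst z), 0))"
    unfolding vector_integral_def by (intro Bochner_Integration.integral_cong refl) (simp add: eq)
  also have "\<dots> = vector_integral ?Z \<sigma> (cyl_gradient \<phi>1) + vector_integral ?Z \<sigma> (\<lambda>z. (gradient g (fst z), 0))"
    by (intro vector_integral_add[OF v] C0c_bounded_measurable C0c_cyl_gradient[OF U(1) c1] C0c_horizontal gg)
  also have "vector_integral ?Z \<sigma> (cyl_gradient \<phi>1) = 0" using df c1 unfolding div_free_def by blast
  also have "vector_integral ?Z \<sigma> (\<lambda>z. (gradient g (fst z), 0)) = vector_integral (borel_on \<Omega>) (BV_deriv_perp \<Omega> u) (gradient g)"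
    by (rule marginal_C0c[OF U u v m gg])
  also have "\<dots> = 0" by (rule BV_deriv_perp_gradient[OF U u slice(1) gg])
  finally show ?thesis by simp
qed

section \<open>The supremum is at most the infimum\<close>

text \<open>The constraint on \<open>(\<psi>, \<phi>)\<close> is one on the field \<open>(\<psi>, 0) + \<nabla>\<phi>\<close> alone.\<close>

lemma dual_constraint_iff:
  "dual_constraint \<Omega> f \<psi> \<phi> \<longleftrightarrow> (\<forall>x\<in>\<Omega>. \<forall>v\<in>circle.
     affine_minorant f (v \<bullet> fst ((\<psi> x, 0) + cyl_gradient \<phi> (x, v))) (snd ((\<psi> x, 0) + cyl_gradient \<phi> (x, v))))"
  unfolding dual_constraint_def conjugate_le_iff_affine_minorant by (simp add: add.commute)

lemma weak_duality:
  assumes U: "open \<Omega>" "\<Omega> \<noteq> {}" and cv: "convex_ext f" and lsc: "lower_semicont f" and pos: "\<And>t. f t > 0"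
    and u: "u \<in> BV \<Omega>"
    and v: "vector_measure (borel_on (\<Omega> \<times> circle)) \<sigma>" and m: "has_marginal \<Omega> u \<sigma>" and df: "div_free \<Omega> \<sigma>"
    and \<psi>: "C0c \<Omega> \<psi>" and \<phi>: "C1_cyl \<Omega> \<phi>" "C0c (\<Omega> \<times> circle) (cyl_gradient \<phi>)" and dc: "dual_constraint \<Omega> f \<psi> \<phi>"
  shows "ennreal (vector_integral (borel_on \<Omega>) (BV_deriv_perp \<Omega> u) \<psi>) \<le> h_integral \<Omega> f \<sigma>"
proof -
  let ?Z = "borel_on (\<Omega> \<times> circle)" and ?N = "total_variation (borel_on (\<Omega> \<times> circle)) \<sigma>"
    and ?p = "polar_density (borel_on (\<Omega> \<times> circle)) \<sigma>"
  define \<xi> where "\<xi> z = (\<psi> (fst z), 0) + cyl_gradient \<phi> z" for z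
  have \<xi>c: "C0c (\<Omega> \<times> circle) \<xi>" unfolding \<xi>_def by (intro C0c_add C0c_horizontal \<psi> \<phi>)
  have "vector_integral ?Z \<sigma> \<xi> = vector_integral ?Z \<sigma> (\<lambda>z. (\<psi> (fst z), 0)) + vector_integral ?Z \<sigma> (cyl_gradient \<phi>)"
    unfolding \<xi>_def by (intro vector_integral_add[OF v] C0c_bounded_measurable C0c_horizontal \<psi> \<phi>)
  hence I: "vector_integral (borel_on \<Omega>) (BV_deriv_perp \<Omega> u) \<psi> = (\<integral>z. \<xi> z \<bullet> ?p z \<partial>?N)"
    using marginal_C0c[OF U u v m \<psi>] div_free_general[OF U u v m df \<phi>] by (simp add: vector_integral_def)
  have int: "integrable ?N (\<lambda>z. \<xi> z \<bullet> ?p z)"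
    by (rule vector_integral_components(2)[OF v C0c_bounded_measurable[OF \<xi>c]])
  have "ennreal (\<integral>z. \<xi> z \<bullet> ?p z \<partial>?N) \<le> ennreal (\<integral>z. max 0 (\<xi> z \<bullet> ?p z) \<partial>?N)"
    using int by (intro ennreal_leI integral_mono) auto
  also have "\<dots> = (\<integral>\<^sup>+z. ennreal (max 0 (\<xi> z \<bullet> ?p z)) \<partial>?N)"
    using int by (intro nn_integral_eq_integral[symmetric]) auto
  also have "\<dots> \<le> (\<integral>\<^sup>+z. hfun f (snd z) (?p z) \<partial>?N)"
  proof (rule nn_integral_mono)
    fix z assume "z \<in> space ?N"
    hence z: "fst z \<in> \<Omega>" "snd z \<in> circle" by (auto simp: mem_Times_iff)
    have "affine_minorant f (snd z \<bullet> fst (\<xi> z)) (snd (\<xi> z))"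
      using bspec[OF bspec[OF dc[unfolded dual_constraint_iff] z(1)] z(2)] by (simp add: \<xi>_def)
    hence "ennreal (\<xi> z \<bullet> ?p z) \<le> hfun f (snd z) (?p z)" by (rule support_le_hfun[OF cv lsc pos z(2)])
    moreover have "ennreal (max 0 (\<xi> z \<bullet> ?p z)) = ennreal (\<xi> z \<bullet> ?p z)" by (simp add: max_def ennreal_neg)
    ultimately show "ennreal (max 0 (\<xi> z \<bullet> ?p z)) \<le> hfun f (snd z) (?p z)" by simp
  qed
  finally show ?thesis unfolding I h_integral_def .
qed

section \<open>The functional as a supremum over continuous fields\<close>

lemma continuous_on_perp [continuous_intros]:
  "continuous_on S f \<Longrightarrow> continuous_on S (\<lambda>x. perp (f x))"
  by (rule bounded_linear.continuous_on[OF bounded_linear_perp])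

lemma continuous_on_frame_section [continuous_intros]:
  "continuous_on S f \<Longrightarrow> continuous_on S (\<lambda>x. frame_section q (f x))"
  unfolding frame_section_def by (intro continuous_intros)

lemma norm_perp: "norm (perp v) = norm v"
  by (simp add: norm_eq_sqrt_inner inner_vec_def sum_2)

lemma norm_frame_section_le:
  assumes "v \<in> circle"
  shows "norm (frame_section q v) \<le> \<bar>fst q\<bar> + \<bar>fst (snd q)\<bar> + \<bar>snd (snd q)\<bar>"
proof -
  have "norm (frame_section q v) \<le> norm (fst q *\<^sub>R v + fst (snd q) *\<^sub>R perp v) + norm (snd (snd q))"
    unfolding frame_section_def by (rule norm_Pair_le)
  also have "norm (fst q *\<^sub>R v + fst (snd q) *\<^sub>R perp v) \<le> norm (fst q *\<^sub>R v) + norm (fst (snd q) *\<^sub>R perp v)"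
    by (rule norm_triangle_ineq)
  finally show ?thesis using assms by (simp add: norm_perp)
qed

text \<open>Weights of total mass at most one are completed by giving the rest to the zero minorant at index
  \<open>j\<close>.\<close>

lemma affine_minorant_sum:
  assumes "finite I" "j \<in> I" and q: "\<And>i. i \<in> I \<Longrightarrow> affine_minorant f (a i) (c i)" and q0: "a j = 0" "c j = 0"
    and w: "\<And>i. i \<in> I \<Longrightarrow> 0 \<le> w i" "(\<Sum>i\<in>I. w i) \<le> 1"
  shows "affine_minorant f (\<Sum>i\<in>I. w i * a i) (\<Sum>i\<in>I. w i * c i)"
proof -
  let ?K = "{(a, c). affine_minorant f a c}"
  have cv: "convex ?K"
    unfolding convex_def by (auto intro: affine_minorant_convex)
  define w' where "w' i = w i + (if i = j then 1 - (\<Sum>i\<in>I. w i) else 0)" for i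
  have "(\<Sum>i\<in>I. w' i) = 1" unfolding w'_def using assms(1,2) by (simp add: sum.distrib)
  moreover have "0 \<le> w' i" if "i \<in> I" for i using w that by (simp add: w'_def)
  ultimately have "(\<Sum>i\<in>I. w' i *\<^sub>R (a i, c i)) \<in> ?K"
    using q by (intro convex_sum[OF assms(1) cv]) auto
  moreover have "(\<Sum>i\<in>I. w' i *\<^sub>R (a i, c i)) = (\<Sum>i\<in>I. (w i * a i, w i * c i))"
    by (rule sum.cong[OF refl]) (use q0 in \<open>auto simp: w'_def\<close>)
  ultimately show ?thesis by (simp add: sum_prod)
qed

lemma borel_Times_circle:
  fixes \<Omega> :: "(real^2) set"
  assumes "open \<Omega>"
  shows "\<Omega> \<times> circle \<in> sets borel"
proof -
  have "\<Omega> \<times> circle = (\<Omega> \<times> UNIV) \<inter> (UNIV \<times> circle)" by auto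
  moreover have "open (\<Omega> \<times> (UNIV :: (real^2) set))" using \<open>open \<Omega>\<close> by (intro open_Times) auto
  moreover have "closed ((UNIV :: (real^2) set) \<times> circle)" by (intro closed_Times) auto
  ultimately show ?thesis by (simp add: sets.Int borel_open borel_closed)
qed

lemma inner_regular_borel_on:
  fixes Z :: "'a::{polish_space} set"
  assumes Z: "Z \<in> sets borel" and N: "sets N = sets (borel_on Z)" and fin: "finite_measure N"
    and A: "A \<in> sets N" and e: "e > 0"
  obtains K where "compact K" "K \<subseteq> A" "measure N (A - K) \<le> e"
proof -
  interpret N: finite_measure N by (rule fin)
  have sp: "space N = Z" using sets_eq_imp_space_eq[OF N] by simp
  have id: "(\<lambda>z. z) \<in> measurable N borel"
    unfolding measurable_cong_sets[OF N refl] by (rule measurable_restrict_space1) simp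
  define R where "R = distr N borel (\<lambda>z. z)"
  have Ab: "A \<in> sets borel" and AZ: "A \<subseteq> Z"
    using A Z unfolding N by (auto simp: sets_restrict_space_iff)
  have em: "emeasure R B = emeasure N B" if "B \<in> sets borel" "B \<subseteq> Z" for B
    unfolding R_def using that by (subst emeasure_distr[OF id]) (auto simp: sp Int_absorb2)
  have "emeasure R (space R) \<noteq> \<infinity>" unfolding R_def using id by (simp add: emeasure_distr)
  hence "emeasure R A = (SUP K\<in>{K. K \<subseteq> A \<and> compact K}. emeasure R K)"
    by (intro inner_regular Ab) (auto simp: R_def)
  also have "\<dots> = (SUP K\<in>{K. K \<subseteq> A \<and> compact K}. emeasure N K)"
    using AZ by (intro SUP_cong em) (auto intro: borel_compact)
  finally have sup: "emeasure N A = (SUP K\<in>{K. K \<subseteq> A \<and> compact K}. emeasure N K)" using em[OF Ab AZ] by simp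
  have "\<exists>K. K \<subseteq> A \<and> compact K \<and> measure N (A - K) \<le> e"
  proof (cases "measure N A \<le> e")
    case True thus ?thesis by (intro exI[of _ "{}"]) auto
  next
    case False
    have "ennreal (measure N A - e) < emeasure N A"
      unfolding N.emeasure_eq_measure using e False by (intro ennreal_lessI) auto
    then obtain K where K: "K \<subseteq> A" "compact K" "ennreal (measure N A - e) < emeasure N K"
      unfolding sup less_SUP_iff by auto
    have Ks: "K \<in> sets N" using K AZ borel_compact[OF K(2)] Z unfolding N by (auto simp: sets_restrict_space_iff)
    have "measure N A - e < measure N K"
      using K(3) False unfolding N.emeasure_eq_measure by (simp add: ennreal_less_iff)
    moreover have "measure N (A - K) = measure N A - measure N K"
      by (rule N.finite_measure_Diff[OF A Ks K(1)])
    ultimately show ?thesis using K by (intro exI[of _ K]) auto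
  qed
  thus ?thesis using that by blast
qed

text \<open>The cylinder is open in its first factor and closed in the second, hence locally compact.\<close>

lemma compact_neighbourhood_in_cylinder:
  fixes \<Omega> :: "(real^2) set"
  assumes \<Omega>: "open \<Omega>" "\<Omega> \<noteq> {}" and C: "compact C" "C \<subseteq> \<Omega> \<times> circle"
  obtains \<delta> Q where "\<delta> > 0" "compact Q" "Q \<subseteq> \<Omega> \<times> circle"
    "\<And>z y. z \<in> \<Omega> \<times> circle \<Longrightarrow> y \<in> C \<Longrightarrow> dist z y \<le> \<delta> \<Longrightarrow> z \<in> Q"
proof -
  obtain x0 where x0: "x0 \<in> \<Omega>" using \<Omega>(2) by blast
  define C' where "C' = insert (x0, circle_pt 0) C"
  have C': "C' \<noteq> {}" "compact C'" "C' \<subseteq> \<Omega> \<times> UNIV" using C x0 by (auto simp: C'_def)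
  have "open (\<Omega> \<times> (UNIV :: (real^2) set))" using \<Omega>(1) by (intro open_Times) auto
  then obtain \<delta> where \<delta>: "\<delta> > 0" "{z. infdist z C' \<le> \<delta>} \<subseteq> \<Omega> \<times> UNIV"
    using compact_in_open_separated[OF C'(1,2) _ C'(3)] by metis
  have cl: "closed ((UNIV :: (real^2) set) \<times> circle)" by (intro closed_Times) auto
  define Q where "Q = {z. infdist z C' \<le> \<delta>} \<inter> (UNIV \<times> circle)"
  show ?thesis
  proof (rule that[OF \<delta>(1)])
    show "compact Q" unfolding Q_def by (intro compact_Int_closed compact_infdist_le C' \<delta>(1) cl)
    show "Q \<subseteq> \<Omega> \<times> circle" using \<delta>(2) by (auto simp: Q_def)
    fix z y assume z: "z \<in> \<Omega> \<times> circle" "y \<in> C" "dist z y \<le> \<delta>"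
    have "infdist z C' \<le> dist z y" by (rule infdist_le) (use z in \<open>simp add: C'_def\<close>)
    thus "z \<in> Q" using z by (auto simp: Q_def)
  qed
qed

text \<open>The case distinction is needed because the distance to the empty set is zero by convention.\<close>

definition bump :: "nat \<Rightarrow> 'a::metric_space set \<Rightarrow> 'a \<Rightarrow> real" where
  "bump k C z = (if C = {} then 0 else max 0 (1 - real k * infdist z C))"

lemma bump_nonneg: "0 \<le> bump k C z" and bump_le_1: "bump k C z \<le> 1"
  by (auto simp: bump_def infdist_nonneg)

lemma continuous_on_bump: "continuous_on S (bump k C)"
  unfolding bump_def by (cases "C = {}") (auto intro!: continuous_intros)

lemma bump_limit:
  assumes "closed C"
  shows "(\<lambda>k. bump k C z) \<longlonglongrightarrow> indicator C z"
proof (cases "C = {}")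
  case True thus ?thesis by (simp add: bump_def)
next
  case False
  show ?thesis
  proof (cases "z \<in> C")
    case True thus ?thesis using False by (simp add: bump_def)
  next
    case zC: False
    have "infdist z C \<noteq> 0" using in_closed_iff_infdist_zero[OF assms False] zC by blast
    hence pos: "infdist z C > 0" using infdist_nonneg[of z C] by linarith
    then obtain m :: nat where m: "1 \<le> real m * infdist z C" by (metis reals_Archimedean3 less_imp_le)
    have "bump k C z = 0" if "k \<ge> m" for k
    proof -
      have "real m * infdist z C \<le> real k * infdist z C" using that pos by (intro mult_right_mono) auto
      thus ?thesis using m False by (simp add: bump_def)
    qed
    hence "eventually (\<lambda>k. bump k C z = indicator C z) sequentially"
      using zC unfolding eventually_sequentially by auto
    thus ?thesis by (rule tendsto_eventually)
  qed
qed

lemma bump_support: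
  fixes C :: "'a::heine_borel set"
  assumes C: "compact C" and b: "bump k C z \<noteq> 0" and k: "1 \<le> real k * \<delta>" "\<delta> > 0"
  obtains y where "y \<in> C" "dist z y \<le> \<delta>"
proof -
  have ne: "C \<noteq> {}" using b by (auto simp: bump_def)
  obtain y where y: "y \<in> C" "infdist z C = dist z y" using infdist_attains_inf[OF compact_imp_closed[OF C] ne] by metis
  have "real k * infdist z C < 1" using b ne by (auto simp: bump_def max_def split: if_splits)
  hence "real k * infdist z C < real k * \<delta>" using k(1) by linarith
  hence "infdist z C < \<delta>" by (rule mult_left_less_imp_less) simp
  thus ?thesis using y that by auto
qed

text \<open>A Borel choice among finitely many sections of the constraint set. Shrink the sets \<open>A n\<close> to compact
  subsets \<open>C n\<close>, losing little mass of the measure \<open>\<bar>\<sigma>\<bar>\<close>, and interpolate with bumps around the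
  \<open>C n\<close>. The interpolations are convex combinations with the zero section, so they stay in the
  constraint set; as the bumps narrow they converge to the choice on the \<open>C n\<close>.\<close>

lemma integral_selection_le:
  fixes \<sigma> :: "((real^2) \<times> (real^2)) set \<Rightarrow> (real^2) \<times> real" and q :: "nat \<Rightarrow> real \<times> real \<times> real"
  assumes \<Omega>: "open \<Omega>" "\<Omega> \<noteq> {}" and v: "vector_measure (borel_on (\<Omega> \<times> circle)) \<sigma>"
    and q: "\<And>n. affine_minorant f (fst (q n)) (snd (snd (q n)))" "q 0 = 0"
    and S: "\<And>\<xi>. C0c (\<Omega> \<times> circle) \<xi> \<Longrightarrow>
        (\<And>z. z \<in> \<Omega> \<times> circle \<Longrightarrow> affine_minorant f (snd z \<bullet> fst (\<xi> z)) (snd (\<xi> z))) \<Longrightarrow>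
        vector_integral (borel_on (\<Omega> \<times> circle)) \<sigma> \<xi> \<le> S"
    and A: "\<And>n. A n \<in> sets (borel_on (\<Omega> \<times> circle))" "disjoint_family A"
  shows "(\<integral>z. (\<Sum>n\<le>N. indicator (A n) z * (frame_section (q n) (snd z) \<bullet> polar_density (borel_on (\<Omega> \<times> circle)) \<sigma> z))
      \<partial>total_variation (borel_on (\<Omega> \<times> circle)) \<sigma>) \<le> S" (is "?I \<le> S")
proof -
  let ?Z = "\<Omega> \<times> circle"
  let ?N = "total_variation (borel_on ?Z) \<sigma>" and ?g = "polar_density (borel_on ?Z) \<sigma>"
  let ?F = "\<lambda>n z. frame_section (q n) (snd z)"
  have gi: "integrable ?N ?g" by (rule integrable_polar_density[OF v])
  have [measurable]: "?g \<in> borel_measurable ?N" using gi by auto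
  have spN: "space ?N = ?Z" by simp
  have Fm[measurable]: "?F n \<in> borel_measurable ?N" for n
    unfolding measurable_cong_sets[OF sets_total_variation refl]
    by (intro borel_measurable_continuous_on_restrict continuous_intros)
  have AN[measurable]: "A n \<in> sets ?N" for n using A by simp
  define r where "r n = \<bar>fst (q n)\<bar> + \<bar>fst (snd (q n))\<bar> + \<bar>snd (snd (q n))\<bar>" for n
  define B where "B = (\<Sum>n\<le>N. r n)"
  have r0: "0 \<le> r n" for n by (simp add: r_def)
  have B0: "0 \<le> B" unfolding B_def using r0 by (intro sum_nonneg) auto
  have FB: "norm (?F n z) \<le> B" if "n \<le> N" "z \<in> ?Z" for n z
  proof -
    have "norm (?F n z) \<le> r n" unfolding r_def by (rule norm_frame_section_le) (use that in auto)
    also have "r n \<le> B" unfolding B_def using that(1) r0 by (intro member_le_sum) auto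
    finally show ?thesis .
  qed
  \<comment> \<open>the loss on passing from \<open>A n\<close> to \<open>C n\<close> is an integral of the norm of the density, so regularity is used for the variation weighted by that norm\<close>
  define R where "R = density ?N (\<lambda>z. ennreal (norm (?g z)))"
  have Re: "emeasure R X = ennreal (\<integral>z. indicator X z * norm (?g z) \<partial>?N)" if "X \<in> sets ?N" for X
  proof -
    have i: "integrable ?N (\<lambda>z. indicator X z * norm (?g z))"
      using integrable_mult_indicator[OF that integrable_norm[OF gi]] by simp
    have "emeasure R X = (\<integral>\<^sup>+z. ennreal (norm (?g z)) * indicator X z \<partial>?N)"
      unfolding R_def by (rule emeasure_density) (use that in auto)
    also have "\<dots> = (\<integral>\<^sup>+z. ennreal (indicator X z * norm (?g z)) \<partial>?N)"
      by (rule nn_integral_cong) (simp split: split_indicator)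
    also have "\<dots> = ennreal (\<integral>z. indicator X z * norm (?g z) \<partial>?N)"
      by (rule nn_integral_eq_integral[OF i]) simp
    finally show ?thesis .
  qed
  have Rs: "sets R = sets (borel_on ?Z)" by (simp add: R_def)
  have "space R \<in> sets ?N" using sets.top[of R] by (simp only: R_def sets_density)
  hence Rf: "finite_measure R" by (intro finite_measureI) (simp add: Re)
  have Rm: "(\<integral>z. indicator X z * norm (?g z) \<partial>?N) = measure R X" if "X \<in> sets ?N" for X
    unfolding measure_def Re[OF that] by (subst enn2real_ennreal) (auto intro!: integral_nonneg_AE AE_I2)
  have "?I \<le> S + e'" if e': "e' > 0" for e'
  proof -
    define e where "e = e' / (B * real (Suc N) + 1)"
    have eB: "B * real (Suc N) + 1 > 0" using B0 by (simp add: add_nonneg_pos)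
    have e: "e > 0" unfolding e_def using e' eB by simp
    have "e * (B * real (Suc N) + 1) = e'" unfolding e_def using eB by simp
    hence ele: "B * (real (Suc N) * e) \<le> e'" using e by (simp add: algebra_simps)
    have "\<exists>K. compact K \<and> K \<subseteq> A n \<and> measure R (A n - K) \<le> e" for n
      using inner_regular_borel_on[OF borel_Times_circle[OF \<Omega>(1)] Rs Rf _ e, of "A n"] A(1)[of n] Rs by metis
    then obtain C where C: "\<And>n. compact (C n)" "\<And>n. C n \<subseteq> A n" "\<And>n. measure R (A n - C n) \<le> e"
      by metis
    have AZ: "A n \<subseteq> ?Z" for n using sets.sets_into_space[OF A(1)[of n]] by simp
    have CN[measurable]: "C n \<in> sets ?N" for n
      using borel_compact[OF C(1)[of n]] order_trans[OF C(2)[of n] AZ[of n]] borel_Times_circle[OF \<Omega>(1)]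
      by (simp add: sets_restrict_space_iff)
    \<comment> \<open>bumps around different sets may overlap for small \<open>k\<close>; dividing keeps the total weight at most one\<close>
    define \<eta> where "\<eta> k n z = bump k (C n) z / max 1 (\<Sum>j\<le>N. bump k (C j) z)" for k n z
    define \<xi> where "\<xi> k z = (\<Sum>n\<le>N. \<eta> k n z *\<^sub>R ?F n z)" for k z
    have m0: "max 1 (\<Sum>j\<le>N. bump k (C j) z) > 0" for k z by simp
    have \<eta>0: "0 \<le> \<eta> k n z" for k n z unfolding \<eta>_def by (intro divide_nonneg_pos m0 bump_nonneg)
    have \<eta>1: "(\<Sum>n\<le>N. \<eta> k n z) \<le> 1" for k z
      unfolding \<eta>_def sum_divide_distrib[symmetric] using m0[of k z] by (simp add: divide_le_eq)
    have \<xi>B: "norm (\<xi> k z) \<le> B" if z: "z \<in> ?Z" for k z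
    proof -
      have "norm (\<xi> k z) \<le> (\<Sum>n\<le>N. norm (\<eta> k n z *\<^sub>R ?F n z))" unfolding \<xi>_def by (rule norm_sum)
      also have "\<dots> \<le> (\<Sum>n\<le>N. \<eta> k n z * B)"
        using \<eta>0 FB z by (intro sum_mono) (auto intro!: mult_left_mono)
      also have "\<dots> = (\<Sum>n\<le>N. \<eta> k n z) * B" by (rule sum_distrib_right[symmetric])
      also have "\<dots> \<le> 1 * B" by (intro mult_right_mono \<eta>1 B0)
      finally show ?thesis by simp
    qed
    have \<xi>K: "affine_minorant f (snd z \<bullet> fst (\<xi> k z)) (snd (\<xi> k z))" if z: "z \<in> ?Z" for k z
    proof -
      have sz: "snd z \<in> circle" using z by auto
      have "fst (\<xi> k z) = (\<Sum>n\<le>N. \<eta> k n z *\<^sub>R fst (?F n z))" "snd (\<xi> k z) = (\<Sum>n\<le>N. \<eta> k n z * snd (?F n z))"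
        unfolding \<xi>_def fst_sum snd_sum by simp_all
      moreover have "affine_minorant f (\<Sum>n\<le>N. \<eta> k n z * fst (q n)) (\<Sum>n\<le>N. \<eta> k n z * snd (snd (q n)))"
        by (rule affine_minorant_sum[where j=0]) (use q \<eta>0 \<eta>1 in auto)
      ultimately show ?thesis by (simp add: inner_sum_right inner_frame_section[OF sz])
    qed
    have \<xi>cont: "continuous_on ?Z (\<xi> k)" for k
      unfolding \<xi>_def \<eta>_def
      by (intro continuous_intros continuous_on_subset[OF continuous_on_bump subset_UNIV]) (simp add: max_def; linarith)
    have \<xi>m[measurable]: "\<xi> k \<in> borel_measurable ?N" for k
      unfolding measurable_cong_sets[OF sets_total_variation refl]
      by (rule borel_measurable_continuous_on_restrict[OF \<xi>cont])
    define C' where "C' = (\<Union>n\<le>N. C n)"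
    have C': "compact C'" unfolding C'_def by (intro compact_UN C(1)) simp
    have C'Z: "C' \<subseteq> ?Z" unfolding C'_def by (intro UN_least order_trans[OF C(2) AZ])
    obtain \<delta> Q where \<delta>: "\<delta> > 0" and Q: "compact Q" "Q \<subseteq> ?Z"
      "\<And>z y. z \<in> ?Z \<Longrightarrow> y \<in> C' \<Longrightarrow> dist z y \<le> \<delta> \<Longrightarrow> z \<in> Q"
      using compact_neighbourhood_in_cylinder[OF \<Omega> C' C'Z] by metis
    obtain k0 :: nat where k0: "1 \<le> real k0 * \<delta>" using \<delta> by (metis reals_Archimedean3 less_imp_le)
    have \<xi>c: "C0c ?Z (\<xi> k)" if k: "k \<ge> k0" for k
    proof -
      have "real k0 * \<delta> \<le> real k * \<delta>" using k \<delta> by (intro mult_right_mono) auto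
      hence kd: "1 \<le> real k * \<delta>" using k0 by linarith
      have "compact_support ?Z (\<xi> k)"
      proof (rule compact_supportI[OF Q(1,2)])
        fix z assume z: "z \<in> ?Z" "z \<notin> Q"
        have "bump k (C n) z = 0" if "n \<le> N" for n
        proof (rule ccontr)
          assume "bump k (C n) z \<noteq> 0"
          then obtain y where "y \<in> C n" "dist z y \<le> \<delta>" using bump_support[OF C(1) _ kd \<delta>] by metis
          moreover from this have "y \<in> C'" using that unfolding C'_def by blast
          ultimately show False using Q(3)[OF z(1), of y] z(2) by blast
        qed
        thus "\<xi> k z = 0" unfolding \<xi>_def \<eta>_def by simp
      qed
      thus ?thesis using \<xi>cont unfolding C0c_def by blast
    qed
    have le: "(\<integral>z. \<xi> k z \<bullet> ?g z \<partial>?N) \<le> S" if "k \<ge> k0" for k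
      using S[OF \<xi>c[OF that] \<xi>K] unfolding vector_integral_def by blast
    define \<zeta> where "\<zeta> z = (\<Sum>n\<le>N. indicator (C n) z *\<^sub>R ?F n z)" for z
    have disj: "(\<Sum>n\<le>N. indicator (C n) z :: real) \<le> 1" for z
    proof (cases "\<exists>n\<le>N. z \<in> C n")
      case True
      then obtain n where n: "n \<le> N" "z \<in> C n" by blast
      have "z \<notin> C j" if "j \<noteq> n" for j
        using disjoint_family_onD[OF A(2) UNIV_I UNIV_I that] C(2) n(2) by blast
      hence "(\<Sum>j\<le>N. indicator (C j) z :: real) = (\<Sum>j\<le>N. if j = n then 1 else 0)"
        using n by (intro sum.cong) (auto simp: indicator_def)
      thus ?thesis using n by simp
    next
      case False
      hence "(\<Sum>j\<le>N. indicator (C j) z :: real) = 0" by (intro sum.neutral) (auto simp: indicator_def)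
      thus ?thesis by simp
    qed
    have lim: "(\<lambda>k. \<xi> k z) \<longlonglongrightarrow> \<zeta> z" for z
    proof -
      have b: "(\<lambda>k. bump k (C n) z) \<longlonglongrightarrow> indicator (C n) z" for n
        by (rule bump_limit[OF compact_imp_closed[OF C(1)]])
      have "(\<lambda>k. \<eta> k n z) \<longlonglongrightarrow> indicator (C n) z / max 1 (\<Sum>j\<le>N. indicator (C j) z)" for n
        unfolding \<eta>_def by (intro tendsto_divide tendsto_max tendsto_sum tendsto_const b) (simp add: max_def; linarith)
      moreover have "max 1 (\<Sum>j\<le>N. indicator (C j) z :: real) = 1" using disj[of z] by simp
      ultimately have "(\<lambda>k. \<eta> k n z) \<longlonglongrightarrow> indicator (C n) z" for n by simp
      thus ?thesis unfolding \<xi>_def \<zeta>_def by (intro tendsto_sum tendsto_scaleR tendsto_const)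
    qed
    have dom: "integrable ?N (\<lambda>z. B * norm (?g z))" using gi by simp
    have bnd: "norm (x \<bullet> ?g z) \<le> B * norm (?g z)" if "norm x \<le> B" for x z
      using Cauchy_Schwarz_ineq2[of x "?g z"] mult_right_mono[OF that, of "norm (?g z)"] by simp
    have "(\<lambda>k. \<integral>z. \<xi> k z \<bullet> ?g z \<partial>?N) \<longlonglongrightarrow> (\<integral>z. \<zeta> z \<bullet> ?g z \<partial>?N)"
    proof (rule integral_dominated_convergence[OF _ _ dom])
      show "(\<lambda>z. \<zeta> z \<bullet> ?g z) \<in> borel_measurable ?N" unfolding \<zeta>_def by measurable
      show "AE z in ?N. (\<lambda>k. \<xi> k z \<bullet> ?g z) \<longlonglongrightarrow> \<zeta> z \<bullet> ?g z"
        by (intro AE_I2 tendsto_inner lim tendsto_const)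
      show "AE z in ?N. norm (\<xi> k z \<bullet> ?g z) \<le> B * norm (?g z)" for k
        by (intro AE_I2 bnd \<xi>B) (simp only: spN)
    qed measurable
    hence \<zeta>S: "(\<integral>z. \<zeta> z \<bullet> ?g z \<partial>?N) \<le> S"
      by (rule LIMSEQ_le_const2) (use le in blast)
    have iF: "integrable ?N (\<lambda>z. indicator X z * (?F n z \<bullet> ?g z))" if n: "n \<le> N" and X: "X \<in> sets ?N" for n X
    proof (rule Bochner_Integration.integrable_bound[OF dom])
      show "(\<lambda>z. indicator X z * (?F n z \<bullet> ?g z)) \<in> borel_measurable ?N" using X by measurable
      show "AE z in ?N. norm (indicator X z * (?F n z \<bullet> ?g z)) \<le> norm (B * norm (?g z))"
      proof (rule AE_I2)
        fix z assume "z \<in> space ?N"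
        hence "norm (?F n z \<bullet> ?g z) \<le> B * norm (?g z)" by (intro bnd FB[OF n]) (simp only: spN)
        thus "norm (indicator X z * (?F n z \<bullet> ?g z)) \<le> norm (B * norm (?g z))"
          using B0 by (cases "z \<in> X") auto
      qed
    qed
    have diff: "(\<integral>z. indicator (A n) z * (?F n z \<bullet> ?g z) \<partial>?N) \<le> (\<integral>z. indicator (C n) z * (?F n z \<bullet> ?g z) \<partial>?N) + B * e" if n: "n \<le> N" for n
    proof -
      have X: "A n - C n \<in> sets ?N" by measurable
      have "(\<integral>z. indicator (A n) z * (?F n z \<bullet> ?g z) \<partial>?N)
          = (\<integral>z. indicator (C n) z * (?F n z \<bullet> ?g z) + indicator (A n - C n) z * (?F n z \<bullet> ?g z) \<partial>?N)"
        using C(2)[of n] by (intro Bochner_Integration.integral_cong refl) (auto split: split_indicator)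
      also have "\<dots> = (\<integral>z. indicator (C n) z * (?F n z \<bullet> ?g z) \<partial>?N) + (\<integral>z. indicator (A n - C n) z * (?F n z \<bullet> ?g z) \<partial>?N)"
        by (rule Bochner_Integration.integral_add[OF iF[OF n CN] iF[OF n X]])
      also have "(\<integral>z. indicator (A n - C n) z * (?F n z \<bullet> ?g z) \<partial>?N) \<le> (\<integral>z. B * (indicator (A n - C n) z * norm (?g z)) \<partial>?N)"
      proof (rule integral_mono[OF iF[OF n X]])
        show "integrable ?N (\<lambda>z. B * (indicator (A n - C n) z * norm (?g z)))"
          using integrable_mult_indicator[OF X integrable_norm[OF gi]] by (intro integrable_mult_right) simp
        fix z assume "z \<in> space ?N"
        hence "z \<in> ?Z" by (simp only: spN)
        hence "\<bar>?F n z \<bullet> ?g z\<bar> \<le> B * norm (?g z)" using bnd[OF FB[OF n]] by simp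
        thus "indicator (A n - C n) z * (?F n z \<bullet> ?g z) \<le> B * (indicator (A n - C n) z * norm (?g z))"
          by (auto split: split_indicator)
      qed
      also have "(\<integral>z. B * (indicator (A n - C n) z * norm (?g z)) \<partial>?N) = B * measure R (A n - C n)"
        using Rm[OF X] by simp
      also have "\<dots> \<le> B * e" by (intro mult_left_mono C(3) B0)
      finally show ?thesis by simp
    qed
    have "?I = (\<Sum>n\<le>N. \<integral>z. indicator (A n) z * (?F n z \<bullet> ?g z) \<partial>?N)"
      by (rule Bochner_Integration.integral_sum) (simp add: iF[OF _ AN])
    also have "\<dots> \<le> (\<Sum>n\<le>N. (\<integral>z. indicator (C n) z * (?F n z \<bullet> ?g z) \<partial>?N) + B * e)"
      by (intro sum_mono diff) simp
    also have "\<dots> = (\<Sum>n\<le>N. \<integral>z. indicator (C n) z * (?F n z \<bullet> ?g z) \<partial>?N) + B * (real (Suc N) * e)"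
      by (simp add: sum.distrib algebra_simps)
    also have "(\<Sum>n\<le>N. \<integral>z. indicator (C n) z * (?F n z \<bullet> ?g z) \<partial>?N) = (\<integral>z. \<zeta> z \<bullet> ?g z \<partial>?N)"
      unfolding \<zeta>_def inner_sum_left inner_scaleR_left
      by (rule Bochner_Integration.integral_sum[symmetric]) (simp add: iF[OF _ CN])
    finally show ?thesis using \<zeta>S ele by linarith
  qed
  thus ?thesis by (rule field_le_epsilon)
qed

text \<open>Up to a null set \<open>h\<close> along the polar density is the increasing limit of maxima of finitely many
  pairings with continuous sections; each maximum is realised by a Borel choice of section.\<close>

lemma h_integral_le:
  fixes \<sigma> :: "((real^2) \<times> (real^2)) set \<Rightarrow> (real^2) \<times> real"
  assumes \<Omega>: "open \<Omega>" "\<Omega> \<noteq> {}" and cv: "convex_ext f" and lsc: "lower_semicont f" and pos: "\<And>t. f t > 0"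
    and v: "vector_measure (borel_on (\<Omega> \<times> circle)) \<sigma>"
    and S: "\<And>\<xi>. C0c (\<Omega> \<times> circle) \<xi> \<Longrightarrow>
        (\<And>z. z \<in> \<Omega> \<times> circle \<Longrightarrow> affine_minorant f (snd z \<bullet> fst (\<xi> z)) (snd (\<xi> z))) \<Longrightarrow>
        vector_integral (borel_on (\<Omega> \<times> circle)) \<sigma> \<xi> \<le> S"
  shows "h_integral \<Omega> f \<sigma> \<le> ennreal S"
proof -
  let ?Z = "\<Omega> \<times> circle"
  let ?N = "total_variation (borel_on ?Z) \<sigma>" and ?g = "polar_density (borel_on ?Z) \<sigma>"
  obtain q :: "nat \<Rightarrow> real \<times> real \<times> real" where q: "\<And>n. affine_minorant f (fst (q n)) (snd (snd (q n)))" "q 0 = 0"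
      "\<And>v p. v \<in> circle \<Longrightarrow> p \<noteq> 0 \<Longrightarrow> hfun f v p = (SUP n. ennreal (frame_section (q n) v \<bullet> p))"
    using hfun_eq_countable_SUP[OF cv lsc pos] by blast
  have gi: "integrable ?N ?g" by (rule integrable_polar_density[OF v])
  have [measurable]: "?g \<in> borel_measurable ?N" using gi by auto
  have [measurable]: "(\<lambda>z. frame_section (q n) (snd z)) \<in> borel_measurable ?N" for n
    unfolding measurable_cong_sets[OF sets_total_variation refl]
    by (intro borel_measurable_continuous_on_restrict continuous_intros)
  define V where "V n z = frame_section (q n) (snd z) \<bullet> ?g z" for n z
  have Vm[measurable]: "V n \<in> borel_measurable ?N" for n unfolding V_def by measurable
  have V0: "V 0 z = 0" for z by (simp add: V_def q(2) frame_section_def inner_prod_def)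
  \<comment> \<open>the index at which the maximum over the first sections is attained\<close>
  define best where "best = rec_nat (\<lambda>z. 0) (\<lambda>n b z. if V (b z) z < V (Suc n) z then Suc n else b z)"
  have best_0: "best 0 = (\<lambda>z. 0)" and best_Suc: "best (Suc n) = (\<lambda>z. if V (best n z) z < V (Suc n) z then Suc n else best n z)" for n
    unfolding best_def by simp_all
  have best_le: "best n z \<le> n" for n z by (induction n) (auto simp: best_0 best_Suc)
  have best_ge: "V k z \<le> V (best n z) z" if "k \<le> n" for k n z
    using that by (induction n) (auto simp: best_0 best_Suc le_Suc_eq)
  have bm[measurable]: "best n \<in> measurable ?N (count_space UNIV)" for n
  proof (induction n)
    case (Suc n)
    have [measurable]: "best n \<in> measurable ?N (count_space UNIV)" by (rule Suc)
    have [measurable]: "(\<lambda>z. V (best n z) z) \<in> borel_measurable ?N"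
      by (rule measurable_compose_countable[where f="\<lambda>i z. V i z"]) measurable
    show ?case unfolding best_Suc by measurable
  qed (simp add: best_0)
  define m where "m n z = V (best n z) z" for n z
  have mm[measurable]: "m n \<in> borel_measurable ?N" for n
    unfolding m_def by (rule measurable_compose_countable[where f="\<lambda>i z. V i z"]) measurable
  have m0: "0 \<le> m n z" for n z using best_ge[of 0 n z] V0[of z] by (simp add: m_def)
  have m_sup: "(SUP n. ennreal (m n z)) = (SUP n. ennreal (V n z))" for z
  proof (rule antisym)
    show "(SUP n. ennreal (m n z)) \<le> (SUP n. ennreal (V n z))"
      unfolding m_def by (intro SUP_least) (rule SUP_upper[OF UNIV_I])
    show "(SUP n. ennreal (V n z)) \<le> (SUP n. ennreal (m n z))"
      by (intro SUP_mono) (use best_ge m_def ennreal_leI in \<open>metis order_refl UNIV_I\<close>)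
  qed
  have inc: "incseq (\<lambda>n z. ennreal (m n z))"
  proof (rule incseq_SucI, rule le_funI)
    fix n z
    have "V (best n z) z \<le> V (best (Suc n) z) z" using best_ge[of "best n z" "Suc n" z] best_le[of n z] by simp
    thus "ennreal (m n z) \<le> ennreal (m (Suc n) z)" unfolding m_def by (rule ennreal_leI)
  qed
  have step: "(\<integral>\<^sup>+z. ennreal (m N z) \<partial>?N) \<le> ennreal S" for N
  proof -
    define A where "A n = {z \<in> space ?N. best N z = n}" for n
    have "A n \<in> sets ?N" for n unfolding A_def by measurable
    hence A: "A n \<in> sets (borel_on ?Z)" for n by simp
    have disj: "disjoint_family A" by (auto simp: disjoint_family_on_def A_def)
    have mA: "m N z = (\<Sum>n\<le>N. indicator (A n) z * V n z)" if z: "z \<in> space ?N" for z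
    proof -
      have "(\<Sum>n\<le>N. indicator (A n) z * V n z) = (\<Sum>n\<le>N. if n = best N z then V n z else 0)"
        using z by (intro sum.cong) (auto simp: A_def indicator_def)
      thus ?thesis using best_le[of N z] by (simp add: m_def)
    qed
    have int: "integrable ?N (V n)" for n
    proof -
      define r where "r = \<bar>fst (q n)\<bar> + \<bar>fst (snd (q n))\<bar> + \<bar>snd (snd (q n))\<bar>"
      show ?thesis
      proof (rule Bochner_Integration.integrable_bound[OF integrable_mult_right[OF integrable_norm[OF gi], of r] Vm], rule AE_I2)
        fix z assume "z \<in> space ?N"
        hence "norm (frame_section (q n) (snd z)) \<le> r" unfolding r_def by (intro norm_frame_section_le) auto
        hence "norm (frame_section (q n) (snd z)) * norm (?g z) \<le> r * norm (?g z)" by (intro mult_right_mono) auto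
        moreover have "r \<ge> 0" by (simp add: r_def)
        ultimately show "norm (V n z) \<le> norm (r * norm (?g z))"
          unfolding V_def using Cauchy_Schwarz_ineq2[of "frame_section (q n) (snd z)" "?g z"] by simp
      qed
    qed
    have "integrable ?N (\<lambda>z. \<Sum>n\<le>N. indicator (A n) z *\<^sub>R V n z)"
      using A int by (intro Bochner_Integration.integrable_sum integrable_mult_indicator) auto
    hence mi: "integrable ?N (m N)"
      by (rule Bochner_Integration.integrable_cong[OF refl, THEN iffD1, rotated]) (simp add: mA)
    have "(\<integral>z. m N z \<partial>?N) = (\<integral>z. (\<Sum>n\<le>N. indicator (A n) z * (frame_section (q n) (snd z) \<bullet> ?g z)) \<partial>?N)"
      by (intro Bochner_Integration.integral_cong refl) (simp add: mA V_def)
    also have "\<dots> \<le> S" by (rule integral_selection_le[where f=f and S=S and q=q and A=A, OF \<Omega> v q(1,2) _ A disj]) (rule S)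
    finally have "ennreal (\<integral>z. m N z \<partial>?N) \<le> ennreal S" by (rule ennreal_leI)
    thus ?thesis using nn_integral_eq_integral[OF mi] m0 by simp
  qed
  have "h_integral \<Omega> f \<sigma> = (\<integral>\<^sup>+z. (SUP n. ennreal (m n z)) \<partial>?N)"
    unfolding h_integral_def
  proof (rule nn_integral_cong_AE)
    show "AE z in ?N. hfun f (snd z) (?g z) = (SUP n. ennreal (m n z))"
      using polar_density_nonzero[OF v] AE_space
    proof eventually_elim
      case (elim z)
      have "snd z \<in> circle" using elim(2) by auto
      thus ?case unfolding m_sup V_def by (rule q(3)[OF _ elim(1)])
    qed
  qed
  also have "\<dots> = (SUP n. \<integral>\<^sup>+z. ennreal (m n z) \<partial>?N)"
    by (rule nn_integral_monotone_convergence_SUP[OF inc]) measurable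
  also have "\<dots> \<le> ennreal S" by (intro SUP_least step)
  finally show ?thesis .
qed

section \<open>Vector-valued Riesz representation\<close>

text \<open>The scalar theorem is applied to each component of the functional.\<close>

theorem Riesz_representation_vector:
  fixes Z :: "'a::metric_space set" and L :: "('a \<Rightarrow> 'b::euclidean_space) \<Rightarrow> real"
  assumes add: "\<And>\<xi> \<zeta>. C0c Z \<xi> \<Longrightarrow> C0c Z \<zeta> \<Longrightarrow> L (\<lambda>z. \<xi> z + \<zeta> z) = L \<xi> + L \<zeta>"
    and scale: "\<And>\<xi> c. C0c Z \<xi> \<Longrightarrow> L (\<lambda>z. c *\<^sub>R \<xi> z) = c * L \<xi>"
    and bound: "\<And>\<xi> B. C0c Z \<xi> \<Longrightarrow> 0 \<le> B \<Longrightarrow> (\<And>z. z \<in> Z \<Longrightarrow> norm (\<xi> z) \<le> B) \<Longrightarrow> \<bar>L \<xi>\<bar> \<le> C * B"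
  obtains \<sigma> where "vector_measure (borel_on Z) \<sigma>"
    "\<And>\<xi>. C0c Z \<xi> \<Longrightarrow> vector_integral (borel_on Z) \<sigma> \<xi> = L \<xi>"
proof -
  have c0: "C0c Z (\<lambda>z. s z *\<^sub>R b)" if "C0c Z s" for s and b :: 'b
    by (rule C0c_linear_image[OF bounded_linear_scaleR_left that])
  have "\<exists>M1 M2. finite_measure M1 \<and> finite_measure M2 \<and> sets M1 = sets (borel_on Z) \<and> sets M2 = sets (borel_on Z) \<and>
      (\<forall>s. C0c Z s \<longrightarrow> L (\<lambda>z. s z *\<^sub>R b) = (\<integral>z. s z \<partial>M1) - (\<integral>z. s z \<partial>M2))" for b :: 'b
  proof -
    obtain M1 M2 where "finite_measure M1" "finite_measure M2" "sets M1 = sets (borel_on Z)" "sets M2 = sets (borel_on Z)"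
      "\<And>s. C0c Z s \<Longrightarrow> L (\<lambda>z. s z *\<^sub>R b) = (\<integral>z. s z \<partial>M1) - (\<integral>z. s z \<partial>M2)"
    proof (rule Riesz_representation_C0c[where Z=Z and L="\<lambda>s. L (\<lambda>z. s z *\<^sub>R b)" and C="C * norm b"])
      fix f g :: "'a \<Rightarrow> real" assume "C0c Z f" "C0c Z g"
      thus "L (\<lambda>z. (f z + g z) *\<^sub>R b) = L (\<lambda>z. f z *\<^sub>R b) + L (\<lambda>z. g z *\<^sub>R b)"
        unfolding scaleR_add_left by (intro add c0)
    next
      fix f :: "'a \<Rightarrow> real" and c assume "C0c Z f"
      thus "L (\<lambda>z. (c * f z) *\<^sub>R b) = c * L (\<lambda>z. f z *\<^sub>R b)"
        unfolding scaleR_scaleR[symmetric] by (intro scale c0)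
    next
      fix f :: "'a \<Rightarrow> real" and B :: real assume f: "C0c Z f" "0 \<le> B" "\<And>z. z \<in> Z \<Longrightarrow> \<bar>f z\<bar> \<le> B"
      have "\<bar>L (\<lambda>z. f z *\<^sub>R b)\<bar> \<le> C * (norm b * B)"
      proof (rule bound[OF c0[OF f(1)]])
        show "0 \<le> norm b * B" using f(2) by simp
        show "norm (f z *\<^sub>R b) \<le> norm b * B" if "z \<in> Z" for z
          using mult_left_mono[OF f(3)[OF that], of "norm b"] by (simp add: mult.commute)
      qed
      thus "\<bar>L (\<lambda>z. f z *\<^sub>R b)\<bar> \<le> C * norm b * B" by (simp add: mult.assoc)
    qed blast
    thus ?thesis by blast
  qed
  then obtain M1 M2 where M: "\<And>b. finite_measure (M1 b)" "\<And>b. finite_measure (M2 b)"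
    "\<And>b. sets (M1 b) = sets (borel_on Z)" "\<And>b. sets (M2 b) = sets (borel_on Z)"
    "\<And>b s. C0c Z s \<Longrightarrow> L (\<lambda>z. s z *\<^sub>R b) = (\<integral>z. s z \<partial>M1 b) - (\<integral>z. s z \<partial>M2 b)"
    by metis
  define \<sigma> where "\<sigma> A = (\<Sum>b\<in>Basis. (measure (M1 b) A - measure (M2 b) A) *\<^sub>R b)" for A
  have v: "vector_measure (borel_on Z) \<sigma>"
    unfolding vector_measure_def \<sigma>_def
  proof (intro allI impI)
    fix A :: "nat \<Rightarrow> 'a set" assume A: "range A \<subseteq> sets (borel_on Z)" "disjoint_family A"
    have "(\<lambda>n. measure (M1 b) (A n)) sums measure (M1 b) (\<Union>n. A n)"
      "(\<lambda>n. measure (M2 b) (A n)) sums measure (M2 b) (\<Union>n. A n)" for b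
      using A M(3,4) finite_measure.finite_measure_UNION[OF M(1)] finite_measure.finite_measure_UNION[OF M(2)]
      by metis+
    thus "(\<lambda>n. \<Sum>b\<in>Basis. (measure (M1 b) (A n) - measure (M2 b) (A n)) *\<^sub>R b) sums
        (\<Sum>b\<in>Basis. (measure (M1 b) (\<Union>n. A n) - measure (M2 b) (\<Union>n. A n)) *\<^sub>R b)"
      by (intro sums_sum bounded_linear.sums[OF bounded_linear_scaleR_left] sums_diff)
  qed
  have comp: "\<sigma> A \<bullet> b = measure (M1 b) A - measure (M2 b) A" if "b \<in> Basis" for A b
    unfolding \<sigma>_def by (rule inner_sum_left_Basis[OF that])
  have int: "integrable (M1 b) s" "integrable (M2 b) s" "\<bar>(\<integral>z. s z \<partial>M1 b)\<bar> \<le> measure (M1 b) Z * B" "\<bar>(\<integral>z. s z \<partial>M2 b)\<bar> \<le> measure (M2 b) Z * B"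
    if s: "s \<in> borel_measurable (borel_on Z)" "\<And>x. x \<in> Z \<Longrightarrow> \<bar>s x\<bar> \<le> B" for s :: "'a \<Rightarrow> real" and b and B :: real
  proof -
    have gen: "integrable N s \<and> \<bar>(\<integral>z. s z \<partial>N)\<bar> \<le> measure N Z * B"
      if N: "finite_measure N" "sets N = sets (borel_on Z)" for N :: "'a measure"
    proof -
      interpret N: finite_measure N by (rule N)
      have sp: "space N = Z" using sets_eq_imp_space_eq[OF N(2)] by simp
      have sN: "s \<in> borel_measurable N" using s(1) unfolding measurable_cong_sets[OF N(2) refl] .
      have one: "integrable N (\<lambda>x. 1 :: real)" by (rule N.integrable_const)
      show ?thesis
        using bounded_measurable_mult_integrable[OF one sN, of B] s(2) sp by simp
    qed
    show "integrable (M1 b) s" "integrable (M2 b) s" "\<bar>(\<integral>z. s z \<partial>M1 b)\<bar> \<le> measure (M1 b) Z * B" "\<bar>(\<integral>z. s z \<partial>M2 b)\<bar> \<le> measure (M2 b) Z * B"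
      using gen[OF M(1)[of b] M(3)[of b]] gen[OF M(2)[of b] M(4)[of b]] by simp_all
  qed
  have int': "integrable (M1 b) s" "integrable (M2 b) s" if bs: "bounded_measurable (borel_on Z) s" for s :: "'a \<Rightarrow> real" and b
  proof -
    obtain B where B: "s \<in> borel_measurable (borel_on Z)" "\<And>x. x \<in> Z \<Longrightarrow> \<bar>s x\<bar> \<le> B"
      using bs unfolding bounded_measurable_def by auto
    show "integrable (M1 b) s" by (rule int(1)[OF B(1), of B]) (rule B(2))
    show "integrable (M2 b) s" by (rule int(2)[OF B(1), of B]) (rule B(2))
  qed
  have J: "(\<integral>z. s z * (polar_density (borel_on Z) \<sigma> z \<bullet> b) \<partial>total_variation (borel_on Z) \<sigma>) = (\<integral>z. s z \<partial>M1 b) - (\<integral>z. s z \<partial>M2 b)"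
    if b: "b \<in> Basis" and s: "bounded_measurable (borel_on Z) s" for b s
  proof (rule component_integral_unique[OF v b, where s=s and J="\<lambda>s. (\<integral>z. s z \<partial>M1 b) - (\<integral>z. s z \<partial>M2 b)" and C="measure (M1 b) Z + measure (M2 b) Z"])
    fix s t :: "'a \<Rightarrow> real" assume st: "bounded_measurable (borel_on Z) s" "bounded_measurable (borel_on Z) t"
    show "(\<integral>z. s z + t z \<partial>M1 b) - (\<integral>z. s z + t z \<partial>M2 b) = (\<integral>z. s z \<partial>M1 b) - (\<integral>z. s z \<partial>M2 b) + ((\<integral>z. t z \<partial>M1 b) - (\<integral>z. t z \<partial>M2 b))"
      using int'[OF st(1)] int'[OF st(2)] by (simp add: Bochner_Integration.integral_add)
  next
    fix s :: "'a \<Rightarrow> real" and c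
    show "(\<integral>z. c * s z \<partial>M1 b) - (\<integral>z. c * s z \<partial>M2 b) = c * ((\<integral>z. s z \<partial>M1 b) - (\<integral>z. s z \<partial>M2 b))"
      by (simp add: right_diff_distrib)
  next
    fix s :: "'a \<Rightarrow> real" and B :: real
    assume s: "s \<in> borel_measurable (borel_on Z)" "0 \<le> B" "\<And>x. x \<in> space (borel_on Z) \<Longrightarrow> \<bar>s x\<bar> \<le> B"
    hence "\<And>x. x \<in> Z \<Longrightarrow> \<bar>s x\<bar> \<le> B" by simp
    from int(3,4)[OF s(1) this, of b]
    show "\<bar>(\<integral>z. s z \<partial>M1 b) - (\<integral>z. s z \<partial>M2 b)\<bar> \<le> (measure (M1 b) Z + measure (M2 b) Z) * B"
      unfolding distrib_right by linarith
  next
    fix A assume A: "A \<in> sets (borel_on Z)"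
    have "(\<integral>z. indicator A z \<partial>N) = measure N A" if "sets N = sets (borel_on Z)" for N :: "'a measure"
    proof -
      have "A \<inter> space N = A" using sets.sets_into_space[of A N] A that by auto
      thus ?thesis by simp
    qed
    thus "(\<integral>z. indicator A z \<partial>M1 b) - (\<integral>z. indicator A z \<partial>M2 b) = \<sigma> A \<bullet> b"
      using M(3,4) comp[OF b] by metis
  qed (rule s)
  have L_sum: "C0c Z (\<lambda>z. \<Sum>b\<in>I. \<xi> b z) \<and> L (\<lambda>z. \<Sum>b\<in>I. \<xi> b z) = (\<Sum>b\<in>I. L (\<xi> b))" if "finite I" "\<And>b. b \<in> I \<Longrightarrow> C0c Z (\<xi> b)" for I :: "'b set" and \<xi>
    using that
  proof (induction I rule: finite_induct)
    case empty
    have "L (\<lambda>z. 0) = 0" using scale[OF C0c_zero, of 0] by simp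
    thus ?case by (simp add: C0c_zero)
  next
    case (insert b I)
    have b: "C0c Z (\<xi> b)" and I: "C0c Z (\<lambda>z. \<Sum>b\<in>I. \<xi> b z)" "L (\<lambda>z. \<Sum>b\<in>I. \<xi> b z) = (\<Sum>b\<in>I. L (\<xi> b))"
      using insert by auto
    show ?case unfolding sum.insert[OF insert.hyps] using C0c_add[OF b I(1)] add[OF b I(1)] I(2) by simp
  qed
  show ?thesis
  proof (rule that[OF v])
    fix \<xi> :: "'a \<Rightarrow> 'b" assume \<xi>: "C0c Z \<xi>"
    have \<xi>b: "C0c Z (\<lambda>z. \<xi> z \<bullet> b)" for b by (rule C0c_linear_image[OF bounded_linear_inner_left \<xi>])
    have "vector_integral (borel_on Z) \<sigma> \<xi> = (\<Sum>b\<in>Basis. L (\<lambda>z. (\<xi> z \<bullet> b) *\<^sub>R b))"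
      unfolding vector_integral_components(1)[OF v C0c_bounded_measurable[OF \<xi>]]
    proof (rule sum.cong[OF refl])
      fix b :: 'b assume b: "b \<in> Basis"
      show "(\<integral>z. (\<xi> z \<bullet> b) * (polar_density (borel_on Z) \<sigma> z \<bullet> b) \<partial>total_variation (borel_on Z) \<sigma>) = L (\<lambda>z. (\<xi> z \<bullet> b) *\<^sub>R b)"
        unfolding J[OF b C0c_bounded_measurable[OF \<xi>b]] by (rule M(5)[OF \<xi>b, symmetric])
    qed
    also have "\<dots> = L (\<lambda>z. \<Sum>b\<in>Basis. (\<xi> z \<bullet> b) *\<^sub>R b)"
      using L_sum[of Basis "\<lambda>b z. (\<xi> z \<bullet> b) *\<^sub>R b"] c0[OF \<xi>b] by auto
    also have "(\<lambda>z. \<Sum>b\<in>Basis. (\<xi> z \<bullet> b) *\<^sub>R b) = \<xi>" by (rule ext) (rule euclidean_representation)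
    finally show "vector_integral (borel_on Z) \<sigma> \<xi> = L \<xi>" .
  qed
qed

section \<open>Minkowski gauges\<close>

definition gauge_of :: "'v::real_vector set \<Rightarrow> 'v \<Rightarrow> real" where
  "gauge_of K x = Inf {t. 0 < t \<and> (1 / t) *\<^sub>R x \<in> K}"

lemma gauge_of_le: "0 < t \<Longrightarrow> (1 / t) *\<^sub>R x \<in> K \<Longrightarrow> gauge_of K x \<le> t"
  unfolding gauge_of_def by (rule cInf_lower) (auto intro: bdd_belowI[of _ 0])

lemma gauge_of_ge:
  assumes "0 < t0" "(1 / t0) *\<^sub>R x \<in> K" "\<And>t. 0 < t \<Longrightarrow> (1 / t) *\<^sub>R x \<in> K \<Longrightarrow> y \<le> t"
  shows "y \<le> gauge_of K x"
  unfolding gauge_of_def by (rule cInf_greatest) (use assms in auto)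

lemma gauge_of_add:
  assumes K: "convex K" and x: "0 < s0" "(1 / s0) *\<^sub>R x \<in> K" and y: "0 < t0" "(1 / t0) *\<^sub>R y \<in> K"
  shows "gauge_of K (x + y) \<le> gauge_of K x + gauge_of K y"
proof -
  have "gauge_of K (x + y) \<le> s + t" if s: "0 < s" "(1 / s) *\<^sub>R x \<in> K" and t: "0 < t" "(1 / t) *\<^sub>R y \<in> K" for s t
  proof (rule gauge_of_le)
    have "(s / (s + t)) *\<^sub>R ((1 / s) *\<^sub>R x) + (t / (s + t)) *\<^sub>R ((1 / t) *\<^sub>R y) \<in> K"
      using s t by (intro convexD[OF K]) (auto simp: add_divide_distrib[symmetric])
    thus "(1 / (s + t)) *\<^sub>R (x + y) \<in> K" using s t by (simp add: scaleR_add_right)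
  qed (use s t in simp)
  note sum = this
  have "gauge_of K (x + y) - s \<le> gauge_of K y" if s: "0 < s" "(1 / s) *\<^sub>R x \<in> K" for s
  proof (rule gauge_of_ge[OF y])
    fix t assume "0 < t" "(1 / t) *\<^sub>R y \<in> K"
    hence "gauge_of K (x + y) \<le> s + t" by (rule sum[OF s])
    thus "gauge_of K (x + y) - s \<le> t" by simp
  qed
  hence "gauge_of K (x + y) - gauge_of K y \<le> gauge_of K x"
    by (intro gauge_of_ge[OF x]) (simp add: algebra_simps)
  thus ?thesis by simp
qed

text \<open>The scaled point inherits admissible factors from \<open>x\<close> and conversely; for \<open>c = 0\<close> every positive
  factor is admissible, as \<open>0 \<in> K\<close>.\<close>

lemma gauge_of_scale:
  assumes K0: "0 \<in> K" and x: "0 < t0" "(1 / t0) *\<^sub>R x \<in> K" and c: "0 \<le> c"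
  shows "gauge_of K (c *\<^sub>R x) = c * gauge_of K x"
proof (cases "c = 0")
  case True
  have "gauge_of K 0 \<le> 0 + e" if "e > 0" for e
    unfolding add_0_left by (rule gauge_of_le[OF that]) (simp add: K0)
  hence "gauge_of K 0 \<le> 0" by (rule field_le_epsilon)
  moreover have "0 \<le> gauge_of K 0" by (rule gauge_of_ge[of 1]) (simp_all add: K0)
  ultimately show ?thesis using True by simp
next
  case False
  hence c: "c > 0" using c by simp
  show ?thesis
  proof (rule antisym)
    have "gauge_of K (c *\<^sub>R x) / c \<le> gauge_of K x"
    proof (rule gauge_of_ge[OF x])
      fix t assume "0 < t" "(1 / t) *\<^sub>R x \<in> K"
      hence "gauge_of K (c *\<^sub>R x) \<le> c * t" using c by (intro gauge_of_le) auto
      thus "gauge_of K (c *\<^sub>R x) / c \<le> t" using c by (simp add: pos_divide_le_eq mult.commute)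
    qed
    thus "gauge_of K (c *\<^sub>R x) \<le> c * gauge_of K x" using c by (simp add: pos_divide_le_eq mult.commute)
    show "c * gauge_of K x \<le> gauge_of K (c *\<^sub>R x)"
    proof (rule gauge_of_ge[of "c * t0"])
      show "0 < c * t0" "(1 / (c * t0)) *\<^sub>R (c *\<^sub>R x) \<in> K" using c x by auto
      fix t assume t: "0 < t" "(1 / t) *\<^sub>R (c *\<^sub>R x) \<in> K"
      have "gauge_of K x \<le> t / c" using t c by (intro gauge_of_le) (auto simp: mult.commute)
      thus "c * gauge_of K x \<le> t" using c by (simp add: pos_le_divide_eq mult.commute)
    qed
  qed
qed

section \<open>The infimum is at most the supremum\<close>

text \<open>Cauchy-Schwarz against the vector \<open>(v, t)\<close>, of norm \<open>sqrt (1 + t\<^sup>2)\<close>: growth of \<open>f\<close> puts a ball of radius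
  \<open>\<gamma>\<close> inside the constraint set.\<close>

lemma small_is_affine_minorant:
  assumes f: "\<And>t. f t \<ge> ennreal (\<gamma> * sqrt (1 + t\<^sup>2))" and v: "v \<in> circle" and \<xi>: "norm \<xi> \<le> \<gamma>"
  shows "affine_minorant f (v \<bullet> fst \<xi>) (snd \<xi>)"
  unfolding affine_minorant_def
proof
  fix t
  have "v \<bullet> fst \<xi> + snd \<xi> * t = \<xi> \<bullet> (v, t)" by (simp add: inner_prod_def inner_commute)
  also have "\<dots> \<le> norm \<xi> * norm (v, t)" by (rule norm_cauchy_schwarz)
  also have "norm (v, t) = sqrt (1 + t\<^sup>2)" using v by (simp add: norm_Pair)
  also have "norm \<xi> * sqrt (1 + t\<^sup>2) \<le> \<gamma> * sqrt (1 + t\<^sup>2)" using \<xi> by (intro mult_right_mono) auto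
  finally show "ennreal (v \<bullet> fst \<xi> + snd \<xi> * t) \<le> f t" by (rule order_trans[OF ennreal_leI f])
qed

lemma C1c_cyl_add:
  assumes "C1c_cyl \<Omega> \<phi>" "C1c_cyl \<Omega> \<psi>"
  shows "C1c_cyl \<Omega> (\<lambda>z. \<phi> z + \<psi> z)"
  using assms cyl_gradient_add(1) compact_support_add unfolding C1c_cyl_def by blast

lemma C1c_cyl_scale:
  assumes "C1c_cyl \<Omega> \<phi>"
  shows "C1c_cyl \<Omega> (\<lambda>z. c * \<phi> z)"
  unfolding C1c_cyl_def
proof
  show "C1_cyl \<Omega> (\<lambda>z. c * \<phi> z)" using assms unfolding C1c_cyl_def by (intro cyl_gradient_scale(1)) blast
  show "compact_support (\<Omega> \<times> circle) (\<lambda>z. c * \<phi> z)"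
    by (rule compact_support_mono[of _ \<phi>]) (use assms in \<open>auto simp: C1c_cyl_def\<close>)
qed

lemma zero_cyl:
  shows "C1c_cyl \<Omega> (\<lambda>z. 0)" "cyl_gradient (\<lambda>z. 0) (x, v) = 0"
proof -
  have l: "lift (\<lambda>z. 0) = (\<lambda>z. 0)" by (rule ext) (simp add: lift_def case_prod_beta)
  have d: "frechet_derivative (\<lambda>z :: (real^2) \<times> real. 0 :: real) (at z) = (\<lambda>k. 0)" for z
    by (rule frechet_derivative_at[symmetric]) (rule has_derivative_const)
  have "C1_cyl \<Omega> (\<lambda>z. 0)" unfolding C1_cyl_def l C1_def d by simp
  thus "C1c_cyl \<Omega> (\<lambda>z. 0)" unfolding C1c_cyl_def by (simp add: compact_support_def)
  show "cyl_gradient (\<lambda>z. 0) (x, v) = 0" unfolding cyl_gradient_eq l gradient_def d by simp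
qed

lemma zero_dual_constraint:
  assumes "\<gamma> > 0" and f: "\<And>t. f t \<ge> ennreal (\<gamma> * sqrt (1 + t\<^sup>2))"
  shows "dual_constraint \<Omega> f (\<lambda>x. 0) (\<lambda>z. 0)"
  unfolding dual_constraint_iff
proof (intro ballI)
  fix x v :: "real^2" assume "x \<in> \<Omega>" "v \<in> circle"
  thus "affine_minorant f (v \<bullet> fst ((0, 0) + cyl_gradient (\<lambda>z. 0) (x, v))) (snd ((0, 0) + cyl_gradient (\<lambda>z. 0) (x, v)))"
    using assms(1) by (intro small_is_affine_minorant[OF f]) (auto simp: zero_cyl(2) zero_prod_def[symmetric])
qed

text \<open>Hahn-Banach is applied to the graph of \<open>(\<psi>, 0) + \<nabla>\<phi> \<mapsto> \<integral> \<psi> \<cdot> Du\<^sup>\<bottom>\<close> with the sublinear bound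
  \<open>S\<close> times the gauge of the constraint set. If \<open>((\<psi>, 0) + \<nabla>\<phi>) / t\<close> lies in the constraint set, then
  \<open>\<psi> / t\<close> is admissible and so \<open>\<integral> \<psi> \<cdot> Du\<^sup>\<bottom> \<le> t S\<close>: this is the domination. In particular it implies
  that the assignment is well defined.\<close>

lemma strong_duality:
  fixes S :: real
  assumes \<Omega>: "open \<Omega>" "\<Omega> \<noteq> {}" and cv: "convex_ext f" and lsc: "lower_semicont f"
    and \<gamma>: "\<gamma> > 0" and f: "\<And>t. f t \<ge> ennreal (\<gamma> * sqrt (1 + t\<^sup>2))" and u: "u \<in> BV \<Omega>"
    and S: "\<And>\<psi> \<phi>. C0c \<Omega> \<psi> \<Longrightarrow> C1c_cyl \<Omega> \<phi> \<Longrightarrow> dual_constraint \<Omega> f \<psi> \<phi> \<Longrightarrow>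
      vector_integral (borel_on \<Omega>) (BV_deriv_perp \<Omega> u) \<psi> \<le> S"
  shows "F \<Omega> f u \<le> ennreal S"
proof -
  let ?Z = "\<Omega> \<times> circle"
  let ?I = "vector_integral (borel_on \<Omega>) (BV_deriv_perp \<Omega> u)"
  note vD = vector_measure_BV_deriv_perp[OF u]
  have pos: "f t > 0" for t
  proof -
    have "0 < \<gamma> * sqrt (1 + t\<^sup>2)" using \<gamma> by (simp add: add_pos_nonneg)
    thus ?thesis using f[of t] by (metis ennreal_less_zero_iff less_le_trans)
  qed
  define X where "X = {\<xi> :: (real^2) \<times> (real^2) \<Rightarrow> (real^2) \<times> real. C0c ?Z \<xi>}"
  have X: "subspace X"
    unfolding subspace_def X_def
    by (auto simp: plus_fun_def zero_fun_def scaleR_fun_def intro: C0c_zero C0c_add C0c_scaleR)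
  define K where "K = {\<xi>. \<forall>z\<in>?Z. affine_minorant f (snd z \<bullet> fst (\<xi> z)) (snd (\<xi> z :: (real^2) \<times> real))}"
  have K: "convex K"
    unfolding convex_def
  proof (intro ballI allI impI)
    fix \<xi> \<zeta> and a b :: real assume *: "\<xi> \<in> K" "\<zeta> \<in> K" "0 \<le> a" "0 \<le> b" "a + b = 1"
    show "a *\<^sub>R \<xi> + b *\<^sub>R \<zeta> \<in> K"
      unfolding K_def
    proof (intro CollectI ballI)
      fix z :: "(real^2) \<times> (real^2)" assume "z \<in> ?Z"
      hence "affine_minorant f (snd z \<bullet> fst (\<xi> z)) (snd (\<xi> z))" "affine_minorant f (snd z \<bullet> fst (\<zeta> z)) (snd (\<zeta> z))"
        using *(1,2) unfolding K_def by auto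
      from affine_minorant_convex[OF this *(3-5)]
      show "affine_minorant f (snd z \<bullet> fst ((a *\<^sub>R \<xi> + b *\<^sub>R \<zeta>) z)) (snd ((a *\<^sub>R \<xi> + b *\<^sub>R \<zeta>) z))"
        by (simp add: plus_fun_def scaleR_fun_def inner_add_right)
    qed
  qed
  have absorb: "(1 / t) *\<^sub>R \<xi> \<in> K" if "t > 0" "\<And>z. z \<in> ?Z \<Longrightarrow> norm (\<xi> z) \<le> \<gamma> * t" for \<xi> t
    unfolding K_def
  proof (intro CollectI ballI)
    fix z :: "(real^2) \<times> (real^2)" assume z: "z \<in> ?Z"
    have "norm (((1 / t) *\<^sub>R \<xi>) z) \<le> \<gamma>" using that(1) that(2)[OF z] by (simp add: scaleR_fun_def pos_divide_le_eq)
    thus "affine_minorant f (snd z \<bullet> fst (((1 / t) *\<^sub>R \<xi>) z)) (snd (((1 / t) *\<^sub>R \<xi>) z))"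
      using z by (intro small_is_affine_minorant[OF f]) auto
  qed
  have K0: "0 \<in> K" using absorb[of 1 0] \<gamma> by (simp add: zero_fun_def)
  have absorb': "\<exists>t>0. (1 / t) *\<^sub>R \<xi> \<in> K" if X: "\<xi> \<in> X" for \<xi>
  proof -
    have "C0c ?Z \<xi>" using X by (simp add: X_def)
    then obtain B where B: "B > 0" "\<And>z. z \<in> ?Z \<Longrightarrow> norm (\<xi> z) \<le> B" using C0c_bounded by metis
    have "(1 / (B / \<gamma>)) *\<^sub>R \<xi> \<in> K" using B \<gamma> by (intro absorb) auto
    thus ?thesis using B \<gamma> by (intro exI[of _ "B / \<gamma>"]) auto
  qed
  have S0: "0 \<le> S"
  proof -
    have "?I (\<lambda>x. 0) \<le> S" by (rule S[OF C0c_zero zero_cyl(1) zero_dual_constraint[OF \<gamma> f]])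
    thus ?thesis by (simp add: vector_integral_def)
  qed
  define p where "p \<xi> = S * gauge_of K \<xi>" for \<xi>
  define G0 where "G0 = {(\<xi>, r). \<exists>\<psi> \<phi>. C0c \<Omega> \<psi> \<and> C1c_cyl \<Omega> \<phi> \<and> \<xi> \<in> X \<and>
      (\<forall>z\<in>?Z. \<xi> z = (\<psi> (fst z), 0) + cyl_gradient \<phi> z) \<and> r = ?I \<psi>}"
  have G0I: "(\<xi>, ?I \<psi>) \<in> G0" if "C0c \<Omega> \<psi>" "C1c_cyl \<Omega> \<phi>" "\<xi> \<in> X" "\<And>z. z \<in> ?Z \<Longrightarrow> \<xi> z = (\<psi> (fst z), 0) + cyl_gradient \<phi> z" for \<xi> \<psi> \<phi>
    unfolding G0_def using that by blast
  have c1: "C1_cyl \<Omega> \<phi>" if "C1c_cyl \<Omega> \<phi>" for \<phi> using that unfolding C1c_cyl_def by blast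
  have G0: "subspace G0"
  proof (rule subspaceI)
    have "(0, ?I (\<lambda>x. 0)) \<in> G0"
      by (rule G0I[OF C0c_zero zero_cyl(1)]) (use subspace_0[OF X] in \<open>auto simp: zero_cyl(2) zero_fun_def zero_prod_def\<close>)
    thus "0 \<in> G0" by (simp add: vector_integral_def zero_prod_def)
  next
    fix a b assume "a \<in> G0" "b \<in> G0"
    then obtain \<xi> \<psi> \<phi> \<xi>' \<psi>' \<phi>' where a: "a = (\<xi>, ?I \<psi>)" "C0c \<Omega> \<psi>" "C1c_cyl \<Omega> \<phi>" "\<xi> \<in> X" "\<And>z. z \<in> ?Z \<Longrightarrow> \<xi> z = (\<psi> (fst z), 0) + cyl_gradient \<phi> z"
      and b: "b = (\<xi>', ?I \<psi>')" "C0c \<Omega> \<psi>'" "C1c_cyl \<Omega> \<phi>'" "\<xi>' \<in> X" "\<And>z. z \<in> ?Z \<Longrightarrow> \<xi>' z = (\<psi>' (fst z), 0) + cyl_gradient \<phi>' z"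
      unfolding G0_def by blast
    have "(\<xi> + \<xi>', ?I (\<lambda>x. \<psi> x + \<psi>' x)) \<in> G0"
    proof (rule G0I[OF C0c_add[OF a(2) b(2)]])
      show "C1c_cyl \<Omega> (\<lambda>z. \<phi> z + \<phi>' z)" by (rule C1c_cyl_add[OF a(3) b(3)])
      show "\<xi> + \<xi>' \<in> X" by (rule subspace_add[OF X a(4) b(4)])
      fix z :: "(real^2) \<times> (real^2)" assume z: "z \<in> ?Z"
      have "cyl_gradient (\<lambda>z. \<phi> z + \<phi>' z) (fst z, snd z) = cyl_gradient \<phi> (fst z, snd z) + cyl_gradient \<phi>' (fst z, snd z)"
        using z by (intro cyl_gradient_add(2)[OF c1[OF a(3)] c1[OF b(3)]]) auto
      thus "(\<xi> + \<xi>') z = (\<psi> (fst z) + \<psi>' (fst z), 0) + cyl_gradient (\<lambda>z. \<phi> z + \<phi>' z) z"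
        using a(5)[OF z] b(5)[OF z] by (simp add: prod_eq_iff)
    qed
    thus "a + b \<in> G0"
      using vector_integral_add[OF vD C0c_bounded_measurable[OF a(2)] C0c_bounded_measurable[OF b(2)]]
      by (simp add: a(1) b(1))
  next
    fix c :: real and a assume "a \<in> G0"
    then obtain \<xi> \<psi> \<phi> where a: "a = (\<xi>, ?I \<psi>)" "C0c \<Omega> \<psi>" "C1c_cyl \<Omega> \<phi>" "\<xi> \<in> X" "\<And>z. z \<in> ?Z \<Longrightarrow> \<xi> z = (\<psi> (fst z), 0) + cyl_gradient \<phi> z"
      unfolding G0_def by blast
    have "(c *\<^sub>R \<xi>, ?I (\<lambda>x. c *\<^sub>R \<psi> x)) \<in> G0"
    proof (rule G0I[OF C0c_scaleR[OF a(2)]])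
      show "C1c_cyl \<Omega> (\<lambda>z. c * \<phi> z)" by (rule C1c_cyl_scale[OF a(3)])
      show "c *\<^sub>R \<xi> \<in> X" by (rule subspace_scale[OF X a(4)])
      fix z :: "(real^2) \<times> (real^2)" assume z: "z \<in> ?Z"
      have "cyl_gradient (\<lambda>z. c * \<phi> z) (fst z, snd z) = c *\<^sub>R cyl_gradient \<phi> (fst z, snd z)"
        using z by (intro cyl_gradient_scale(2)[OF c1[OF a(3)]]) auto
      thus "(c *\<^sub>R \<xi>) z = (c *\<^sub>R \<psi> (fst z), 0) + cyl_gradient (\<lambda>z. c * \<phi> z) z"
        using a(5)[OF z] by (simp add: prod_eq_iff scaleR_fun_def scaleR_add_right distrib_left)
    qed
    thus "c *\<^sub>R a \<in> G0" by (simp add: a(1) vector_integral_scaleR)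
  qed
  have dom: "\<xi> \<in> X \<and> r \<le> p \<xi>" if G: "(\<xi>, r) \<in> G0" for \<xi> r
  proof -
    obtain \<psi> \<phi> where a: "r = ?I \<psi>" "C0c \<Omega> \<psi>" "C1c_cyl \<Omega> \<phi>" "\<xi> \<in> X" "\<And>z. z \<in> ?Z \<Longrightarrow> \<xi> z = (\<psi> (fst z), 0) + cyl_gradient \<phi> z"
      using G unfolding G0_def by blast
    have le: "r \<le> S * t" if t: "0 < t" "(1 / t) *\<^sub>R \<xi> \<in> K" for t
    proof -
      have "?I (\<lambda>x. (1 / t) *\<^sub>R \<psi> x) \<le> S"
      proof (rule S[OF C0c_scaleR[OF a(2)]])
        show "C1c_cyl \<Omega> (\<lambda>z. (1 / t) * \<phi> z)" by (rule C1c_cyl_scale[OF a(3)])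
        show "dual_constraint \<Omega> f (\<lambda>x. (1 / t) *\<^sub>R \<psi> x) (\<lambda>z. (1 / t) * \<phi> z)"
          unfolding dual_constraint_iff
        proof (intro ballI)
          fix x v :: "real^2" assume x: "x \<in> \<Omega>" and v: "v \<in> circle"
          have z: "(x, v) \<in> ?Z" using x v by simp
          have "((1 / t) *\<^sub>R \<psi> x, 0) + cyl_gradient (\<lambda>z. (1 / t) * \<phi> z) (x, v) = ((1 / t) *\<^sub>R \<xi>) (x, v)"
            unfolding cyl_gradient_scale(2)[OF c1[OF a(3)] x] using a(5)[OF z]
            by (simp add: prod_eq_iff scaleR_fun_def scaleR_add_right add_divide_distrib)
          thus "affine_minorant f (v \<bullet> fst (((1 / t) *\<^sub>R \<psi> x, 0) + cyl_gradient (\<lambda>z. (1 / t) * \<phi> z) (x, v)))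
              (snd (((1 / t) *\<^sub>R \<psi> x, 0) + cyl_gradient (\<lambda>z. (1 / t) * \<phi> z) (x, v)))"
            using t(2) z unfolding K_def by fastforce
        qed
      qed
      thus ?thesis using t(1) unfolding vector_integral_scaleR a(1)[symmetric] by (simp add: pos_divide_le_eq)
    qed
    obtain t0 where t0: "0 < t0" "(1 / t0) *\<^sub>R \<xi> \<in> K" using absorb'[OF a(4)] by blast
    have "r \<le> p \<xi>"
    proof (cases "S = 0")
      case True thus ?thesis using le[OF t0] by (simp add: p_def)
    next
      case False
      hence S: "S > 0" using S0 by simp
      have "r / S \<le> gauge_of K \<xi>"
        by (rule gauge_of_ge[OF t0]) (use le S in \<open>simp add: pos_divide_le_eq mult.commute\<close>)
      thus ?thesis using S by (simp add: p_def pos_divide_le_eq mult.commute)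
    qed
    thus ?thesis using a(4) by simp
  qed
  have p_add: "p (\<xi> + \<zeta>) \<le> p \<xi> + p \<zeta>" if X: "\<xi> \<in> X" "\<zeta> \<in> X" for \<xi> \<zeta>
  proof -
    obtain s t where "0 < s" "(1 / s) *\<^sub>R \<xi> \<in> K" "0 < t" "(1 / t) *\<^sub>R \<zeta> \<in> K"
      using absorb'[OF X(1)] absorb'[OF X(2)] by blast
    hence "gauge_of K (\<xi> + \<zeta>) \<le> gauge_of K \<xi> + gauge_of K \<zeta>" by (rule gauge_of_add[OF K])
    thus ?thesis unfolding p_def distrib_left[symmetric] using S0 by (rule mult_left_mono)
  qed
  have p_scale: "p (c *\<^sub>R \<xi>) = c * p \<xi>" if "\<xi> \<in> X" "0 \<le> c" for \<xi> c
    using absorb'[OF that(1)] gauge_of_scale[OF K0 _ _ that(2)] by (auto simp: p_def)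
  obtain L where L: "\<And>\<xi> \<zeta>. \<xi> \<in> X \<Longrightarrow> \<zeta> \<in> X \<Longrightarrow> L (\<xi> + \<zeta>) = L \<xi> + L \<zeta>"
    "\<And>\<xi> c. \<xi> \<in> X \<Longrightarrow> L (c *\<^sub>R \<xi>) = c * L \<xi>" "\<And>\<xi>. \<xi> \<in> X \<Longrightarrow> L \<xi> \<le> p \<xi>" "\<And>\<xi> r. (\<xi>, r) \<in> G0 \<Longrightarrow> L \<xi> = r"
    using Hahn_Banach_dominated[OF X p_add p_scale G0 dom] by blast
  have Lle: "L \<xi> \<le> S / \<gamma> * B" if \<xi>: "C0c ?Z \<xi>" and B: "0 \<le> B" "\<And>z. z \<in> ?Z \<Longrightarrow> norm (\<xi> z) \<le> B" for \<xi> B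
  proof -
    have "gauge_of K \<xi> \<le> B / \<gamma> + e" if e: "e > 0" for e
    proof (rule gauge_of_le)
      show t: "0 < B / \<gamma> + e" using B(1) \<gamma> e by (simp add: add_nonneg_pos)
      have "\<gamma> * (B / \<gamma> + e) = B + \<gamma> * e" using \<gamma> by (simp add: distrib_left)
      moreover have "0 < \<gamma> * e" using \<gamma> e by simp
      ultimately have "norm (\<xi> z) \<le> \<gamma> * (B / \<gamma> + e)" if "z \<in> ?Z" for z using B(2)[OF that] by linarith
      thus "(1 / (B / \<gamma> + e)) *\<^sub>R \<xi> \<in> K" by (rule absorb[OF t])
    qed
    hence "gauge_of K \<xi> \<le> B / \<gamma>" by (rule field_le_epsilon)
    hence "p \<xi> \<le> S * (B / \<gamma>)" unfolding p_def using S0 by (rule mult_left_mono)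
    thus ?thesis using L(3)[of \<xi>] \<xi> by (simp add: X_def)
  qed
  obtain \<sigma> where v: "vector_measure (borel_on ?Z) \<sigma>" and rep: "\<And>\<xi>. C0c ?Z \<xi> \<Longrightarrow> vector_integral (borel_on ?Z) \<sigma> \<xi> = L \<xi>"
  proof (rule Riesz_representation_vector[where Z="?Z" and L=L and C="S / \<gamma>"])
    fix \<xi> \<zeta> :: "(real^2) \<times> (real^2) \<Rightarrow> (real^2) \<times> real" assume "C0c ?Z \<xi>" "C0c ?Z \<zeta>"
    thus "L (\<lambda>z. \<xi> z + \<zeta> z) = L \<xi> + L \<zeta>" using L(1)[of \<xi> \<zeta>] by (simp add: X_def plus_fun_def)
  next
    fix \<xi> :: "(real^2) \<times> (real^2) \<Rightarrow> (real^2) \<times> real" and c assume "C0c ?Z \<xi>"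
    thus "L (\<lambda>z. c *\<^sub>R \<xi> z) = c * L \<xi>" using L(2)[of \<xi> c] by (simp add: X_def scaleR_fun_def)
  next
    fix \<xi> :: "(real^2) \<times> (real^2) \<Rightarrow> (real^2) \<times> real" and B :: real assume \<xi>: "C0c ?Z \<xi>" and B: "0 \<le> B" "\<And>z. z \<in> ?Z \<Longrightarrow> norm (\<xi> z) \<le> B"
    have "L \<xi> \<le> S / \<gamma> * B" by (rule Lle[OF \<xi> B])
    moreover have "L (\<lambda>z. (-1) *\<^sub>R \<xi> z) \<le> S / \<gamma> * B" by (rule Lle[OF C0c_scaleR[OF \<xi>] B(1)]) (use B(2) in simp)
    moreover have "L (\<lambda>z. (-1) *\<^sub>R \<xi> z) = - L \<xi>" using L(2)[of \<xi> "-1"] \<xi> by (simp add: X_def scaleR_fun_def)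
    ultimately show "\<bar>L \<xi>\<bar> \<le> S / \<gamma> * B" by linarith
  qed blast
  have "div_free \<Omega> \<sigma>"
    unfolding div_free_def
  proof (intro allI impI)
    fix \<phi> assume \<phi>: "C1c_cyl \<Omega> \<phi>"
    have c: "C0c ?Z (cyl_gradient \<phi>)" by (rule C0c_cyl_gradient[OF \<Omega>(1) \<phi>])
    have "(cyl_gradient \<phi>, ?I (\<lambda>x. 0)) \<in> G0"
      by (rule G0I[OF C0c_zero \<phi>]) (use c in \<open>auto simp: X_def zero_prod_def[symmetric]\<close>)
    thus "vector_integral (borel_on ?Z) \<sigma> (cyl_gradient \<phi>) = 0"
      using L(4) rep[OF c] by (simp add: vector_integral_def)
  qed
  moreover have "has_marginal \<Omega> u \<sigma>"
    unfolding has_marginal_def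
  proof (intro allI impI)
    fix \<phi> :: "real^2 \<Rightarrow> real^2" assume \<phi>: "C1c \<Omega> \<phi>"
    have p\<phi>: "C0c \<Omega> (\<lambda>x. perp (\<phi> x))" by (rule C0c_linear_image[OF bounded_linear_perp C1c_C0c[OF \<phi>]])
    have c: "C0c ?Z (\<lambda>z. (perp (\<phi> (fst z)), 0 :: real))" by (rule C0c_horizontal[OF p\<phi>])
    have "((\<lambda>z. (perp (\<phi> (fst z)), 0)), ?I (\<lambda>x. perp (\<phi> x))) \<in> G0"
      by (rule G0I[OF p\<phi> zero_cyl(1)]) (use c in \<open>auto simp: X_def zero_cyl(2)\<close>)
    hence 1: "vector_integral (borel_on ?Z) \<sigma> (\<lambda>z. (perp (\<phi> (fst z)), 0)) = ?I (\<lambda>x. perp (\<phi> x))"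
      using L(4) rep[OF c] by simp
    have "vector_integral (borel_on ?Z) (\<lambda>A. fst (\<sigma> A)) (\<lambda>z. perp (\<phi> (fst z))) = vector_integral (borel_on ?Z) \<sigma> (\<lambda>z. (perp (\<phi> (fst z)), 0))"
      by (intro vector_integral_fst[OF v] C0c_bounded_measurable C0c_comp_fst p\<phi> compact_sphere)
    moreover have "?I (\<lambda>x. perp (\<phi> x)) = vector_integral (borel_on \<Omega>) (BV_deriv \<Omega> u) (\<lambda>x. - perp (perp (\<phi> x)))"
      by (rule vector_integral_BV_deriv_perp[OF u C0c_bounded_measurable[OF p\<phi>]])
    moreover have "- perp (perp x) = x" for x by (simp add: vec_eq_iff forall_2)
    ultimately show "vector_integral (borel_on ?Z) (\<lambda>A. fst (\<sigma> A)) (\<lambda>(x, v). perp (\<phi> x)) = vector_integral (borel_on \<Omega>) (BV_deriv \<Omega> u) \<phi>"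
      using 1 by (simp add: case_prod_unfold)
  qed
  moreover have "h_integral \<Omega> f \<sigma> \<le> ennreal S"
  proof (rule h_integral_le[OF \<Omega> cv lsc pos v])
    fix \<xi> :: "(real^2) \<times> (real^2) \<Rightarrow> (real^2) \<times> real"
    assume \<xi>: "C0c ?Z \<xi>" "\<And>z. z \<in> ?Z \<Longrightarrow> affine_minorant f (snd z \<bullet> fst (\<xi> z)) (snd (\<xi> z))"
    have "gauge_of K \<xi> \<le> 1" by (rule gauge_of_le) (use \<xi>(2) in \<open>auto simp: K_def\<close>)
    hence "p \<xi> \<le> S * 1" unfolding p_def using S0 by (rule mult_left_mono)
    thus "vector_integral (borel_on ?Z) \<sigma> \<xi> \<le> S" using L(3)[of \<xi>] \<xi>(1) rep[OF \<xi>(1)] by (simp add: X_def)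
  qed
  ultimately show ?thesis unfolding F_def using v by (intro INF_lower2[of \<sigma>]) auto
qed

theorem proposition3p3:
  fixes \<Omega> :: "(real^2) set" and f :: "real \<Rightarrow> ennreal" and \<gamma> :: real and u :: "real^2 \<Rightarrow> real"
  assumes "open \<Omega>" and "connected \<Omega>" and "\<Omega> \<noteq> {}" and "bounded \<Omega>" and "lipschitz_boundary \<Omega>"
    and "convex_ext f" and "lower_semicont f"
    and "\<gamma> > 0" and "\<And>t. f t \<ge> ennreal (\<gamma> * sqrt (1 + t\<^sup>2))"
    and "u \<in> BV \<Omega>"
  shows "(connected (frontier \<Omega>) \<longrightarrow>
           enn2ereal (F \<Omega> f u) =
             (SUP \<psi>\<in>{\<psi>. C0c \<Omega> \<psi> \<and> (\<exists>\<phi>. C1c_cyl \<Omega> \<phi> \<and> dual_constraint \<Omega> f \<psi> \<phi>)}.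
                ereal (vector_integral (borel_on \<Omega>) (BV_deriv_perp \<Omega> u) \<psi>))) \<and>
         (\<not> connected (frontier \<Omega>) \<longrightarrow>
           enn2ereal (F \<Omega> f u) =
             (SUP \<psi>\<in>{\<psi>. C0c \<Omega> \<psi> \<and>
                        (\<exists>\<phi>. C1_cyl \<Omega> \<phi> \<and> C0c (\<Omega> \<times> circle) (cyl_gradient \<phi>) \<and> dual_constraint \<Omega> f \<psi> \<phi>)}.
                ereal (vector_integral (borel_on \<Omega>) (BV_deriv_perp \<Omega> u) \<psi>)))"
proof -
  let ?I = "vector_integral (borel_on \<Omega>) (BV_deriv_perp \<Omega> u)"
  let ?A = "{\<psi>. C0c \<Omega> \<psi> \<and> (\<exists>\<phi>. C1c_cyl \<Omega> \<phi> \<and> dual_constraint \<Omega> f \<psi> \<phi>)}"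
  let ?B = "{\<psi>. C0c \<Omega> \<psi> \<and> (\<exists>\<phi>. C1_cyl \<Omega> \<phi> \<and> C0c (\<Omega> \<times> circle) (cyl_gradient \<phi>) \<and> dual_constraint \<Omega> f \<psi> \<phi>)}"
  have pos: "f t > 0" for t
  proof -
    have "0 < \<gamma> * sqrt (1 + t\<^sup>2)" using assms(8) by (simp add: add_pos_nonneg)
    thus ?thesis using assms(9)[of t] by (metis ennreal_less_zero_iff less_le_trans)
  qed
  have lower: "enn2ereal (F \<Omega> f u) \<le> (SUP \<psi>\<in>?A. ereal (?I \<psi>))"
  proof (rule ereal_le_real)
    fix S :: real assume S: "(SUP \<psi>\<in>?A. ereal (?I \<psi>)) \<le> ereal S"
    have "?I \<psi> \<le> S" if "C0c \<Omega> \<psi>" "C1c_cyl \<Omega> \<phi>" "dual_constraint \<Omega> f \<psi> \<phi>" for \<psi> \<phi>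
    proof -
      have "ereal (?I \<psi>) \<le> (SUP \<psi>\<in>?A. ereal (?I \<psi>))" by (rule SUP_upper) (use that in blast)
      thus ?thesis using S order_trans ereal_less_eq(3) by blast
    qed
    note bd = this
    have "F \<Omega> f u \<le> ennreal S"
      by (rule strong_duality[OF assms(1,3,6,7,8,9,10)]) (rule bd)
    hence 1: "enn2ereal (F \<Omega> f u) \<le> enn2ereal (ennreal S)" by (simp add: less_eq_ennreal.rep_eq)
    have "?I (\<lambda>x. 0) \<le> S"
      by (rule bd[OF C0c_zero zero_cyl(1) zero_dual_constraint[OF assms(8,9)]])
    hence "0 \<le> S" by (simp add: vector_integral_def)
    with 1 show "enn2ereal (F \<Omega> f u) \<le> ereal S" by (simp add: enn2ereal_ennreal)
  qed
  have mid: "(SUP \<psi>\<in>?A. ereal (?I \<psi>)) \<le> (SUP \<psi>\<in>?B. ereal (?I \<psi>))"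
  proof (rule SUP_subset_mono)
    show "?A \<subseteq> ?B" using C0c_cyl_gradient[OF assms(1)] unfolding C1c_cyl_def by blast
  qed simp
  have upper: "(SUP \<psi>\<in>?B. ereal (?I \<psi>)) \<le> enn2ereal (F \<Omega> f u)"
  proof (rule SUP_least, clarify)
    fix \<psi> \<phi> assume d: "C0c \<Omega> \<psi>" "C1_cyl \<Omega> \<phi>" "C0c (\<Omega> \<times> circle) (cyl_gradient \<phi>)" "dual_constraint \<Omega> f \<psi> \<phi>"
    have "ennreal (?I \<psi>) \<le> F \<Omega> f u"
      unfolding F_def
      by (rule INF_greatest) (use weak_duality[OF assms(1,3,6,7) pos assms(10) _ _ _ d] in blast)
    hence "enn2ereal (ennreal (?I \<psi>)) \<le> enn2ereal (F \<Omega> f u)" by (simp add: less_eq_ennreal.rep_eq)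
    moreover have "ereal (?I \<psi>) \<le> enn2ereal (ennreal (?I \<psi>))"
      by (cases "0 \<le> ?I \<psi>") (auto simp: enn2ereal_ennreal ennreal_neg zero_ennreal.rep_eq)
    ultimately show "ereal (?I \<psi>) \<le> enn2ereal (F \<Omega> f u)" by (rule order_trans[rotated])
  qed
  show ?thesis using lower mid upper by (auto intro: antisym order_trans)
qed

end
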